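(* Let $T>0$ and let $X=(X_t)_{t\in[0,T]}$ be a zero-mean Gaussian process with $X_0=0$ having the Orey index $\gamma\in(0,1)$ and satisfying condition (C2) of the context with constant $\kappa>0$. With the normalized increments defined using $\kappa$ and $\gamma$ as in the context, assume that there is a constant $C$ such that for all $n$ $$\max_{1\le k\le in-1}\ \sum_{j=1}^{in-1}\big|d^{\widehat X,in}_{j,k}\big|\le C,\qquad i=1,2,$$ that, for the fractional Brownian motion $B^\gamma$ with Hurst index $\gamma$, $$\frac1n\Big(\operatorname{cov}\big(i^{-1}V^{\widehat X}_{in,T},\,j^{-1}V^{\widehat X}_{jn,T}\big)-\operatorname{cov}\big(i^{-1}V^{\widehat B^\gamma}_{in,T},\,j^{-1}V^{\widehat B^\gamma}_{jn,T}\big)\Big)\xrightarrow[n\to\infty]{}0\qquad\text{for all } i,j\in\{1,2\},$$ and that $$\sqrt n\,\big((in)^{-1}\mathbf{E}V^{\widehat X}_{in,T}-1\big)\xrightarrow[n\to\infty]{}0,\qquad i=1,2.$$ Define $$\widehat\gamma_n=\frac12-\frac{1}{2\ln2}\ln\left(\frac{\sum_{k=1}^{2n-1}\big(\Delta^{(2)}_{2n,k}X\big)^2}{\sum_{k=1}^{n-1}\big(\Delta^{(2)}_{n,k}X\big)^2}\right).$$ Then, as $n\to\infty$, $\widehat\gamma_n\to\gamma$ almost surely and $$2\ln2\,\sqrt n\,(\widehat\gamma_n-\gamma)\xrightarrow{\ d\ }\mathcal N(0;\sigma_\gamma^2),\qquad \sigma_\gamma^2=\tfrac32\Sigma_{11}-2\Sigma_{12},$$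 where $\Sigma_{11},\Sigma_{12}$ are the numbers (depending on $\gamma$) defined in the context.
   Context: **Orey index.** Put $\sigma_X^2(s,t)=\mathbf{E}[X_t-X_s]^2$, $\sigma_X=\sqrt{\sigma_X^2}$. Let $\Psi$ be the set of functions $f$ on $(0,T)$, regularly varying at zero with index $1$, such that $f(h)/h\to\infty$ as $h\downarrow0$. For $\varphi\in\Psi$ let $$\gamma_*(\varphi)=\inf\Big\{g>0:\lim_{h\downarrow0}\sup_{\varphi(h)\le s\le T-h}\frac{h^g}{\sigma_X(s,s+h)}=0\Big\},\quad \widetilde\gamma_*=\inf\Big\{g>0:\lim_{h\downarrow0}\frac{h^g}{\sigma_X(0,h)}=0\Big\},$$ $$\gamma^*(\varphi)=\sup\Big\{g>0:\lim_{h\downarrow0}\inf_{\varphi(h)\le s\le T-h}\frac{h^g}{\sigma_X(s,s+h)}=+\infty\Big\},\quad \widetilde\gamma^*=\sup\Big\{g>0:\lim_{h\downarrow0}\frac{h^g}{\sigma_X(0,h)}=+\infty\Big\}.$$ If $\sup_{0\le s\le T-h}\sigma_X(s,s+h)\to0$ as $h\to0$ and $\gamma_*(\varphi)=\widetilde\gamma_*=\gamma^*(\varphi)=\widetilde\gamma^*$ for every $\varphi\in\Psi$, then $X$ is said to have the Orey index $\gamma_X=\widetilde\gamma_*=\widetilde\gamma^*$. **Condition (C2)** (with constant $\kappa>0$): for every $\varphi\in\Psi$, $$\sup_{\varphi(\delta)\le t\le T-\delta}\ \sup_{0<h\le\delta}\Big|\frac{\sigma_X(t,t+h)}{\kappa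 h^\gamma}-1\Big|\longrightarrow0\quad\text{as }\delta\downarrow0.$$ **Increments.** For an integer $N\ge2$ (used with $N=in$, the product of $i\in\{1,2\}$ and $n$) and $1\le k\le N-1$ put $$\Delta^{(2)}_{N,k}X=X_{\frac{k+1}{N}T}-2X_{\frac kN T}+X_{\frac{k-1}{N}T},\qquad \Delta^{(2)}_{N,k}\widehat X=\frac{\Delta^{(2)}_{N,k}X}{\kappa\sqrt{4-2^{2\gamma}}\,(T/N)^\gamma},$$ $$V^{\widehat X}_{N,T}=\sum_{k=1}^{N-1}\big(\Delta^{(2)}_{N,k}\widehat X\big)^2,\qquad d^{\widehat X,N}_{j,k}=\mathbf{E}\big[\Delta^{(2)}_{N,j}\widehat X\,\Delta^{(2)}_{N,k}\widehat X\big],\quad 1\le j,k\le N-1.$$ Empty sums and maxima (case $N=1$) are taken to be $0$; $\widehat\gamma_n$ is considered for $n\ge2$. The fractional Brownian motion $B^\gamma$ is the centered Gaussian process on $[0,T]$ with $\mathbf{E}B^\gamma_tB^\gamma_s=\frac12(t^{2\gamma}+s^{2\gamma}-|t-s|^{2\gamma})$; the quantities $V^{\widehat B^\gamma}_{N,T}$ are defined by the same formulas with $X$ replaced by $B^\gamma$ and $\kappa=1$. **Constants.** $$\Sigma_{11}=2\Big(1+\frac{2}{(4-2^{2\gamma})^2}\sum_{j=1}^\infty\widehat\rho_\gamma^{\,2}(j)\Big),\qquad \Sigma_{12}=\frac{1}{2^{2\gamma}(4-2^{2\gamma})^2}\sum_{j\in\mathbb Z}\widetilde\rho_\gamma^{\,2}(j),$$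 $$\widehat\rho_\gamma(j)=\tfrac12\big[-6|j|^{2\gamma}-|j-2|^{2\gamma}-|j+2|^{2\gamma}+4|j-1|^{2\gamma}+4|j+1|^{2\gamma}\big],$$ $$\widetilde\rho_\gamma(j)=\tfrac12\big[|j+1|^{2\gamma}+2|j+2|^{2\gamma}-|j+3|^{2\gamma}+|j-1|^{2\gamma}-4|j|^{2\gamma}-|j-3|^{2\gamma}+2|j-2|^{2\gamma}\big].$$ *)

theory Defs
  imports "HOL-Probability.Probability"
begin

text \<open>The normal law with mean \<open>m\<close> and standard deviation \<open>s\<close>.  The degenerate case has to be
  included, since a Gaussian process may have linear combinations of variance zero.\<close>

definition normal_law :: "real \<Rightarrow> real \<Rightarrow> real measure" where
  "normal_law m s = (if s = 0 then return borel m else density lborel (normal_density m s))"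

text \<open>A process is indexed by all reals; only the times in \<open>{0..T}\<close> are ever constrained.\<close>

definition gaussian_process :: "'a measure \<Rightarrow> real \<Rightarrow> (real \<Rightarrow> 'a \<Rightarrow> real) \<Rightarrow> bool" where
  "gaussian_process M T X \<longleftrightarrow>
     prob_space M \<and>
     (\<forall>t\<in>{0..T}. X t \<in> borel_measurable M) \<and>
     (\<forall>F c. finite F \<longrightarrow> F \<subseteq> {0..T} \<longrightarrow>
        (\<exists>m s. 0 \<le> s \<and> distr M borel (\<lambda>\<omega>. \<Sum>t\<in>F. c t * X t \<omega>) = normal_law m s))"

definition centered_gaussian_process :: "'a measure \<Rightarrow> real \<Rightarrow> (real \<Rightarrow> 'a \<Rightarrow> real) \<Rightarrow> bool" where
  "centered_gaussian_process M T X \<longleftrightarrow>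
     gaussian_process M T X \<and> (\<forall>t\<in>{0..T}. (\<integral>\<omega>. X t \<omega> \<partial>M) = 0)"

definition fractional_brownian_motion ::
    "'a measure \<Rightarrow> real \<Rightarrow> real \<Rightarrow> (real \<Rightarrow> 'a \<Rightarrow> real) \<Rightarrow> bool" where
  "fractional_brownian_motion M T \<gamma> B \<longleftrightarrow>
     centered_gaussian_process M T B \<and>
     (\<forall>t\<in>{0..T}. \<forall>s\<in>{0..T}. (\<integral>\<omega>. B t \<omega> * B s \<omega> \<partial>M) =
        1/2 * (t powr (2*\<gamma>) + s powr (2*\<gamma>) - \<bar>t - s\<bar> powr (2*\<gamma>)))"

definition covariance :: "'a measure \<Rightarrow> ('a \<Rightarrow> real) \<Rightarrow> ('a \<Rightarrow> real) \<Rightarrow> real" where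
  "covariance M Y Z =
     (\<integral>\<omega>. (Y \<omega> - (\<integral>\<omega>'. Y \<omega>' \<partial>M)) * (Z \<omega> - (\<integral>\<omega>'. Z \<omega>' \<partial>M)) \<partial>M)"

definition incr_sd :: "'a measure \<Rightarrow> (real \<Rightarrow> 'a \<Rightarrow> real) \<Rightarrow> real \<Rightarrow> real \<Rightarrow> real" where
  "incr_sd M X s t = sqrt (\<integral>\<omega>. (X t \<omega> - X s \<omega>)\<^sup>2 \<partial>M)"

text \<open>As usual, a regularly varying function is positive and measurable.\<close>

definition regularly_varying_at_zero :: "real \<Rightarrow> real \<Rightarrow> (real \<Rightarrow> real) \<Rightarrow> bool" where
  "regularly_varying_at_zero T \<rho> f \<longleftrightarrow>
     f \<in> borel_measurable (restrict_space borel {0<..<T}) \<and>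
     (\<forall>h\<in>{0<..<T}. 0 < f h) \<and>
     (\<forall>c>0. ((\<lambda>h. f (c * h) / f h) \<longlongrightarrow> c powr \<rho>) (at_right 0))"

definition Psi :: "real \<Rightarrow> (real \<Rightarrow> real) set" where
  "Psi T = {f. regularly_varying_at_zero T 1 f \<and> filterlim (\<lambda>h. f h / h) at_top (at_right 0)}"

text \<open>The suprema, infima and quotients below are taken in the extended reals: in particular
  \<open>h powr g / 0 = \<infinity>\<close> for \<open>h > 0\<close>, and the infimum of an empty set of exponents is \<open>\<infinity>\<close>.\<close>

definition scaled_ratio ::
    "'a measure \<Rightarrow> (real \<Rightarrow> 'a \<Rightarrow> real) \<Rightarrow> real \<Rightarrow> real \<Rightarrow> real \<Rightarrow> ereal" where
  "scaled_ratio M X g s h = ereal (h powr g) / ereal (incr_sd M X s (s + h))"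

definition gamma_lower ::
    "'a measure \<Rightarrow> real \<Rightarrow> (real \<Rightarrow> 'a \<Rightarrow> real) \<Rightarrow> (real \<Rightarrow> real) \<Rightarrow> ereal" where
  "gamma_lower M T X \<phi> = Inf {ereal g | g. 0 < g \<and>
     ((\<lambda>h. SUP s\<in>{\<phi> h..T - h}. scaled_ratio M X g s h) \<longlongrightarrow> 0) (at_right 0)}"

definition gamma_lower0 :: "'a measure \<Rightarrow> (real \<Rightarrow> 'a \<Rightarrow> real) \<Rightarrow> ereal" where
  "gamma_lower0 M X = Inf {ereal g | g. 0 < g \<and>
     ((\<lambda>h. scaled_ratio M X g 0 h) \<longlongrightarrow> 0) (at_right 0)}"

definition gamma_upper ::
    "'a measure \<Rightarrow> real \<Rightarrow> (real \<Rightarrow> 'a \<Rightarrow> real) \<Rightarrow> (real \<Rightarrow> real) \<Rightarrow> ereal" where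
  "gamma_upper M T X \<phi> = Sup {ereal g | g. 0 < g \<and>
     ((\<lambda>h. INF s\<in>{\<phi> h..T - h}. scaled_ratio M X g s h) \<longlongrightarrow> \<infinity>) (at_right 0)}"

definition gamma_upper0 :: "'a measure \<Rightarrow> (real \<Rightarrow> 'a \<Rightarrow> real) \<Rightarrow> ereal" where
  "gamma_upper0 M X = Sup {ereal g | g. 0 < g \<and>
     ((\<lambda>h. scaled_ratio M X g 0 h) \<longlongrightarrow> \<infinity>) (at_right 0)}"

definition has_Orey_index :: "'a measure \<Rightarrow> real \<Rightarrow> (real \<Rightarrow> 'a \<Rightarrow> real) \<Rightarrow> real \<Rightarrow> bool" where
  "has_Orey_index M T X \<gamma> \<longleftrightarrow>
     ((\<lambda>h. SUP s\<in>{0..T - h}. ereal (incr_sd M X s (s + h))) \<longlongrightarrow> 0) (at_right 0) \<and>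
     gamma_lower0 M X = ereal \<gamma> \<and> gamma_upper0 M X = ereal \<gamma> \<and>
     (\<forall>\<phi>\<in>Psi T. gamma_lower M T X \<phi> = ereal \<gamma> \<and> gamma_upper M T X \<phi> = ereal \<gamma>)"

definition condition_C2 ::
    "'a measure \<Rightarrow> real \<Rightarrow> (real \<Rightarrow> 'a \<Rightarrow> real) \<Rightarrow> real \<Rightarrow> real \<Rightarrow> bool" where
  "condition_C2 M T X \<kappa> \<gamma> \<longleftrightarrow>
     (\<forall>\<phi>\<in>Psi T.
        ((\<lambda>\<delta>. SUP t\<in>{\<phi> \<delta>..T - \<delta>}. SUP h\<in>{0<..\<delta>}.
             ereal \<bar>incr_sd M X t (t + h) / (\<kappa> * h powr \<gamma>) - 1\<bar>) \<longlongrightarrow> 0) (at_right 0))"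

definition incr2 :: "real \<Rightarrow> (real \<Rightarrow> 'a \<Rightarrow> real) \<Rightarrow> nat \<Rightarrow> nat \<Rightarrow> 'a \<Rightarrow> real" where
  "incr2 T X N k \<omega> =
     X ((real k + 1) / real N * T) \<omega> - 2 * X (real k / real N * T) \<omega>
       + X ((real k - 1) / real N * T) \<omega>"

definition nincr2 ::
    "real \<Rightarrow> real \<Rightarrow> real \<Rightarrow> (real \<Rightarrow> 'a \<Rightarrow> real) \<Rightarrow> nat \<Rightarrow> nat \<Rightarrow> 'a \<Rightarrow> real" where
  "nincr2 \<kappa> \<gamma> T X N k \<omega> =
     incr2 T X N k \<omega> / (\<kappa> * sqrt (4 - 2 powr (2*\<gamma>)) * (T / real N) powr \<gamma>)"

definition quad_var ::
    "real \<Rightarrow> real \<Rightarrow> real \<Rightarrow> (real \<Rightarrow> 'a \<Rightarrow> real) \<Rightarrow> nat \<Rightarrow> 'a \<Rightarrow> real" where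
  "quad_var \<kappa> \<gamma> T X N \<omega> = (\<Sum>k=1..N-1. (nincr2 \<kappa> \<gamma> T X N k \<omega>)\<^sup>2)"

definition incr_cov ::
    "'a measure \<Rightarrow> real \<Rightarrow> real \<Rightarrow> real \<Rightarrow> (real \<Rightarrow> 'a \<Rightarrow> real) \<Rightarrow> nat \<Rightarrow> nat \<Rightarrow> nat \<Rightarrow> real" where
  "incr_cov M \<kappa> \<gamma> T X N j k =
     (\<integral>\<omega>. nincr2 \<kappa> \<gamma> T X N j \<omega> * nincr2 \<kappa> \<gamma> T X N k \<omega> \<partial>M)"

definition max_row_sum ::
    "'a measure \<Rightarrow> real \<Rightarrow> real \<Rightarrow> real \<Rightarrow> (real \<Rightarrow> 'a \<Rightarrow> real) \<Rightarrow> nat \<Rightarrow> real" where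
  "max_row_sum M \<kappa> \<gamma> T X N =
     (if N \<le> 1 then 0
      else MAX k\<in>{1..N-1}. \<Sum>j=1..N-1. \<bar>incr_cov M \<kappa> \<gamma> T X N j k\<bar>)"

definition gamma_hat :: "real \<Rightarrow> (real \<Rightarrow> 'a \<Rightarrow> real) \<Rightarrow> nat \<Rightarrow> 'a \<Rightarrow> real" where
  "gamma_hat T X n \<omega> =
     1/2 - 1 / (2 * ln 2) *
       ln ((\<Sum>k=1..2*n-1. (incr2 T X (2*n) k \<omega>)\<^sup>2) / (\<Sum>k=1..n-1. (incr2 T X n k \<omega>)\<^sup>2))"

definition rho_hat :: "real \<Rightarrow> int \<Rightarrow> real" where
  "rho_hat \<gamma> j = 1/2 *
     (- 6 * \<bar>real_of_int j\<bar> powr (2*\<gamma>)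
      - \<bar>real_of_int (j - 2)\<bar> powr (2*\<gamma>) - \<bar>real_of_int (j + 2)\<bar> powr (2*\<gamma>)
      + 4 * \<bar>real_of_int (j - 1)\<bar> powr (2*\<gamma>) + 4 * \<bar>real_of_int (j + 1)\<bar> powr (2*\<gamma>))"

definition rho_tilde :: "real \<Rightarrow> int \<Rightarrow> real" where
  "rho_tilde \<gamma> j = 1/2 *
     (\<bar>real_of_int (j + 1)\<bar> powr (2*\<gamma>) + 2 * \<bar>real_of_int (j + 2)\<bar> powr (2*\<gamma>)
      - \<bar>real_of_int (j + 3)\<bar> powr (2*\<gamma>) + \<bar>real_of_int (j - 1)\<bar> powr (2*\<gamma>)
      - 4 * \<bar>real_of_int j\<bar> powr (2*\<gamma>) - \<bar>real_of_int (j - 3)\<bar> powr (2*\<gamma>)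
      + 2 * \<bar>real_of_int (j - 2)\<bar> powr (2*\<gamma>))"

definition Sigma11 :: "real \<Rightarrow> real" where
  "Sigma11 \<gamma> =
     2 * (1 + 2 / (4 - 2 powr (2*\<gamma>))\<^sup>2 * (\<Sum>j. (rho_hat \<gamma> (int (Suc j)))\<^sup>2))"

definition Sigma12 :: "real \<Rightarrow> real" where
  "Sigma12 \<gamma> =
     1 / (2 powr (2*\<gamma>) * (4 - 2 powr (2*\<gamma>))\<^sup>2) * (\<Sum>\<^sub>\<infinity>j\<in>UNIV. (rho_tilde \<gamma> j)\<^sup>2)"

definition asymp_var :: "real \<Rightarrow> real" where
  "asymp_var \<gamma> = 3/2 * Sigma11 \<gamma> - 2 * Sigma12 \<gamma>"

end

theory Submission
  imports Defs
begin

text \<open>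
  Write \<open>x\<^sub>N = V\<^sub>N / N\<close> for the averaged quadratic variation of the normalized second
  differences with mesh \<open>T / N\<close>.  The estimator is an explicit function of two of these averages:
  \<open>2 ln 2 (gamma_hat - \<gamma>) = ln x\<^sub>n - ln x\<^sub>2\<^sub>n\<close> (lemma \<open>gamma_hat_eq\<close>).  So
  everything follows from the behaviour of \<open>V\<^sub>N\<close>, which is a quadratic form in jointly Gaussian
  variables.

  The central fact about such a form, centred as \<open>F = (\<Sum>i. a\<^sub>i (Y\<^sub>i\<^sup>2 - E Y\<^sub>i\<^sup>2))\<close>, is the
  recursion \<open>E F\<^sup>k\<^sup>+\<^sup>1 = k E (F\<^sup>k\<^sup>-\<^sup>1 G)\<close> with
  \<open>G = 2 (\<Sum>i j. a\<^sub>i a\<^sub>j c\<^sub>i\<^sub>j Y\<^sub>i Y\<^sub>j)\<close>, where \<open>c\<^sub>i\<^sub>j\<close> are the covariances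
  (lemma \<open>expectation_qform_power_Suc\<close>).  It comes from Gaussian integration by parts, which for
  polynomials is proved by differentiating the one-dimensional moment recursion along lines in the
  Gaussian space (lemma \<open>gaussian_integration_by_parts_power\<close>).  The mean of \<open>G\<close> is the
  variance of \<open>F\<close>.  If \<open>G\<close> were constant, the recursion would be that of the moments of a normal
  law; and when the rows of \<open>(c\<^sub>i\<^sub>j)\<close> are absolutely bounded and the weights of the
  form in about \<open>n\<close> variables are of order \<open>1 / \<surd>n\<close>, the variance of \<open>G\<close> tends to zero while all moments of \<open>F\<close>
  stay bounded.  Hence the moments of \<open>F\<close>, and with them its characteristic function, converge to
  those of a centred normal law (lemmas \<open>moments_qform_tendsto_normal\<close> and
  \<open>char_tendsto_normal_law\<close>).

  This is applied to \<open>F\<^sub>n = \<surd>n ((x\<^sub>n - E x\<^sub>n) - (x\<^sub>2\<^sub>n - E x\<^sub>2\<^sub>n))\<close>, a form in the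
  increments of both meshes together.  Its covariance matrix also has bounded rows, because a second
  difference of the coarse mesh is a combination of three neighbouring ones of the fine mesh.  Its
  variance has the same limit as for fractional Brownian motion, where the increments are stationary
  and the double sums of squared correlations become, after division by \<open>n\<close>, series over the
  integers; this produces \<open>\<Sigma>\<^sub>1\<^sub>1\<close> and \<open>\<Sigma>\<^sub>1\<^sub>2\<close>.

  The boundedness of the eighth moment of \<open>\<surd>N (x\<^sub>N - E x\<^sub>N)\<close> and the assumption on the
  means give \<open>\<surd>N (x\<^sub>N - 1)\<^sup>2 \<longlonglongrightarrow> 0\<close> almost surely.  This one rate yields both
  conclusions: it implies \<open>x\<^sub>N \<longlonglongrightarrow> 1\<close>, hence consistency, and it makes the quadratic error in
  \<open>ln x\<^sub>N \<approx> x\<^sub>N - 1\<close> negligible at the scale \<open>\<surd>n\<close>, so that \<open>F\<^sub>n\<close> and the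
  normalized estimation error have the same limit law.
\<close>

section \<open>Normal laws and the method of moments\<close>

lemma real_distribution_normal_law:
  assumes "0 \<le> s"
  shows "real_distribution (normal_law m s)"
proof -
  have "prob_space (return borel m)"
    by (intro prob_space_return) simp
  then have "prob_space (normal_law m s)"
    using assms prob_space_normal_density[of s m] by (auto simp: normal_law_def)
  moreover have "sets (normal_law m s) = sets borel"
    by (simp add: normal_law_def)
  ultimately show ?thesis
    by (simp add: real_distribution_def real_distribution_axioms_def)
qed

lemma integrable_normal_law_power:
  assumes "0 \<le> s"
  shows "integrable (normal_law 0 s) (\<lambda>x. x ^ k)"
proof (cases "s = 0")
  case True
  then show ?thesis
    by (simp add: normal_law_def integrable_iff_bounded nn_integral_return)
next
  case False
  with assms integrable_normal_moment[of s 0 k] show ?thesis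
    by (simp add: normal_law_def integrable_density)
qed

lemma normal_law_moment_even:
  assumes "0 \<le> s"
  shows "(\<integral>x. x ^ (2 * k) \<partial>normal_law 0 s) = fact (2 * k) / (2 ^ k * fact k) * s ^ (2 * k)"
proof (cases "s = 0")
  case True
  then show ?thesis
    by (cases k) (simp_all add: normal_law_def integral_return measure_return)
next
  case False
  with assms integral_normal_moment_even[of s 0 k] show ?thesis
    by (simp add: normal_law_def integral_density power_divide power_mult)
qed

lemma normal_law_moment_odd:
  assumes "0 \<le> s"
  shows "(\<integral>x. x ^ (2 * k + 1) \<partial>normal_law 0 s) = 0"
proof (cases "s = 0")
  case True
  then show ?thesis
    by (simp add: normal_law_def integral_return)
next
  case False
  with assms integral_normal_moment_odd[of s 0 k] show ?thesis
    by (simp add: normal_law_def integral_density)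
qed

lemma normal_law_moment_Suc_Suc:
  assumes "0 \<le> s"
  shows "(\<integral>x. x ^ (k + 2) \<partial>normal_law 0 s) = real (k + 1) * s\<^sup>2 * (\<integral>x. x ^ k \<partial>normal_law 0 s)"
proof (cases "even k")
  case True
  then obtain j where j: "k = 2 * j" by (elim evenE)
  have "k + 2 = 2 * Suc j" using j by simp
  then have "(\<integral>x. x ^ (k + 2) \<partial>normal_law 0 s)
      = fact (2 * Suc j) / (2 ^ Suc j * fact (Suc j)) * s ^ (2 * Suc j)"
    using normal_law_moment_even[OF assms, of "Suc j"] by simp
  also have "\<dots> = real (k + 1) * s\<^sup>2 * (fact (2 * j) / (2 ^ j * fact j) * s ^ (2 * j))"
  proof -
    have "fact (2 * Suc j) = (2 * (real j + 1)) * (real (k + 1) * fact (2 * j))"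
      by (simp add: j algebra_simps)
    moreover have "(2::real) ^ Suc j * fact (Suc j) = (2 * (real j + 1)) * (2 ^ j * fact j)"
      by (simp add: algebra_simps)
    moreover have "2 * (real j + 1) \<noteq> 0"
      by simp
    ultimately have "fact (2 * Suc j) / (2 ^ Suc j * fact (Suc j))
        = real (k + 1) * fact (2 * j) / (2 ^ j * fact j)"
      by (simp only: mult_divide_mult_cancel_left) simp
    then show ?thesis
      by (simp add: power2_eq_square)
  qed
  finally show ?thesis
    using normal_law_moment_even[OF assms, of j] by (simp add: j)
next
  case False
  then obtain j where j: "k = 2 * j + 1" by (elim oddE)
  have "k + 2 = 2 * Suc j + 1" using j by simp
  then show ?thesis
    using normal_law_moment_odd[OF assms, of j] normal_law_moment_odd[OF assms, of "Suc j"]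
    by (simp add: j)
qed

lemma normal_law_mean:
  assumes "0 \<le> s"
  shows "integrable (normal_law m s) (\<lambda>x. x)" "(\<integral>x. x \<partial>normal_law m s) = m"
proof -
  have "has_bochner_integral (normal_law m s) (\<lambda>x. x) m"
  proof (cases "s = 0")
    case True
    then show ?thesis
      by (simp add: normal_law_def has_bochner_integral_iff integral_return
          integrable_iff_bounded nn_integral_return)
  next
    case False
    with assms normal_moment_nz_1[of s m] show ?thesis
      by (simp add: normal_law_def has_bochner_integral_density)
  qed
  then show "integrable (normal_law m s) (\<lambda>x. x)" "(\<integral>x. x \<partial>normal_law m s) = m"
    by (auto simp: has_bochner_integral_iff)
qed

lemma summable_power_over_fact: "summable (\<lambda>k. (x::real) ^ k / fact k)"
  using summable_exp[of x] by (simp add: divide_inverse mult.commute)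

lemma norm_diff_add_less:
  fixes a b c d :: "'a::real_normed_vector"
  assumes "norm a < e / 4" "norm b < e / 4" "norm c < e / 2" "d = a - b + c"
  shows "norm d < e"
  using assms norm_triangle_ineq[of "a - b" c] norm_triangle_ineq4[of a b] by simp

text \<open>Expand the characteristic functions to order \<open>2 K\<close>.  The Taylor polynomials converge because
  the moments do, and both remainders are controlled by moments of order \<open>2 K\<close>; for the normal law
  the bound is \<open>2 (t\<^sup>2 s\<^sup>2 / 2)\<^sup>K / K!\<close>, which is small for a suitable \<open>K\<close> chosen before
  \<open>n\<close>.\<close>

lemma char_tendsto_normal_law:
  fixes N :: "nat \<Rightarrow> real measure"
  assumes N: "\<And>n. real_distribution (N n)" and s: "0 \<le> s"
    and integrable: "\<And>n k. integrable (N n) (\<lambda>x. x ^ k)"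
    and moments: "\<And>k. (\<lambda>n. \<integral>x. x ^ k \<partial>N n) \<longlonglongrightarrow> (\<integral>x. x ^ k \<partial>normal_law 0 s)"
  shows "(\<lambda>n. char (N n) t) \<longlonglongrightarrow> char (normal_law 0 s) t"
proof (rule LIMSEQ_I)
  fix e :: real assume "0 < e"
  let ?Z = "normal_law 0 s"
  let ?p = "\<lambda>N K. \<Sum>k\<le>K. (\<i> * t) ^ k / fact k * complex_of_real (\<integral>x. x ^ k \<partial>N)"
  define b where "b K N = 2 * \<bar>t\<bar> ^ (2 * K) / fact (2 * K) * (\<integral>x. x ^ (2 * K) \<partial>N)" for K and N :: "real measure"
  have approx: "cmod (char N' t - ?p N' (2 * K)) \<le> b K N'"
    if "real_distribution N'" "\<And>k. integrable N' (\<lambda>x. x ^ k)" for N' K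
    using real_distribution.char_approx1[OF that(1), of "2 * K" t] that(2)
    by (simp add: b_def power_even_abs)
  have "(\<lambda>K. 2 * ((\<bar>t\<bar>\<^sup>2 * s\<^sup>2 / 2) ^ K / fact K)) \<longlonglongrightarrow> 2 * 0"
    by (intro tendsto_mult tendsto_const summable_LIMSEQ_zero summable_power_over_fact)
  moreover have "b K ?Z = 2 * ((\<bar>t\<bar>\<^sup>2 * s\<^sup>2 / 2) ^ K / fact K)" for K
    unfolding b_def normal_law_moment_even[OF s]
    by (simp add: power_mult power_divide power_mult_distrib)
  ultimately have "(\<lambda>K. b K ?Z) \<longlonglongrightarrow> 0"
    by simp
  then obtain K where K: "b K ?Z < e / 4"
    using order_tendstoD(2)[of "\<lambda>K. b K ?Z" 0 sequentially "e / 4"] \<open>0 < e\<close>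
    by (auto simp: eventually_sequentially)
  have "(\<lambda>n. b K (N n)) \<longlonglongrightarrow> b K ?Z"
    unfolding b_def by (intro tendsto_mult tendsto_const moments)
  then have ev1: "\<forall>\<^sub>F n in sequentially. b K (N n) < e / 4"
    using K by (rule order_tendstoD)
  have "(\<lambda>n. ?p (N n) (2 * K)) \<longlonglongrightarrow> ?p ?Z (2 * K)"
    by (intro tendsto_sum tendsto_mult tendsto_const tendsto_of_real moments)
  then have ev2: "\<forall>\<^sub>F n in sequentially. dist (?p (N n) (2 * K)) (?p ?Z (2 * K)) < e / 2"
    using \<open>0 < e\<close> by (intro tendstoD) auto
  have "\<forall>\<^sub>F n in sequentially. norm (char (N n) t - char ?Z t) < e"
    using ev1 ev2
  proof eventually_elim
    case (elim n)
    have 1: "cmod (char (N n) t - ?p (N n) (2 * K)) < e / 4"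
      using approx[OF N integrable] elim(1) by (rule le_less_trans)
    have 2: "cmod (char ?Z t - ?p ?Z (2 * K)) < e / 4"
      using approx[OF real_distribution_normal_law[OF s] integrable_normal_law_power[OF s]] K
      by (rule le_less_trans)
    have 3: "char (N n) t - char ?Z t = (char (N n) t - ?p (N n) (2 * K))
        - (char ?Z t - ?p ?Z (2 * K)) + (?p (N n) (2 * K) - ?p ?Z (2 * K))"
      by simp
    show ?case
      by (rule norm_diff_add_less[OF 1 2 elim(2)[unfolded dist_norm] 3])
  qed
  then show "\<exists>no. \<forall>n\<ge>no. norm (char (N n) t - char ?Z t) < e"
    by (simp add: eventually_sequentially)
qed

section \<open>Almost sure limits and asymptotically equal variables\<close>

text \<open>The series of the variables has a finite expectation, so it converges almost surely.\<close>

lemma (in prob_space) AE_tendsto_0_if_expectations_summable: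
  fixes W :: "nat \<Rightarrow> 'a \<Rightarrow> real"
  assumes nonneg: "\<And>n \<omega>. 0 \<le> W n \<omega>" and int: "\<And>n. integrable M (W n)"
    and sum: "summable (\<lambda>n. expectation (W n))"
  shows "AE \<omega> in M. (\<lambda>n. W n \<omega>) \<longlonglongrightarrow> 0"
proof -
  have meas: "W n \<in> borel_measurable M" for n
    using int by auto
  have "(\<integral>\<^sup>+\<omega>. (\<Sum>n. ennreal (W n \<omega>)) \<partial>M) = (\<Sum>n. \<integral>\<^sup>+\<omega>. ennreal (W n \<omega>) \<partial>M)"
    using meas by (intro nn_integral_suminf) auto
  also have "\<dots> = (\<Sum>n. ennreal (expectation (W n)))"
    using int nonneg by (simp add: nn_integral_eq_integral)
  also have "\<dots> = ennreal (\<Sum>n. expectation (W n))"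
    using sum nonneg by (intro suminf_ennreal2) (auto intro: integral_nonneg_AE)
  finally have "(\<integral>\<^sup>+\<omega>. (\<Sum>n. ennreal (W n \<omega>)) \<partial>M) \<noteq> \<infinity>"
    by simp
  then have "AE \<omega> in M. (\<Sum>n. ennreal (W n \<omega>)) \<noteq> \<infinity>"
    using meas by (intro nn_integral_PInf_AE) auto
  then show ?thesis
  proof eventually_elim
    case (elim \<omega>)
    then have "summable (\<lambda>n. W n \<omega>)"
      using nonneg by (intro summable_suminf_not_top) auto
    then show ?case
      by (rule summable_LIMSEQ_zero)
  qed
qed

text \<open>Slutsky's theorem at the level of characteristic functions, by dominated convergence.\<close>

lemma (in prob_space) char_tendsto_asymptotically_equal:
  fixes F W :: "nat \<Rightarrow> 'a \<Rightarrow> real"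
  assumes F: "\<And>n. F n \<in> borel_measurable M" and W: "\<And>n. W n \<in> borel_measurable M"
    and diff: "AE \<omega> in M. (\<lambda>n. W n \<omega> - F n \<omega>) \<longlonglongrightarrow> 0"
    and lim: "(\<lambda>n. char (distr M borel (F n)) t) \<longlonglongrightarrow> c"
  shows "(\<lambda>n. char (distr M borel (W n)) t) \<longlonglongrightarrow> c"
proof -
  have char_eq: "char (distr M borel U) t = (CLINT \<omega>|M. iexp (t * U \<omega>))" if "U \<in> borel_measurable M" for U
    using that by (simp add: char_def integral_distr)
  have int: "integrable M (\<lambda>\<omega>. iexp (t * U \<omega>))" if "U \<in> borel_measurable M" for U
    using that by (intro integrable_const_bound[of _ 1]) auto
  have "(\<lambda>n. CLINT \<omega>|M. iexp (t * W n \<omega>) - iexp (t * F n \<omega>)) \<longlonglongrightarrow> (CLINT \<omega>|M. 0)"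
  proof (rule integral_dominated_convergence[where w = "\<lambda>_. 2"])
    show "AE \<omega> in M. (\<lambda>n. iexp (t * W n \<omega>) - iexp (t * F n \<omega>)) \<longlonglongrightarrow> 0"
      using diff
    proof eventually_elim
      case (elim \<omega>)
      have "norm (iexp (t * W n \<omega>) - iexp (t * F n \<omega>)) = norm (iexp (t * (W n \<omega> - F n \<omega>)) - 1)" for n
      proof -
        have arg: "t * W n \<omega> = t * F n \<omega> + t * (W n \<omega> - F n \<omega>)"
          by (simp add: right_diff_distrib)
        have "iexp (t * W n \<omega>) = iexp (t * F n \<omega>) * iexp (t * (W n \<omega> - F n \<omega>))"
          by (subst arg) (simp only: of_real_add distrib_left exp_add)
        then have "iexp (t * W n \<omega>) - iexp (t * F n \<omega>) = iexp (t * F n \<omega>) * (iexp (t * (W n \<omega> - F n \<omega>)) - 1)"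
          by (simp only: right_diff_distrib mult_1_right)
        then show ?thesis
          by (simp only: norm_mult norm_exp_i_times mult_1_left)
      qed
      moreover have "(\<lambda>n. norm (iexp (t * (W n \<omega> - F n \<omega>)) - 1)) \<longlonglongrightarrow> norm (iexp (t * 0) - 1)"
        by (intro tendsto_intros elim)
      ultimately have "(\<lambda>n. norm (iexp (t * W n \<omega>) - iexp (t * F n \<omega>))) \<longlonglongrightarrow> 0"
        by (simp only:) simp
      then show ?case
        by (rule tendsto_norm_zero_cancel)
    qed
    show "AE \<omega> in M. norm (iexp (t * W n \<omega>) - iexp (t * F n \<omega>)) \<le> 2" for n
    proof (rule AE_I2)
      fix \<omega>
      show "norm (iexp (t * W n \<omega>) - iexp (t * F n \<omega>)) \<le> 2"
        using norm_triangle_ineq4[of "iexp (t * W n \<omega>)" "iexp (t * F n \<omega>)"] by simp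
    qed
  qed (use F W in auto)
  then have "(\<lambda>n. char (distr M borel (W n)) t - char (distr M borel (F n)) t) \<longlonglongrightarrow> 0"
    using F W int by (simp add: char_eq)
  from tendsto_add[OF this lim] show ?thesis
    by simp
qed

text \<open>The error of \<open>ln x \<approx> x - 1\<close> is quadratic in \<open>x - 1\<close>, so the assumption makes it vanish even
  after multiplication by \<open>\<surd>n\<close>.\<close>

lemma log_linearization:
  fixes x :: "nat \<Rightarrow> real"
  assumes "(\<lambda>n. sqrt (real n) * (x n - 1)\<^sup>2) \<longlonglongrightarrow> 0"
  shows "x \<longlonglongrightarrow> 1" and "(\<lambda>n. sqrt (real n) * (ln (x n) - (x n - 1))) \<longlonglongrightarrow> 0"
proof -
  have "(\<lambda>n. (x n - 1)\<^sup>2) \<longlonglongrightarrow> 0"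
  proof (rule tendsto_sandwich[OF _ _ tendsto_const assms])
    show "\<forall>\<^sub>F n in sequentially. (x n - 1)\<^sup>2 \<le> sqrt (real n) * (x n - 1)\<^sup>2"
      using eventually_ge_at_top[of 1]
    proof eventually_elim
      case (elim n)
      then have "1 \<le> sqrt (real n)"
        by simp
      from mult_right_mono[OF this, of "(x n - 1)\<^sup>2"] show ?case
        by simp
    qed
  qed simp
  then have "(\<lambda>n. sqrt ((x n - 1)\<^sup>2)) \<longlonglongrightarrow> sqrt 0"
    by (rule tendsto_real_sqrt)
  then have diff: "(\<lambda>n. x n - 1) \<longlonglongrightarrow> 0"
    by (simp only: real_sqrt_abs real_sqrt_zero tendsto_rabs_zero_iff)
  from tendsto_add[OF this tendsto_const[of 1]] show "x \<longlonglongrightarrow> 1"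
    by simp
  have "\<forall>\<^sub>F n in sequentially. \<bar>x n - 1\<bar> < 1/2"
    using tendstoD[OF diff, of "1/2"] by (simp add: dist_real_def)
  then have bound: "\<forall>\<^sub>F n in sequentially. \<bar>sqrt (real n) * (ln (x n) - (x n - 1))\<bar> \<le> 2 * (sqrt (real n) * (x n - 1)\<^sup>2)"
  proof eventually_elim
    case (elim n)
    then have "\<bar>ln (1 + (x n - 1)) - (x n - 1)\<bar> \<le> 2 * (x n - 1)\<^sup>2"
      by (intro abs_ln_one_plus_x_minus_x_bound) simp
    from mult_left_mono[OF this, of "sqrt (real n)"] show ?case
      by (simp add: abs_mult mult_ac)
  qed
  show "(\<lambda>n. sqrt (real n) * (ln (x n) - (x n - 1))) \<longlonglongrightarrow> 0"
    by (rule tendsto_rabs_zero_cancel, rule tendsto_sandwich[OF _ bound tendsto_const])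
      (use tendsto_mult_right_zero[OF assms, of 2] in auto)
qed

section \<open>Polynomials in Gaussian variables and integration by parts\<close>

context prob_space
begin

text \<open>An algebra of random variables on which every expectation occurring below is finite.\<close>

definition has_moments :: "('a \<Rightarrow> real) \<Rightarrow> bool" where
  "has_moments W \<longleftrightarrow> W \<in> borel_measurable M \<and> (\<forall>p::nat. integrable M (\<lambda>\<omega>. \<bar>W \<omega>\<bar> ^ p))"

lemma has_moments_measurable: "has_moments W \<Longrightarrow> W \<in> borel_measurable M"
  by (simp add: has_moments_def)

lemma has_moments_integrable: "has_moments W \<Longrightarrow> integrable M W"
  using integrable_abs_iff[of W M] by (auto simp: has_moments_def dest: spec[of _ 1])

lemma has_moments_const [simp]: "has_moments (\<lambda>_. c)"
  by (simp add: has_moments_def)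

lemma has_moments_add [intro]:
  assumes "has_moments U" "has_moments V"
  shows "has_moments (\<lambda>\<omega>. U \<omega> + V \<omega>)"
  unfolding has_moments_def
proof (intro conjI allI)
  show meas: "(\<lambda>\<omega>. U \<omega> + V \<omega>) \<in> borel_measurable M"
    using assms by (auto simp: has_moments_def)
  fix p :: nat
  show "integrable M (\<lambda>\<omega>. \<bar>U \<omega> + V \<omega>\<bar> ^ p)"
  proof (rule Bochner_Integration.integrable_bound)
    show "integrable M (\<lambda>\<omega>. 2 ^ p * (\<bar>U \<omega>\<bar> ^ p + \<bar>V \<omega>\<bar> ^ p))"
      using assms by (auto simp: has_moments_def)
    show "(\<lambda>\<omega>. \<bar>U \<omega> + V \<omega>\<bar> ^ p) \<in> borel_measurable M"
      using meas by measurable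
    have "\<bar>u + v\<bar> ^ p \<le> 2 ^ p * (\<bar>u\<bar> ^ p + \<bar>v\<bar> ^ p)" for u v :: real
    proof -
      have "\<bar>u + v\<bar> ^ p \<le> (2 * max \<bar>u\<bar> \<bar>v\<bar>) ^ p"
        by (intro power_mono) auto
      also have "\<dots> \<le> 2 ^ p * (\<bar>u\<bar> ^ p + \<bar>v\<bar> ^ p)"
        by (auto simp: power_mult_distrib max_def)
      finally show ?thesis .
    qed
    then show "AE \<omega> in M. norm (\<bar>U \<omega> + V \<omega>\<bar> ^ p) \<le> norm (2 ^ p * (\<bar>U \<omega>\<bar> ^ p + \<bar>V \<omega>\<bar> ^ p))"
      by (auto simp: abs_mult)
  qed
qed

lemma has_moments_mult [intro]:
  assumes "has_moments U" "has_moments V"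
  shows "has_moments (\<lambda>\<omega>. U \<omega> * V \<omega>)"
  unfolding has_moments_def
proof (intro conjI allI)
  show meas: "(\<lambda>\<omega>. U \<omega> * V \<omega>) \<in> borel_measurable M"
    using assms by (auto simp: has_moments_def)
  fix p :: nat
  show "integrable M (\<lambda>\<omega>. \<bar>U \<omega> * V \<omega>\<bar> ^ p)"
  proof (rule Bochner_Integration.integrable_bound)
    show "integrable M (\<lambda>\<omega>. \<bar>U \<omega>\<bar> ^ (2 * p) + \<bar>V \<omega>\<bar> ^ (2 * p))"
      using assms by (auto simp: has_moments_def)
    show "(\<lambda>\<omega>. \<bar>U \<omega> * V \<omega>\<bar> ^ p) \<in> borel_measurable M"
      using meas by measurable
    have "\<bar>u * v\<bar> ^ p \<le> \<bar>u\<bar> ^ (2 * p) + \<bar>v\<bar> ^ (2 * p)" for u v :: real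
    proof -
      have "2 * (\<bar>u\<bar> ^ p * \<bar>v\<bar> ^ p) \<le> (\<bar>u\<bar> ^ p)\<^sup>2 + (\<bar>v\<bar> ^ p)\<^sup>2"
        using sum_squares_bound[of "\<bar>u\<bar> ^ p" "\<bar>v\<bar> ^ p"] by simp
      moreover have "0 \<le> \<bar>u\<bar> ^ p * \<bar>v\<bar> ^ p"
        by simp
      ultimately have "\<bar>u\<bar> ^ p * \<bar>v\<bar> ^ p \<le> (\<bar>u\<bar> ^ p)\<^sup>2 + (\<bar>v\<bar> ^ p)\<^sup>2"
        by linarith
      then show ?thesis
        unfolding abs_mult power_mult_distrib mult.commute[of 2 p] power_mult .
    qed
    then show "AE \<omega> in M. norm (\<bar>U \<omega> * V \<omega>\<bar> ^ p) \<le> norm (\<bar>U \<omega>\<bar> ^ (2 * p) + \<bar>V \<omega>\<bar> ^ (2 * p))"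
      by auto
  qed
qed

lemma has_moments_power [intro]: "has_moments U \<Longrightarrow> has_moments (\<lambda>\<omega>. U \<omega> ^ k)"
  by (induction k) auto

lemma has_moments_sum [intro]:
  "(\<And>i. i \<in> I \<Longrightarrow> has_moments (U i)) \<Longrightarrow> has_moments (\<lambda>\<omega>. \<Sum>i\<in>I. U i \<omega>)"
  by (induction I rule: infinite_finite_induct) auto

lemma has_moments_diff [intro]:
  "has_moments U \<Longrightarrow> has_moments V \<Longrightarrow> has_moments (\<lambda>\<omega>. U \<omega> - V \<omega>)"
  using has_moments_add[of U "\<lambda>\<omega>. - 1 * V \<omega>"] has_moments_mult[of "\<lambda>_. - 1" V] by simp

lemma has_moments_abs [intro]: "has_moments U \<Longrightarrow> has_moments (\<lambda>\<omega>. \<bar>U \<omega>\<bar>)"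
  by (auto simp: has_moments_def)

text \<open>The expectation is a polynomial in \<open>e\<close>, so only its linear coefficient has to be read off.  This
  is how identities about powers of a single variable are polarized below.\<close>

lemma has_real_derivative_expectation_perturbed_power:
  assumes U: "has_moments U" and L: "has_moments L" and Z: "has_moments Z"
  shows "((\<lambda>e. expectation (\<lambda>\<omega>. U \<omega> * (L \<omega> + e * Z \<omega>) ^ q))
    has_real_derivative real q * expectation (\<lambda>\<omega>. U \<omega> * Z \<omega> * L \<omega> ^ (q - 1))) (at 0)"
proof -
  define c where "c k = real (q choose k) * expectation (\<lambda>\<omega>. U \<omega> * Z \<omega> ^ k * L \<omega> ^ (q - k))" for k
  have "expectation (\<lambda>\<omega>. U \<omega> * (L \<omega> + e * Z \<omega>) ^ q) = (\<Sum>k\<le>q. c k * e ^ k)" for e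
  proof -
    have "U \<omega> * (L \<omega> + e * Z \<omega>) ^ q
        = (\<Sum>k\<le>q. (e ^ k * real (q choose k)) * (U \<omega> * Z \<omega> ^ k * L \<omega> ^ (q - k)))" for \<omega>
      unfolding add.commute[of "L \<omega>"] binomial_ring sum_distrib_left
      by (simp add: power_mult_distrib mult_ac)
    moreover have "integrable M (\<lambda>\<omega>. (e ^ k * real (q choose k)) * (U \<omega> * Z \<omega> ^ k * L \<omega> ^ (q - k)))" for k
      using assms by (intro has_moments_integrable has_moments_mult has_moments_power has_moments_const)
    ultimately have "expectation (\<lambda>\<omega>. U \<omega> * (L \<omega> + e * Z \<omega>) ^ q)
        = (\<Sum>k\<le>q. expectation (\<lambda>\<omega>. (e ^ k * real (q choose k)) * (U \<omega> * Z \<omega> ^ k * L \<omega> ^ (q - k))))"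
      by (simp only: Bochner_Integration.integral_sum)
    then show ?thesis
      unfolding c_def integral_mult_right_zero by (simp only: mult_ac)
  qed
  moreover have "((\<lambda>e. \<Sum>k\<le>q. c k * e ^ k) has_real_derivative (\<Sum>k\<le>q. c k * (real k * 0 ^ (k - 1)))) (at 0)"
    by (auto intro!: derivative_eq_intros sum.cong)
  moreover have "(\<Sum>k\<le>q. c k * (real k * 0 ^ (k - 1))) = (\<Sum>k\<in>{1} \<inter> {..q}. c k)"
    by (rule sum.mono_neutral_cong_right) (auto simp: power_0_left)
  moreover have "\<dots> = real q * expectation (\<lambda>\<omega>. U \<omega> * Z \<omega> * L \<omega> ^ (q - 1))"
    by (cases "q = 0") (simp_all add: c_def)
  ultimately show ?thesis
    by simp
qed

end

text \<open>A linear space of centred random variables is jointly Gaussian exactly when each member has a normal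
  law.  Closure under \<open>Y + c Z\<close> together with the zero variable expresses linearity.\<close>

locale gaussian_space = prob_space M for M :: "'a measure" +
  fixes H :: "('a \<Rightarrow> real) set"
  assumes H_measurable: "Y \<in> H \<Longrightarrow> Y \<in> borel_measurable M"
    and H_normal: "Y \<in> H \<Longrightarrow> \<exists>s\<ge>0. distr M borel Y = normal_law 0 s"
    and H_zero: "(\<lambda>_. 0) \<in> H"
    and H_add_scaled: "Y \<in> H \<Longrightarrow> Z \<in> H \<Longrightarrow> (\<lambda>\<omega>. Y \<omega> + c * Z \<omega>) \<in> H"
begin

lemma H_scale: "Z \<in> H \<Longrightarrow> (\<lambda>\<omega>. c * Z \<omega>) \<in> H"
  using H_add_scaled[OF H_zero, of Z c] by simp

lemma H_has_moments [intro]: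
  assumes "Y \<in> H"
  shows "has_moments Y"
  unfolding has_moments_def
proof (intro conjI allI)
  show "Y \<in> borel_measurable M"
    using assms by (rule H_measurable)
  fix p :: nat
  obtain s where s: "0 \<le> s" "distr M borel Y = normal_law 0 s"
    using H_normal[OF assms] by auto
  have "integrable (distr M borel Y) (\<lambda>x. \<bar>x ^ p\<bar>)"
    unfolding s(2) using integrable_normal_law_power[OF s(1), of p] by (rule integrable_abs)
  then show "integrable M (\<lambda>\<omega>. \<bar>Y \<omega>\<bar> ^ p)"
    using H_measurable[OF assms] by (simp add: integrable_distr_eq power_abs)
qed

lemma expectation_H [simp]:
  assumes "Y \<in> H"
  shows "expectation Y = 0"
proof -
  obtain s where s: "0 \<le> s" "distr M borel Y = normal_law 0 s"
    using H_normal[OF assms] by auto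
  show ?thesis
    using normal_law_moment_odd[OF s(1), of 0] H_measurable[OF assms]
    by (simp flip: s(2) add: integral_distr)
qed

lemma expectation_H_power_Suc_Suc:
  assumes "L \<in> H"
  shows "expectation (\<lambda>\<omega>. L \<omega> ^ (p + 2))
    = real (p + 1) * expectation (\<lambda>\<omega>. L \<omega> * L \<omega>) * expectation (\<lambda>\<omega>. L \<omega> ^ p)"
proof -
  obtain s where s: "0 \<le> s" "distr M borel L = normal_law 0 s"
    using H_normal[OF assms] by auto
  have "expectation (\<lambda>\<omega>. L \<omega> ^ k) = (\<integral>x. x ^ k \<partial>normal_law 0 s)" for k
    using H_measurable[OF assms] by (simp flip: s(2) add: integral_distr)
  moreover have "(\<integral>x. x ^ 2 \<partial>normal_law 0 s) = s\<^sup>2"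
    using normal_law_moment_even[OF s(1), of 1] by simp
  ultimately show ?thesis
    using normal_law_moment_Suc_Suc[OF s(1), of p]
    by (simp only: power2_eq_square[symmetric] of_nat_add)
qed

text \<open>Apply the moment recursion to \<open>L + e Y\<close> and differentiate at \<open>e = 0\<close>; the result expresses
  the identity for \<open>p\<close> through the one for \<open>p - 2\<close>.\<close>

lemma expectation_H_times_power:
  assumes Y: "Y \<in> H" and L: "L \<in> H"
  shows "expectation (\<lambda>\<omega>. Y \<omega> * L \<omega> ^ p)
    = real p * expectation (\<lambda>\<omega>. Y \<omega> * L \<omega>) * expectation (\<lambda>\<omega>. L \<omega> ^ (p - 1))"
proof (induction p rule: less_induct)
  case (less p)
  consider "p = 0" | "p = 1" | r where "p = r + 2"
    by (metis One_nat_def add_2_eq_Suc' not0_implies_Suc)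
  then show ?case
  proof cases
    case 1
    then show ?thesis using Y by simp
  next
    case 2
    then show ?thesis by (simp add: prob_space)
  next
    case 3
    have hY: "has_moments Y" and hL: "has_moments L"
      using Y L by auto
    let ?E = "expectation"
    let ?v = "\<lambda>e. ?E (\<lambda>\<omega>. 1 * (L \<omega> + e * Y \<omega>) ^ 2)"
    have "?E (\<lambda>\<omega>. 1 * (L \<omega> + e * Y \<omega>) ^ (r + 3))
        = real (r + 2) * (?v e * ?E (\<lambda>\<omega>. 1 * (L \<omega> + e * Y \<omega>) ^ (r + 1)))" for e
      using expectation_H_power_Suc_Suc[OF H_add_scaled[OF L Y, of e], of "r + 1"]
      by (simp add: power2_eq_square numeral_3_eq_3)
    moreover note D = has_real_derivative_expectation_perturbed_power[OF has_moments_const[of 1] hL hY]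
    note DERIV_cmult[OF DERIV_mult[OF D[of 2] D[of "r + 1"]], of "real (r + 2)"]
    ultimately have "real (r + 3) * ?E (\<lambda>\<omega>. Y \<omega> * L \<omega> ^ (r + 2))
        = real (r + 2) * (2 * ?E (\<lambda>\<omega>. Y \<omega> * L \<omega>) * ?E (\<lambda>\<omega>. L \<omega> ^ (r + 1))
            + real (r + 1) * ?E (\<lambda>\<omega>. Y \<omega> * L \<omega> ^ r) * ?E (\<lambda>\<omega>. L \<omega> ^ 2))"
      using DERIV_unique[OF D[of "r + 3"]] by (simp add: algebra_simps)
    moreover have "?E (\<lambda>\<omega>. Y \<omega> * L \<omega> ^ r) * ?E (\<lambda>\<omega>. L \<omega> ^ 2)
        = ?E (\<lambda>\<omega>. Y \<omega> * L \<omega>) * ?E (\<lambda>\<omega>. L \<omega> ^ (r + 1))"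
    proof (cases r)
      case 0
      then show ?thesis using Y L by simp
    next
      case (Suc q)
      have "?E (\<lambda>\<omega>. Y \<omega> * L \<omega> ^ r) = real r * ?E (\<lambda>\<omega>. Y \<omega> * L \<omega>) * ?E (\<lambda>\<omega>. L \<omega> ^ q)"
        using less[of r] 3 Suc by simp
      moreover have "?E (\<lambda>\<omega>. L \<omega> ^ (r + 1)) = real r * ?E (\<lambda>\<omega>. L \<omega> ^ 2) * ?E (\<lambda>\<omega>. L \<omega> ^ q)"
        using expectation_H_power_Suc_Suc[OF L, of q] Suc by (simp add: power2_eq_square)
      ultimately show ?thesis by simp
    qed
    ultimately have "real (r + 3) * ?E (\<lambda>\<omega>. Y \<omega> * L \<omega> ^ (r + 2))
        = real (r + 3) * (real (r + 2) * (?E (\<lambda>\<omega>. Y \<omega> * L \<omega>) * ?E (\<lambda>\<omega>. L \<omega> ^ (r + 1))))"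
      by (simp add: algebra_simps)
    then show ?thesis
      unfolding 3 by simp
  qed
qed

text \<open>\<open>gauss_poly W D\<close> says that \<open>W\<close> is a polynomial in members of the Gaussian space and that
  \<open>D Y\<close> is its formal derivative in the direction in which each \<open>Z\<close> grows at rate
  \<open>E (Y Z)\<close>.  It is a relation because the derivative depends on the polynomial and not only on the
  random variable that the polynomial represents.\<close>

inductive gauss_poly :: "('a \<Rightarrow> real) \<Rightarrow> (('a \<Rightarrow> real) \<Rightarrow> 'a \<Rightarrow> real) \<Rightarrow> bool" where
  const: "gauss_poly (\<lambda>_. c) (\<lambda>_ _. 0)"
| times: "Z \<in> H \<Longrightarrow> gauss_poly W D \<Longrightarrow>
    gauss_poly (\<lambda>\<omega>. Z \<omega> * W \<omega>) (\<lambda>Y \<omega>. expectation (\<lambda>\<omega>. Y \<omega> * Z \<omega>) * W \<omega> + Z \<omega> * D Y \<omega>)"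
| add: "gauss_poly W D \<Longrightarrow> gauss_poly W' D' \<Longrightarrow>
    gauss_poly (\<lambda>\<omega>. W \<omega> + W' \<omega>) (\<lambda>Y \<omega>. D Y \<omega> + D' Y \<omega>)"

lemma gauss_poly_has_moments:
  assumes "gauss_poly W D"
  shows "has_moments W" "has_moments (D Y)"
proof -
  have "has_moments W \<and> has_moments (D Y)"
    using assms
  proof induction
    case (const c)
    show ?case by simp
  next
    case (times Z W D)
    then show ?case
      by (intro conjI has_moments_add has_moments_mult has_moments_const) auto
  next
    case (add W D W' D')
    then show ?case by auto
  qed
  then show "has_moments W" "has_moments (D Y)"
    by auto
qed

lemma gauss_poly_H: "Z \<in> H \<Longrightarrow> gauss_poly Z (\<lambda>Y \<omega>. expectation (\<lambda>\<omega>. Y \<omega> * Z \<omega>))"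
  using gauss_poly.times[OF _ gauss_poly.const[of 1], of Z] by simp

lemma gauss_poly_scale:
  assumes "gauss_poly W D"
  shows "gauss_poly (\<lambda>\<omega>. c * W \<omega>) (\<lambda>Y \<omega>. c * D Y \<omega>)"
  using assms
proof induction
  case (const d)
  then show ?case using gauss_poly.const[of "c * d"] by simp
next
  case (times Z W D)
  have "gauss_poly (\<lambda>\<omega>. Z \<omega> * (c * W \<omega>))
      (\<lambda>Y \<omega>. expectation (\<lambda>\<omega>. Y \<omega> * Z \<omega>) * (c * W \<omega>) + Z \<omega> * (c * D Y \<omega>))"
    by (rule gauss_poly.times[OF times(1,3)])
  then show ?case by (simp add: algebra_simps)
next
  case (add W D W' D')
  show ?case using gauss_poly.add[OF add(3,4)] by (simp add: algebra_simps)
qed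

lemma gauss_poly_mult:
  assumes "gauss_poly W D" and V: "gauss_poly V E"
  shows "gauss_poly (\<lambda>\<omega>. W \<omega> * V \<omega>) (\<lambda>Y \<omega>. D Y \<omega> * V \<omega> + W \<omega> * E Y \<omega>)"
  using assms(1)
proof induction
  case (const c)
  then show ?case using gauss_poly_scale[OF V, of c] by simp
next
  case (times Z W D)
  have "gauss_poly (\<lambda>\<omega>. Z \<omega> * (W \<omega> * V \<omega>))
      (\<lambda>Y \<omega>. expectation (\<lambda>\<omega>. Y \<omega> * Z \<omega>) * (W \<omega> * V \<omega>) + Z \<omega> * (D Y \<omega> * V \<omega> + W \<omega> * E Y \<omega>))"
    by (rule gauss_poly.times[OF times(1,3)])
  then show ?case by (simp add: algebra_simps)
next
  case (add W D W' D')
  show ?case using gauss_poly.add[OF add(3,4)] by (simp add: algebra_simps)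
qed

lemma gauss_poly_sum:
  assumes "finite I" "\<And>i. i \<in> I \<Longrightarrow> gauss_poly (W i) (D i)"
  shows "gauss_poly (\<lambda>\<omega>. \<Sum>i\<in>I. W i \<omega>) (\<lambda>Y \<omega>. \<Sum>i\<in>I. D i Y \<omega>)"
  using assms
proof (induction I)
  case empty
  then show ?case using gauss_poly.const[of 0] by simp
next
  case (insert i I)
  then show ?case using gauss_poly.add[of "W i" "D i"] by simp
qed

lemma gauss_poly_power:
  assumes "gauss_poly W D"
  shows "gauss_poly (\<lambda>\<omega>. W \<omega> ^ k) (\<lambda>Y \<omega>. real k * W \<omega> ^ (k - 1) * D Y \<omega>)"
proof (induction k)
  case 0
  then show ?case using gauss_poly.const[of 1] by simp
next
  case (Suc k)
  have "D Y \<omega> * W \<omega> ^ k + W \<omega> * (real k * W \<omega> ^ (k - 1) * D Y \<omega>)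
      = real (Suc k) * W \<omega> ^ k * D Y \<omega>" for Y \<omega>
    by (cases k) (simp_all add: algebra_simps)
  then show ?case
    using gauss_poly_mult[OF assms Suc] by simp
qed

text \<open>The factor \<open>L\<^sup>p\<close> is what makes the induction work: the identity for \<open>Z W\<close> and \<open>p\<close> is the
  derivative at \<open>e = 0\<close> of the identity for \<open>W\<close> and \<open>p + 1\<close> with \<open>L + e Z\<close> in place of
  \<open>L\<close>, divided by \<open>p + 1\<close>.\<close>

lemma gaussian_integration_by_parts_power:
  assumes "gauss_poly W D" and Y: "Y \<in> H" and "L \<in> H"
  shows "expectation (\<lambda>\<omega>. Y \<omega> * W \<omega> * L \<omega> ^ p)
    = expectation (\<lambda>\<omega>. D Y \<omega> * L \<omega> ^ p)
      + real p * expectation (\<lambda>\<omega>. Y \<omega> * L \<omega>) * expectation (\<lambda>\<omega>. W \<omega> * L \<omega> ^ (p - 1))"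
  using assms(1,3)
proof (induction arbitrary: L p)
  case (const c)
  then show ?case
    using expectation_H_times_power[OF Y const, of p] by (simp add: algebra_simps)
next
  case (times Z W D)
  let ?E = "expectation"
  have h: "has_moments Y" "has_moments W" "has_moments (D Y)" "has_moments L" "has_moments Z"
    using times Y gauss_poly_has_moments by auto
  note deriv = has_real_derivative_expectation_perturbed_power[OF _ h(4,5)]
  have "?E (\<lambda>\<omega>. (Y \<omega> * W \<omega>) * (L \<omega> + e * Z \<omega>) ^ (p + 1))
      = ?E (\<lambda>\<omega>. D Y \<omega> * (L \<omega> + e * Z \<omega>) ^ (p + 1))
        + real (p + 1) * (?E (\<lambda>\<omega>. Y \<omega> * (L \<omega> + e * Z \<omega>) ^ 1) * ?E (\<lambda>\<omega>. W \<omega> * (L \<omega> + e * Z \<omega>) ^ p))" for e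
    using times.IH[OF H_add_scaled[OF times.prems times.hyps(1)], of e "p + 1"] by simp
  moreover note DERIV_add[OF deriv[OF h(3), of "p + 1"]
      DERIV_cmult[OF DERIV_mult[OF deriv[OF h(1), of 1] deriv[OF h(2), of p]], of "real (p + 1)"]]
  ultimately have "real (p + 1) * ?E (\<lambda>\<omega>. (Y \<omega> * W \<omega>) * Z \<omega> * L \<omega> ^ p)
      = real (p + 1) * (?E (\<lambda>\<omega>. D Y \<omega> * Z \<omega> * L \<omega> ^ p) + ?E (\<lambda>\<omega>. Y \<omega> * Z \<omega>) * ?E (\<lambda>\<omega>. W \<omega> * L \<omega> ^ p)
          + real p * ?E (\<lambda>\<omega>. Y \<omega> * L \<omega>) * ?E (\<lambda>\<omega>. W \<omega> * Z \<omega> * L \<omega> ^ (p - 1)))"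
    using DERIV_unique[OF deriv[OF has_moments_mult[OF h(1,2)], of "p + 1"]]
    by (simp add: algebra_simps)
  then have "?E (\<lambda>\<omega>. (Y \<omega> * W \<omega>) * Z \<omega> * L \<omega> ^ p)
      = ?E (\<lambda>\<omega>. D Y \<omega> * Z \<omega> * L \<omega> ^ p) + ?E (\<lambda>\<omega>. Y \<omega> * Z \<omega>) * ?E (\<lambda>\<omega>. W \<omega> * L \<omega> ^ p)
          + real p * ?E (\<lambda>\<omega>. Y \<omega> * L \<omega>) * ?E (\<lambda>\<omega>. W \<omega> * Z \<omega> * L \<omega> ^ (p - 1))"
    by (subst (asm) mult_cancel_left) auto
  moreover have "?E (\<lambda>\<omega>. (?E (\<lambda>\<omega>. Y \<omega> * Z \<omega>) * W \<omega> + Z \<omega> * D Y \<omega>) * L \<omega> ^ p)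
      = ?E (\<lambda>\<omega>. ?E (\<lambda>\<omega>. Y \<omega> * Z \<omega>) * (W \<omega> * L \<omega> ^ p) + D Y \<omega> * Z \<omega> * L \<omega> ^ p)"
    by (intro Bochner_Integration.integral_cong) (simp_all add: algebra_simps)
  moreover have "\<dots> = ?E (\<lambda>\<omega>. Y \<omega> * Z \<omega>) * ?E (\<lambda>\<omega>. W \<omega> * L \<omega> ^ p) + ?E (\<lambda>\<omega>. D Y \<omega> * Z \<omega> * L \<omega> ^ p)"
    using h by (subst Bochner_Integration.integral_add)
      (auto intro!: has_moments_integrable has_moments_mult has_moments_power)
  ultimately show ?case
    by (simp add: mult_ac)
next
  case (add W D W' D')
  have "integrable M (\<lambda>\<omega>. Y \<omega> * W \<omega> * L \<omega> ^ p)" "integrable M (\<lambda>\<omega>. Y \<omega> * W' \<omega> * L \<omega> ^ p)"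
    "integrable M (\<lambda>\<omega>. D Y \<omega> * L \<omega> ^ p)" "integrable M (\<lambda>\<omega>. D' Y \<omega> * L \<omega> ^ p)"
    "integrable M (\<lambda>\<omega>. W \<omega> * L \<omega> ^ (p - 1))" "integrable M (\<lambda>\<omega>. W' \<omega> * L \<omega> ^ (p - 1))"
    using gauss_poly_has_moments(1)[OF add.hyps(1)] gauss_poly_has_moments(1)[OF add.hyps(2)]
      gauss_poly_has_moments(2)[OF add.hyps(1), of Y] gauss_poly_has_moments(2)[OF add.hyps(2), of Y]
      H_has_moments[OF Y] H_has_moments[OF add.prems]
    by (simp_all add: has_moments_integrable has_moments_mult has_moments_power)
  then show ?case
    using add.IH[OF add.prems, of p] by (simp add: distrib_left distrib_right)
qed

lemma gaussian_integration_by_parts: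
  assumes "gauss_poly W D" and "Y \<in> H"
  shows "expectation (\<lambda>\<omega>. Y \<omega> * W \<omega>) = expectation (D Y)"
  using gaussian_integration_by_parts_power[OF assms assms(2), of 0] by simp

text \<open>Isserlis' formula: integrate by parts with respect to \<open>A\<close>.\<close>

lemma expectation_H_four:
  assumes "A \<in> H" "B \<in> H" "C \<in> H" "D \<in> H"
  shows "expectation (\<lambda>\<omega>. A \<omega> * (B \<omega> * (C \<omega> * D \<omega>)))
    = expectation (\<lambda>\<omega>. A \<omega> * B \<omega>) * expectation (\<lambda>\<omega>. C \<omega> * D \<omega>)
      + expectation (\<lambda>\<omega>. A \<omega> * C \<omega>) * expectation (\<lambda>\<omega>. B \<omega> * D \<omega>)
      + expectation (\<lambda>\<omega>. A \<omega> * D \<omega>) * expectation (\<lambda>\<omega>. B \<omega> * C \<omega>)"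
proof -
  let ?E = expectation
  note poly = gauss_poly.times[OF assms(2) gauss_poly.times[OF assms(3) gauss_poly_H[OF assms(4)]]]
  have i: "integrable M (\<lambda>\<omega>. U \<omega> * V \<omega>)" if "U \<in> H" "V \<in> H" for U V
    using that by (auto intro!: has_moments_integrable)
  have "?E (\<lambda>\<omega>. A \<omega> * (B \<omega> * (C \<omega> * D \<omega>)))
      = ?E (\<lambda>\<omega>. ?E (\<lambda>\<omega>. A \<omega> * B \<omega>) * (C \<omega> * D \<omega>)
          + (?E (\<lambda>\<omega>. A \<omega> * C \<omega>) * (B \<omega> * D \<omega>) + ?E (\<lambda>\<omega>. A \<omega> * D \<omega>) * (B \<omega> * C \<omega>)))"
    using gaussian_integration_by_parts[OF poly assms(1)] by (simp add: algebra_simps)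
  also have "\<dots> = ?E (\<lambda>\<omega>. A \<omega> * B \<omega>) * ?E (\<lambda>\<omega>. C \<omega> * D \<omega>)
      + ?E (\<lambda>\<omega>. A \<omega> * C \<omega>) * ?E (\<lambda>\<omega>. B \<omega> * D \<omega>)
      + ?E (\<lambda>\<omega>. A \<omega> * D \<omega>) * ?E (\<lambda>\<omega>. B \<omega> * C \<omega>)"
    using assms by (subst Bochner_Integration.integral_add, simp add: i, simp add: i)+ simp
  finally show ?thesis .
qed

end

section \<open>Quadratic forms in Gaussian variables\<close>

context gaussian_space
begin

abbreviation cov :: "('a \<Rightarrow> real) \<Rightarrow> ('a \<Rightarrow> real) \<Rightarrow> real" where
  "cov U V \<equiv> expectation (\<lambda>\<omega>. U \<omega> * V \<omega>)"

lemma cov_commute: "cov U V = cov V U"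
  by (simp add: mult.commute)

definition qform :: "'i set \<Rightarrow> ('i \<Rightarrow> real) \<Rightarrow> ('i \<Rightarrow> 'a \<Rightarrow> real) \<Rightarrow> 'a \<Rightarrow> real" where
  "qform I a Y \<omega> = (\<Sum>i\<in>I. a i * (Y i \<omega> * Y i \<omega> - cov (Y i) (Y i)))"

text \<open>Half of the squared norm of the gradient \<open>(2 a\<^sub>i Y\<^sub>i)\<^sub>i\<close> of the form, measured with the covariance
  matrix.  It is the weight that integration by parts puts in front of the derivative of a function of
  the form.\<close>

definition half_carre :: "'i set \<Rightarrow> ('i \<Rightarrow> real) \<Rightarrow> ('i \<Rightarrow> 'a \<Rightarrow> real) \<Rightarrow> 'a \<Rightarrow> real" where
  "half_carre I a Y \<omega> = 2 * (\<Sum>i\<in>I. \<Sum>j\<in>I. a i * a j * cov (Y i) (Y j) * (Y i \<omega> * Y j \<omega>))"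

lemma integrable_H_times_H: "U \<in> H \<Longrightarrow> V \<in> H \<Longrightarrow> integrable M (\<lambda>\<omega>. U \<omega> * V \<omega>)"
  by (intro has_moments_integrable has_moments_mult H_has_moments)

lemma has_moments_qform:
  "(\<And>i. i \<in> I \<Longrightarrow> Y i \<in> H) \<Longrightarrow> has_moments (qform I a Y)"
  unfolding qform_def
  by (intro has_moments_sum has_moments_mult has_moments_diff has_moments_const H_has_moments)

lemma has_moments_half_carre:
  "(\<And>i. i \<in> I \<Longrightarrow> Y i \<in> H) \<Longrightarrow> has_moments (half_carre I a Y)"
  unfolding half_carre_def
  by (intro has_moments_sum has_moments_mult has_moments_diff has_moments_const H_has_moments)

lemma qform_gauss_poly:
  assumes "finite I" "\<And>i. i \<in> I \<Longrightarrow> Y i \<in> H"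
  shows "gauss_poly (qform I a Y) (\<lambda>Z \<omega>. \<Sum>i\<in>I. 2 * a i * cov Z (Y i) * Y i \<omega>)"
proof -
  have "gauss_poly (\<lambda>\<omega>. a i * (Y i \<omega> * Y i \<omega> - cov (Y i) (Y i)))
      (\<lambda>Z \<omega>. 2 * a i * cov Z (Y i) * Y i \<omega>)" if "i \<in> I" for i
    using gauss_poly_scale[OF gauss_poly.add[OF
        gauss_poly.times[OF assms(2)[OF that] gauss_poly_H[OF assms(2)[OF that]]]
        gauss_poly.const[of "- cov (Y i) (Y i)"]], of "a i"]
    by (simp add: algebra_simps)
  from gauss_poly_sum[OF assms(1) this] show ?thesis
    by (simp add: qform_def[abs_def])
qed

text \<open>In \<open>E (Y\<^sub>i \<cdot> Y\<^sub>i F\<^sup>k)\<close> integrate by parts with respect to the first factor.  Differentiating the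
  second factor cancels the centring constant, and differentiating \<open>F\<^sup>k\<close> produces \<open>F\<^sup>k\<^sup>-\<^sup>1\<close> times
  one row of \<open>half_carre\<close>.\<close>

lemma expectation_qform_power_Suc:
  assumes I: "finite I" and Y: "\<And>i. i \<in> I \<Longrightarrow> Y i \<in> H"
  shows "expectation (\<lambda>\<omega>. qform I a Y \<omega> ^ Suc k)
    = real k * expectation (\<lambda>\<omega>. qform I a Y \<omega> ^ (k - 1) * half_carre I a Y \<omega>)"
proof -
  let ?F = "qform I a Y" and ?E = expectation
  let ?D = "\<lambda>Z \<omega>. \<Sum>j\<in>I. 2 * a j * cov Z (Y j) * Y j \<omega>"
  have hF: "has_moments ?F" using Y by (rule has_moments_qform)
  have hY: "has_moments (Y i)" if "i \<in> I" for i using Y[OF that] by (rule H_has_moments)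
  have hD: "has_moments (?D Z)" for Z
    using Y by (intro has_moments_sum has_moments_mult has_moments_const H_has_moments)
  have F_pow: "gauss_poly (\<lambda>\<omega>. ?F \<omega> ^ k) (\<lambda>Z \<omega>. real k * ?F \<omega> ^ (k - 1) * ?D Z \<omega>)"
    by (intro gauss_poly_power qform_gauss_poly assms)
  have ibp: "?E (\<lambda>\<omega>. (Y i \<omega> * Y i \<omega> - cov (Y i) (Y i)) * ?F \<omega> ^ k)
      = ?E (\<lambda>\<omega>. Y i \<omega> * (real k * ?F \<omega> ^ (k - 1) * ?D (Y i) \<omega>))" if i: "i \<in> I" for i
  proof -
    have "?E (\<lambda>\<omega>. Y i \<omega> * (Y i \<omega> * ?F \<omega> ^ k))
        = ?E (\<lambda>\<omega>. cov (Y i) (Y i) * ?F \<omega> ^ k + Y i \<omega> * (real k * ?F \<omega> ^ (k - 1) * ?D (Y i) \<omega>))"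
      by (rule gaussian_integration_by_parts[OF gauss_poly.times[OF Y[OF i] F_pow] Y[OF i]])
    also have "\<dots> = ?E (\<lambda>\<omega>. cov (Y i) (Y i) * ?F \<omega> ^ k)
        + ?E (\<lambda>\<omega>. Y i \<omega> * (real k * ?F \<omega> ^ (k - 1) * ?D (Y i) \<omega>))"
      by (intro Bochner_Integration.integral_add has_moments_integrable has_moments_mult
          has_moments_power has_moments_const hF hD hY i)
    finally have "?E (\<lambda>\<omega>. Y i \<omega> * (Y i \<omega> * ?F \<omega> ^ k)) - ?E (\<lambda>\<omega>. cov (Y i) (Y i) * ?F \<omega> ^ k)
        = ?E (\<lambda>\<omega>. Y i \<omega> * (real k * ?F \<omega> ^ (k - 1) * ?D (Y i) \<omega>))"
      by simp
    moreover have "?E (\<lambda>\<omega>. Y i \<omega> * (Y i \<omega> * ?F \<omega> ^ k)) - ?E (\<lambda>\<omega>. cov (Y i) (Y i) * ?F \<omega> ^ k)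
        = ?E (\<lambda>\<omega>. Y i \<omega> * (Y i \<omega> * ?F \<omega> ^ k) - cov (Y i) (Y i) * ?F \<omega> ^ k)"
      by (intro Bochner_Integration.integral_diff[symmetric] has_moments_integrable has_moments_mult
          has_moments_power has_moments_const hF hY i)
    ultimately show ?thesis
      by (simp add: left_diff_distrib mult.assoc)
  qed
  have "?E (\<lambda>\<omega>. ?F \<omega> ^ Suc k)
      = ?E (\<lambda>\<omega>. \<Sum>i\<in>I. a i * ((Y i \<omega> * Y i \<omega> - cov (Y i) (Y i)) * ?F \<omega> ^ k))"
    unfolding power_Suc by (subst qform_def) (simp add: sum_distrib_right mult.assoc)
  also have "\<dots> = (\<Sum>i\<in>I. ?E (\<lambda>\<omega>. a i * ((Y i \<omega> * Y i \<omega> - cov (Y i) (Y i)) * ?F \<omega> ^ k)))"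
    by (intro Bochner_Integration.integral_sum has_moments_integrable has_moments_mult
        has_moments_power has_moments_const has_moments_diff hF hY)
  also have "\<dots> = (\<Sum>i\<in>I. ?E (\<lambda>\<omega>. a i * (Y i \<omega> * (real k * ?F \<omega> ^ (k - 1) * ?D (Y i) \<omega>))))"
    by (intro sum.cong) (simp_all add: ibp)
  also have "\<dots> = ?E (\<lambda>\<omega>. \<Sum>i\<in>I. a i * (Y i \<omega> * (real k * ?F \<omega> ^ (k - 1) * ?D (Y i) \<omega>)))"
    by (intro Bochner_Integration.integral_sum[symmetric] has_moments_integrable has_moments_mult
        has_moments_power has_moments_const has_moments_diff hF hD hY)
  also have "\<dots> = ?E (\<lambda>\<omega>. real k * (?F \<omega> ^ (k - 1) * half_carre I a Y \<omega>))"
    unfolding half_carre_def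
    by (intro Bochner_Integration.integral_cong refl)
      (simp add: sum_distrib_left sum_distrib_right mult_ac)
  finally show ?thesis by simp
qed

lemma expectation_qform [simp]:
  assumes "finite I" "\<And>i. i \<in> I \<Longrightarrow> Y i \<in> H"
  shows "expectation (qform I a Y) = 0"
  using expectation_qform_power_Suc[of I Y a 0] assms by simp

lemma cov_centered_products:
  assumes "A \<in> H" "B \<in> H" "C \<in> H" "D \<in> H"
  shows "expectation (\<lambda>\<omega>. (A \<omega> * B \<omega> - cov A B) * (C \<omega> * D \<omega> - cov C D))
    = cov A C * cov B D + cov A D * cov B C"
proof -
  have h: "has_moments A" "has_moments B" "has_moments C" "has_moments D"
    using assms by auto
  have i: "integrable M (\<lambda>\<omega>. A \<omega> * (B \<omega> * (C \<omega> * D \<omega>)))" "integrable M (\<lambda>\<omega>. cov A B * (C \<omega> * D \<omega>))"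
    "integrable M (\<lambda>\<omega>. cov C D * (A \<omega> * B \<omega>))"
    by (intro has_moments_integrable has_moments_mult has_moments_const h)+
  have "expectation (\<lambda>\<omega>. (A \<omega> * B \<omega> - cov A B) * (C \<omega> * D \<omega> - cov C D))
      = expectation (\<lambda>\<omega>. A \<omega> * (B \<omega> * (C \<omega> * D \<omega>)) - cov A B * (C \<omega> * D \<omega>)
          - cov C D * (A \<omega> * B \<omega>) + cov A B * cov C D)"
    by (intro Bochner_Integration.integral_cong refl) (simp add: algebra_simps)
  also have "\<dots> = expectation (\<lambda>\<omega>. A \<omega> * (B \<omega> * (C \<omega> * D \<omega>))) - cov A B * cov C D
          - cov C D * cov A B + cov A B * cov C D"
    using i by (simp add: prob_space)
  finally show ?thesis
    unfolding expectation_H_four[OF assms] by simp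
qed

lemma cov_qform_qform:
  assumes Y: "\<And>i. i \<in> I \<Longrightarrow> Y i \<in> H" and Z: "\<And>j. j \<in> J \<Longrightarrow> Z j \<in> H"
  shows "cov (qform I a Y) (qform J b Z) = 2 * (\<Sum>i\<in>I. \<Sum>j\<in>J. a i * b j * (cov (Y i) (Z j))\<^sup>2)"
proof -
  let ?U = "\<lambda>i \<omega>. Y i \<omega> * Y i \<omega> - cov (Y i) (Y i)" and ?V = "\<lambda>j \<omega>. Z j \<omega> * Z j \<omega> - cov (Z j) (Z j)"
  have "cov (qform I a Y) (qform J b Z)
      = expectation (\<lambda>\<omega>. \<Sum>i\<in>I. \<Sum>j\<in>J. a i * b j * (?U i \<omega> * ?V j \<omega>))"
    unfolding qform_def sum_product
    by (intro Bochner_Integration.integral_cong refl sum.cong) (simp add: mult_ac)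
  also have "\<dots> = (\<Sum>i\<in>I. \<Sum>j\<in>J. expectation (\<lambda>\<omega>. a i * b j * (?U i \<omega> * ?V j \<omega>)))"
    by (simp add: Bochner_Integration.integral_sum has_moments_integrable has_moments_sum
        has_moments_mult has_moments_diff H_has_moments Y Z del: integral_mult_right_zero)
  also have "\<dots> = (\<Sum>i\<in>I. \<Sum>j\<in>J. a i * b j * (2 * (cov (Y i) (Z j))\<^sup>2))"
  proof (intro sum.cong refl)
    fix i j assume "i \<in> I" "j \<in> J"
    then show "expectation (\<lambda>\<omega>. a i * b j * (?U i \<omega> * ?V j \<omega>)) = a i * b j * (2 * (cov (Y i) (Z j))\<^sup>2)"
      using cov_centered_products[OF Y Y Z Z, of i i j j] by (simp add: power2_eq_square)
  qed
  finally show ?thesis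
    by (simp add: sum_distrib_left mult_ac)
qed

lemma expectation_half_carre:
  assumes "finite I" "\<And>i. i \<in> I \<Longrightarrow> Y i \<in> H"
  shows "expectation (half_carre I a Y) = cov (qform I a Y) (qform I a Y)"
  using expectation_qform_power_Suc[of I Y a 1] assms by (simp add: power2_eq_square)

text \<open>By Schur's test \<open>C\<close> bounds the operator norm of the covariance matrix.\<close>

definition row_bounded :: "'i set \<Rightarrow> ('i \<Rightarrow> 'a \<Rightarrow> real) \<Rightarrow> real \<Rightarrow> bool" where
  "row_bounded I Y C \<longleftrightarrow> (\<forall>i\<in>I. (\<Sum>j\<in>I. \<bar>cov (Y i) (Y j)\<bar>) \<le> C)"

lemma row_bounded_entry:
  assumes "finite I" "row_bounded I Y C" "i \<in> I" "j \<in> I"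
  shows "\<bar>cov (Y i) (Y j)\<bar> \<le> C"
proof -
  have "\<bar>cov (Y i) (Y j)\<bar> \<le> (\<Sum>j\<in>I. \<bar>cov (Y i) (Y j)\<bar>)"
    using assms by (intro member_le_sum) auto
  with assms show ?thesis by (force simp: row_bounded_def)
qed

text \<open>The trace of a fourth power, taken with absolute values: bound the edge that closes the cycle by
  \<open>C\<close>, then sum out one vertex at a time, each at the price of a row sum.\<close>

lemma sum_chain_le:
  assumes I: "finite I" and rows: "row_bounded I Y C" and C: "0 \<le> C"
  shows "(\<Sum>i\<in>I. \<Sum>j\<in>I. \<Sum>k\<in>I. \<Sum>l\<in>I.
      \<bar>cov (Y i) (Y j)\<bar> * \<bar>cov (Y k) (Y l)\<bar> * (\<bar>cov (Y i) (Y k)\<bar> * \<bar>cov (Y j) (Y l)\<bar>)) \<le> real (card I) * C ^ 4"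
proof -
  let ?r = "\<lambda>i j. \<bar>cov (Y i) (Y j)\<bar>"
  have row: "(\<Sum>j\<in>I. ?r i j) \<le> C" if "i \<in> I" for i
    using rows that by (simp add: row_bounded_def)
  have "(\<Sum>i\<in>I. \<Sum>j\<in>I. \<Sum>k\<in>I. \<Sum>l\<in>I. ?r i j * ?r k l * (?r i k * ?r j l))
      \<le> (\<Sum>i\<in>I. \<Sum>j\<in>I. \<Sum>k\<in>I. \<Sum>l\<in>I. ?r i j * ?r k l * (?r i k * C))"
    using row_bounded_entry[OF I rows] by (intro sum_mono mult_left_mono mult_nonneg_nonneg) auto
  also have "\<dots> = (\<Sum>i\<in>I. \<Sum>j\<in>I. \<Sum>k\<in>I. ?r i j * ?r i k * C * (\<Sum>l\<in>I. ?r k l))"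
    by (simp add: sum_distrib_left mult_ac)
  also have "\<dots> \<le> (\<Sum>i\<in>I. \<Sum>j\<in>I. \<Sum>k\<in>I. ?r i j * ?r i k * C * C)"
    using row C by (intro sum_mono mult_left_mono mult_nonneg_nonneg) auto
  also have "\<dots> = (\<Sum>i\<in>I. \<Sum>j\<in>I. ?r i j * C * C * (\<Sum>k\<in>I. ?r i k))"
    by (simp add: sum_distrib_left mult_ac)
  also have "\<dots> \<le> (\<Sum>i\<in>I. \<Sum>j\<in>I. ?r i j * C * C * C)"
    using row C by (intro sum_mono mult_left_mono mult_nonneg_nonneg) auto
  also have "\<dots> = (\<Sum>i\<in>I. C * C * C * (\<Sum>j\<in>I. ?r i j))"
    by (simp add: sum_distrib_left mult_ac)
  also have "\<dots> \<le> (\<Sum>i\<in>I. C * C * C * C)"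
    using row C by (intro sum_mono mult_left_mono mult_nonneg_nonneg) auto
  also have "\<dots> = real (card I) * C ^ 4"
    by (simp add: power4_eq_xxxx)
  finally show ?thesis .
qed

text \<open>By Isserlis' formula the variance is a sum over closed walks of length four; each coefficient of
  \<open>half_carre\<close> carries two weights and one covariance.\<close>

lemma variance_half_carre_le:
  assumes I: "finite I" and Y: "\<And>i. i \<in> I \<Longrightarrow> Y i \<in> H"
    and rows: "row_bounded I Y C" and C: "0 \<le> C" and a: "\<And>i. i \<in> I \<Longrightarrow> \<bar>a i\<bar> \<le> A"
  shows "expectation (\<lambda>\<omega>. (half_carre I a Y \<omega> - expectation (half_carre I a Y))\<^sup>2)
    \<le> 8 * A ^ 4 * real (card I) * C ^ 4"
proof -
  let ?c = "\<lambda>i j. cov (Y i) (Y j)"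
  define b where "b i j = 2 * (a i * a j * ?c i j)" for i j
  let ?P = "\<lambda>i j \<omega>. Y i \<omega> * Y j \<omega> - ?c i j"
  have hP: "has_moments (?P i j)" if "i \<in> I" "j \<in> I" for i j
    using that Y by (intro has_moments_mult has_moments_diff has_moments_const H_has_moments)
  have b_le: "\<bar>b i j\<bar> \<le> 2 * A\<^sup>2 * \<bar>?c i j\<bar>" if "i \<in> I" "j \<in> I" for i j
  proof -
    have "\<bar>a i\<bar> * \<bar>a j\<bar> * \<bar>?c i j\<bar> \<le> A * A * \<bar>?c i j\<bar>"
      using a[OF that(1)] a[OF that(2)] by (intro mult_right_mono mult_mono) auto
    then show ?thesis
      by (simp add: b_def abs_mult power2_eq_square)
  qed
  have carre: "half_carre I a Y \<omega> = (\<Sum>i\<in>I. \<Sum>j\<in>I. b i j * (Y i \<omega> * Y j \<omega>))" for \<omega>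
    by (simp add: half_carre_def b_def sum_distrib_left mult_ac)
  have "expectation (half_carre I a Y) = (\<Sum>i\<in>I. \<Sum>j\<in>I. b i j * ?c i j)"
    unfolding carre
    using Y integrable_H_times_H by (simp add: Bochner_Integration.integral_sum)
  then have diff: "half_carre I a Y \<omega> - expectation (half_carre I a Y) = (\<Sum>i\<in>I. \<Sum>j\<in>I. b i j * ?P i j \<omega>)" for \<omega>
    by (simp add: carre sum_subtractf right_diff_distrib)
  have sq: "(half_carre I a Y \<omega> - expectation (half_carre I a Y))\<^sup>2
      = (\<Sum>i\<in>I. \<Sum>j\<in>I. \<Sum>k\<in>I. \<Sum>l\<in>I. b i j * b k l * (?P i j \<omega> * ?P k l \<omega>))" for \<omega>
    unfolding diff power2_eq_square sum_distrib_right
    unfolding sum_distrib_left by (intro sum.cong refl) (simp add: mult_ac)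
  have "expectation (\<lambda>\<omega>. (half_carre I a Y \<omega> - expectation (half_carre I a Y))\<^sup>2)
      = (\<Sum>i\<in>I. \<Sum>j\<in>I. \<Sum>k\<in>I. \<Sum>l\<in>I. b i j * b k l * expectation (\<lambda>\<omega>. ?P i j \<omega> * ?P k l \<omega>))"
    unfolding sq using hP
    by (simp add: Bochner_Integration.integral_sum has_moments_integrable has_moments_mult has_moments_sum)
  also have "\<dots> = (\<Sum>i\<in>I. \<Sum>j\<in>I. \<Sum>k\<in>I. \<Sum>l\<in>I. b i j * b k l * (?c i k * ?c j l + ?c i l * ?c j k))"
    by (intro sum.cong refl) (simp add: cov_centered_products Y)
  also have "\<dots> \<le> (\<Sum>i\<in>I. \<Sum>j\<in>I. \<Sum>k\<in>I. \<Sum>l\<in>I.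
      4 * A ^ 4 * (\<bar>?c i j\<bar> * \<bar>?c k l\<bar> * (\<bar>?c i k\<bar> * \<bar>?c j l\<bar>) + \<bar>?c i j\<bar> * \<bar>?c k l\<bar> * (\<bar>?c i l\<bar> * \<bar>?c j k\<bar>)))"
  proof (intro sum_mono)
    fix i j k l assume "i \<in> I" "j \<in> I" "k \<in> I" "l \<in> I"
    have "b i j * b k l * (?c i k * ?c j l + ?c i l * ?c j k)
        \<le> \<bar>b i j\<bar> * \<bar>b k l\<bar> * \<bar>?c i k * ?c j l + ?c i l * ?c j k\<bar>"
      unfolding abs_mult[symmetric] by (rule abs_ge_self)
    also have "\<dots> \<le> \<bar>b i j\<bar> * \<bar>b k l\<bar> * (\<bar>?c i k\<bar> * \<bar>?c j l\<bar> + \<bar>?c i l\<bar> * \<bar>?c j k\<bar>)"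
      by (intro mult_left_mono) (simp_all add: abs_triangle_ineq flip: abs_mult)
    also have "\<dots> \<le> (2 * A\<^sup>2 * \<bar>?c i j\<bar>) * (2 * A\<^sup>2 * \<bar>?c k l\<bar>) * (\<bar>?c i k\<bar> * \<bar>?c j l\<bar> + \<bar>?c i l\<bar> * \<bar>?c j k\<bar>)"
      using b_le \<open>i \<in> I\<close> \<open>j \<in> I\<close> \<open>k \<in> I\<close> \<open>l \<in> I\<close> by (intro mult_right_mono mult_mono) auto
    finally show "b i j * b k l * (?c i k * ?c j l + ?c i l * ?c j k)
        \<le> 4 * A ^ 4 * (\<bar>?c i j\<bar> * \<bar>?c k l\<bar> * (\<bar>?c i k\<bar> * \<bar>?c j l\<bar>) + \<bar>?c i j\<bar> * \<bar>?c k l\<bar> * (\<bar>?c i l\<bar> * \<bar>?c j k\<bar>))"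
      by (simp add: power4_eq_xxxx power2_eq_square algebra_simps)
  qed
  also have "\<dots> = 4 * A ^ 4 *
      ((\<Sum>i\<in>I. \<Sum>j\<in>I. \<Sum>k\<in>I. \<Sum>l\<in>I. \<bar>?c i j\<bar> * \<bar>?c k l\<bar> * (\<bar>?c i k\<bar> * \<bar>?c j l\<bar>))
      + (\<Sum>i\<in>I. \<Sum>j\<in>I. \<Sum>k\<in>I. \<Sum>l\<in>I. \<bar>?c i j\<bar> * \<bar>?c k l\<bar> * (\<bar>?c i l\<bar> * \<bar>?c j k\<bar>)))"
    by (simp only: sum_distrib_left[symmetric] sum.distrib)
  also have "(\<Sum>i\<in>I. \<Sum>j\<in>I. \<Sum>k\<in>I. \<Sum>l\<in>I. \<bar>?c i j\<bar> * \<bar>?c k l\<bar> * (\<bar>?c i l\<bar> * \<bar>?c j k\<bar>))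
      = (\<Sum>i\<in>I. \<Sum>j\<in>I. \<Sum>l\<in>I. \<Sum>k\<in>I. \<bar>?c i j\<bar> * \<bar>?c l k\<bar> * (\<bar>?c i l\<bar> * \<bar>?c j k\<bar>))"
    by (rule sum.cong[OF refl], rule sum.cong[OF refl], subst sum.swap) (simp add: mult.commute)
  also have "4 * A ^ 4 *
      ((\<Sum>i\<in>I. \<Sum>j\<in>I. \<Sum>k\<in>I. \<Sum>l\<in>I. \<bar>?c i j\<bar> * \<bar>?c k l\<bar> * (\<bar>?c i k\<bar> * \<bar>?c j l\<bar>))
      + (\<Sum>i\<in>I. \<Sum>j\<in>I. \<Sum>l\<in>I. \<Sum>k\<in>I. \<bar>?c i j\<bar> * \<bar>?c l k\<bar> * (\<bar>?c i l\<bar> * \<bar>?c j k\<bar>)))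
      \<le> 4 * A ^ 4 * (real (card I) * C ^ 4 + real (card I) * C ^ 4)"
    by (intro mult_left_mono add_mono sum_chain_le[OF I rows C]) simp
  finally show ?thesis by simp
qed

end

text \<open>Compare \<open>x\<close> with \<open>R y\<close>: either way one of the two terms on the right dominates.\<close>

lemma weighted_young_power:
  fixes x y R :: real
  assumes "0 \<le> x" "0 \<le> y" "0 < R"
  shows "x ^ m * y \<le> x ^ Suc m / R + R ^ m * y ^ Suc m"
proof (cases "x \<le> R * y")
  case True
  then have "x ^ m * y \<le> (R * y) ^ m * y"
    using assms by (intro mult_right_mono power_mono) auto
  also have "\<dots> \<le> x ^ Suc m / R + R ^ m * y ^ Suc m"
    using assms by (simp add: power_mult_distrib mult_ac)
  finally show ?thesis .
next
  case False
  then have "y \<le> x / R"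
    using assms by (simp add: field_simps)
  then have "x ^ m * y \<le> x ^ m * (x / R)"
    using assms by (intro mult_left_mono) auto
  also have "\<dots> \<le> x ^ Suc m / R + R ^ m * y ^ Suc m"
    using assms by (simp add: mult_ac)
  finally show ?thesis .
qed

context gaussian_space
begin

text \<open>The situation of the limit theorem: \<open>A\<close> bounds the weights and will tend to zero, while
  \<open>A\<^sup>2 card I \<le> K\<close> keeps the variance of the form bounded.\<close>

definition admissible :: "real \<Rightarrow> real \<Rightarrow> real \<Rightarrow> 'i set \<Rightarrow> ('i \<Rightarrow> real) \<Rightarrow> ('i \<Rightarrow> 'a \<Rightarrow> real) \<Rightarrow> bool" where
  "admissible C K A I a Y \<longleftrightarrow> finite I \<and> (\<forall>i\<in>I. Y i \<in> H) \<and> row_bounded I Y C \<and>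
     (\<forall>i\<in>I. \<bar>a i\<bar> \<le> A) \<and> 0 < A \<and> A \<le> 1 \<and> A\<^sup>2 * real (card I) \<le> K"

lemma admissible_abs: "admissible C K A I a Y \<Longrightarrow> admissible C K A I (\<lambda>i. \<bar>a i\<bar>) Y"
  by (simp add: admissible_def)

lemma second_moment_qform_le:
  assumes adm: "admissible C K A I a Y" and C: "0 \<le> C"
  shows "cov (qform I a Y) (qform I a Y) \<le> 2 * C\<^sup>2 * K"
proof -
  let ?c = "\<lambda>i j. cov (Y i) (Y j)"
  have I: "finite I" and Y: "\<And>i. i \<in> I \<Longrightarrow> Y i \<in> H" and rows: "row_bounded I Y C"
    and a: "\<And>i. i \<in> I \<Longrightarrow> \<bar>a i\<bar> \<le> A" and A: "0 < A" "A\<^sup>2 * real (card I) \<le> K"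
    using adm by (auto simp: admissible_def)
  have "(\<Sum>i\<in>I. \<Sum>j\<in>I. a i * a j * (?c i j)\<^sup>2) \<le> (\<Sum>i\<in>I. \<Sum>j\<in>I. A * A * (\<bar>?c i j\<bar> * C))"
  proof (intro sum_mono)
    fix i j assume ij: "i \<in> I" "j \<in> I"
    have "a i * a j * (?c i j)\<^sup>2 \<le> \<bar>a i * a j\<bar> * (?c i j)\<^sup>2"
      by (intro mult_right_mono) auto
    also have "\<dots> = (\<bar>a i\<bar> * \<bar>a j\<bar>) * (\<bar>?c i j\<bar> * \<bar>?c i j\<bar>)"
      by (simp add: abs_mult power2_eq_square)
    also have "\<dots> \<le> A * A * (\<bar>?c i j\<bar> * C)"
      using a[OF ij(1)] a[OF ij(2)] row_bounded_entry[OF I rows ij] A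
      by (intro mult_mono mult_nonneg_nonneg) auto
    finally show "a i * a j * (?c i j)\<^sup>2 \<le> A * A * (\<bar>?c i j\<bar> * C)" .
  qed
  also have "\<dots> = (\<Sum>i\<in>I. A * A * C * (\<Sum>j\<in>I. \<bar>?c i j\<bar>))"
    by (simp add: sum_distrib_left mult_ac)
  also have "\<dots> \<le> (\<Sum>i\<in>I. A * A * C * C)"
    using rows A C by (intro sum_mono mult_left_mono) (auto simp: row_bounded_def)
  also have "\<dots> = C\<^sup>2 * (A\<^sup>2 * real (card I))"
    by (simp add: power2_eq_square mult_ac)
  also have "\<dots> \<le> C\<^sup>2 * K"
    using A by (intro mult_left_mono) auto
  finally show ?thesis
    using Y by (simp add: cov_qform_qform)
qed

text \<open>Schur's test: bound \<open>Y\<^sub>i Y\<^sub>j\<close> by the mean of the squares and sum over a row.  What remains is the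
  form with weights \<open>\<bar>a\<^sub>i\<bar>\<close> plus its mean, so the recursion for the moments of a form
  becomes an inequality between moments of forms.\<close>

lemma half_carre_le:
  assumes adm: "admissible C K A I a Y" and C: "0 \<le> C"
  shows "\<bar>half_carre I a Y \<omega>\<bar> \<le> 2 * C * \<bar>qform I (\<lambda>i. \<bar>a i\<bar>) Y \<omega>\<bar> + 2 * C\<^sup>2 * K"
proof -
  let ?c = "\<lambda>i j. cov (Y i) (Y j)"
  have I: "finite I" and Y: "\<And>i. i \<in> I \<Longrightarrow> Y i \<in> H" and rows: "row_bounded I Y C"
    and a: "\<And>i. i \<in> I \<Longrightarrow> \<bar>a i\<bar> \<le> A" and A: "0 < A" "A \<le> 1" "A\<^sup>2 * real (card I) \<le> K"
    using adm by (auto simp: admissible_def)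
  define t where "t i j = A * (\<bar>a i\<bar> * (Y i \<omega>)\<^sup>2 * \<bar>?c i j\<bar>)" for i j
  have term_le: "\<bar>a i * a j * ?c i j * (Y i \<omega> * Y j \<omega>)\<bar> \<le> (t i j + t j i) / 2" if ij: "i \<in> I" "j \<in> I" for i j
  proof -
    have "2 * (\<bar>Y i \<omega>\<bar> * \<bar>Y j \<omega>\<bar>) \<le> (Y i \<omega>)\<^sup>2 + (Y j \<omega>)\<^sup>2"
      using sum_squares_bound[of "\<bar>Y i \<omega>\<bar>" "\<bar>Y j \<omega>\<bar>"] by simp
    then have "\<bar>a i * a j * ?c i j * (Y i \<omega> * Y j \<omega>)\<bar>
        \<le> \<bar>a i\<bar> * \<bar>a j\<bar> * \<bar>?c i j\<bar> * (((Y i \<omega>)\<^sup>2 + (Y j \<omega>)\<^sup>2) / 2)"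
      unfolding abs_mult by (intro mult_left_mono) auto
    also have "\<dots> = (\<bar>a j\<bar> * (\<bar>a i\<bar> * (Y i \<omega>)\<^sup>2 * \<bar>?c i j\<bar>) + \<bar>a i\<bar> * (\<bar>a j\<bar> * (Y j \<omega>)\<^sup>2 * \<bar>?c j i\<bar>)) / 2"
      by (simp add: algebra_simps cov_commute[of "Y j" "Y i"] add_divide_distrib)
    also have "\<dots> \<le> (t i j + t j i) / 2"
      unfolding t_def using a[OF ij(1)] a[OF ij(2)]
      by (intro divide_right_mono add_mono mult_right_mono) auto
    finally show ?thesis .
  qed
  have row: "(\<Sum>i\<in>I. \<Sum>j\<in>I. t i j) \<le> A * C * (\<Sum>i\<in>I. \<bar>a i\<bar> * (Y i \<omega>)\<^sup>2)"
  proof -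
    have "(\<Sum>i\<in>I. \<Sum>j\<in>I. t i j) = (\<Sum>i\<in>I. A * (\<bar>a i\<bar> * (Y i \<omega>)\<^sup>2) * (\<Sum>j\<in>I. \<bar>?c i j\<bar>))"
      by (simp add: t_def sum_distrib_left mult_ac)
    also have "\<dots> \<le> (\<Sum>i\<in>I. A * (\<bar>a i\<bar> * (Y i \<omega>)\<^sup>2) * C)"
      using rows A by (intro sum_mono mult_left_mono) (auto simp: row_bounded_def)
    finally show ?thesis
      by (simp add: sum_distrib_left mult_ac)
  qed
  have "\<bar>\<Sum>i\<in>I. \<Sum>j\<in>I. a i * a j * ?c i j * (Y i \<omega> * Y j \<omega>)\<bar>
      \<le> (\<Sum>i\<in>I. \<Sum>j\<in>I. (t i j + t j i) / 2)"
    by (intro order_trans[OF sum_abs] sum_mono order_trans[OF sum_abs] sum_mono term_le)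
  also have "\<dots> = ((\<Sum>i\<in>I. \<Sum>j\<in>I. t i j) + (\<Sum>i\<in>I. \<Sum>j\<in>I. t j i)) / 2"
    by (simp add: sum.distrib flip: sum_divide_distrib)
  also have "(\<Sum>i\<in>I. \<Sum>j\<in>I. t j i) = (\<Sum>i\<in>I. \<Sum>j\<in>I. t i j)"
    by (rule sum.swap)
  finally have 1: "\<bar>half_carre I a Y \<omega>\<bar> \<le> 2 * (A * C * (\<Sum>i\<in>I. \<bar>a i\<bar> * (Y i \<omega>)\<^sup>2))"
    using row by (simp add: half_carre_def abs_mult)
  have "(\<Sum>i\<in>I. \<bar>a i\<bar> * (Y i \<omega>)\<^sup>2) = qform I (\<lambda>i. \<bar>a i\<bar>) Y \<omega> + (\<Sum>i\<in>I. \<bar>a i\<bar> * ?c i i)"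
    by (simp add: qform_def right_diff_distrib sum_subtractf power2_eq_square)
  also have "\<dots> \<le> \<bar>qform I (\<lambda>i. \<bar>a i\<bar>) Y \<omega>\<bar> + (\<Sum>i\<in>I. A * C)"
    using a A row_bounded_entry[OF I rows]
    by (intro add_mono abs_ge_self sum_mono mult_mono) (auto simp: abs_le_iff)
  finally have "A * C * (\<Sum>i\<in>I. \<bar>a i\<bar> * (Y i \<omega>)\<^sup>2)
      \<le> A * C * (\<bar>qform I (\<lambda>i. \<bar>a i\<bar>) Y \<omega>\<bar> + (\<Sum>i\<in>I. A * C))"
    using A C by (intro mult_left_mono) auto
  also have "\<dots> = A * (C * \<bar>qform I (\<lambda>i. \<bar>a i\<bar>) Y \<omega>\<bar>) + C\<^sup>2 * (A\<^sup>2 * real (card I))"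
    by (simp add: power2_eq_square algebra_simps)
  also have "\<dots> \<le> 1 * (C * \<bar>qform I (\<lambda>i. \<bar>a i\<bar>) Y \<omega>\<bar>) + C\<^sup>2 * K"
    using A C by (intro add_mono mult_right_mono mult_left_mono) auto
  finally show ?thesis
    using 1 by linarith
qed

text \<open>The recursion gives \<open>E F\<^sup>2\<^sup>m\<^sup>+\<^sup>2 = (2 m + 1) E (F\<^sup>2\<^sup>m G)\<close>.  Young's inequality absorbs half of
  the left-hand side and leaves the moment of order \<open>m + 1\<close> of a bound on \<open>G\<close>.  That bound is
  affine in a form with nonnegative weights, and since \<open>m + 1 \<le> 2 m\<close> for \<open>m \<ge> 1\<close> the induction
  hypothesis for that form is enough.\<close>

lemma even_moments_qform_bounded:
  fixes C K :: real
  assumes C: "0 \<le> C" and K: "0 \<le> K"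
  shows "\<exists>B. \<forall>A (I :: 'i set) a Y. admissible C K A I a Y \<longrightarrow>
    expectation (\<lambda>\<omega>. qform I a Y \<omega> ^ (2 * m)) \<le> B"
proof (induction m)
  case 0
  show ?case by (auto simp: prob_space)
next
  case (Suc m)
  show ?case
  proof (cases "m = 0")
    case True
    then show ?thesis
      using second_moment_qform_le[OF _ C]
      by (intro exI[of _ "2 * C\<^sup>2 * K"]) (auto simp: power2_eq_square)
  next
    case False
    from Suc obtain B where B: "\<And>A (I :: 'i set) a Y. admissible C K A I a Y \<Longrightarrow>
        expectation (\<lambda>\<omega>. qform I a Y \<omega> ^ (2 * m)) \<le> B"
      by auto
    (* With this R the absorbed term is exactly half of the left-hand side. *)
    define R :: real where "R = 2 * (2 * real m + 1)"
    have R: "0 < R" by (simp add: R_def)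
    define D where "D = 2 ^ Suc m * ((2 * C) ^ Suc m * (1 + B) + (2 * C\<^sup>2 * K) ^ Suc m)"
    show ?thesis
    proof (intro exI[of _ "R * (R ^ m * D)"] allI impI)
      fix A and I :: "'i set" and a Y assume adm: "admissible C K A I a Y"
      let ?F = "qform I a Y" and ?S = "qform I (\<lambda>i. \<bar>a i\<bar>) Y" and ?G = "half_carre I a Y"
      have I: "finite I" and Y: "\<And>i. i \<in> I \<Longrightarrow> Y i \<in> H"
        using adm by (auto simp: admissible_def)
      define y where "y \<omega> = 2 * C * \<bar>?S \<omega>\<bar> + 2 * C\<^sup>2 * K" for \<omega>
      have hm: "has_moments ?F" "has_moments ?S" "has_moments ?G"
        using Y by (auto intro: has_moments_qform has_moments_half_carre)
      have hy: "has_moments y"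
        unfolding y_def[abs_def] by (intro has_moments_add has_moments_mult has_moments_const has_moments_abs hm)
      have y0: "0 \<le> y \<omega>" for \<omega>
        using C K by (simp add: y_def)
      have y_pow: "y \<omega> ^ Suc m \<le> 2 ^ Suc m * ((2 * C) ^ Suc m * (1 + ?S \<omega> ^ (2 * m)) + (2 * C\<^sup>2 * K) ^ Suc m)" for \<omega>
      proof -
        have "y \<omega> \<le> 2 * max (2 * C * \<bar>?S \<omega>\<bar>) (2 * C\<^sup>2 * K)"
          by (simp add: y_def)
        then have "y \<omega> ^ Suc m \<le> (2 * max (2 * C * \<bar>?S \<omega>\<bar>) (2 * C\<^sup>2 * K)) ^ Suc m"
          using y0 by (rule power_mono)
        also have "\<dots> = 2 ^ Suc m * max (2 * C * \<bar>?S \<omega>\<bar>) (2 * C\<^sup>2 * K) ^ Suc m"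
          by (rule power_mult_distrib)
        also have "\<dots> \<le> 2 ^ Suc m * ((2 * C * \<bar>?S \<omega>\<bar>) ^ Suc m + (2 * C\<^sup>2 * K) ^ Suc m)"
          using C K by (intro mult_left_mono) (auto simp: max_def)
        also have "(2 * C * \<bar>?S \<omega>\<bar>) ^ Suc m \<le> (2 * C) ^ Suc m * (1 + ?S \<omega> ^ (2 * m))"
        proof -
          have "\<bar>?S \<omega>\<bar> ^ Suc m \<le> 1 + \<bar>?S \<omega>\<bar> ^ (2 * m)"
          proof (cases "\<bar>?S \<omega>\<bar> \<le> 1")
            case True
            then have "\<bar>?S \<omega>\<bar> ^ Suc m \<le> 1" by (intro power_le_one) auto
            then show ?thesis by (simp add: add_increasing2)
          next
            case c: False
            have "\<bar>?S \<omega>\<bar> ^ Suc m \<le> \<bar>?S \<omega>\<bar> ^ (2 * m)"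
              using False c by (intro power_increasing) auto
            then show ?thesis by simp
          qed
          then show ?thesis
            unfolding power_mult_distrib[of "2 * C"] using C
            by (intro mult_left_mono) (auto simp: power_even_abs)
        qed
        finally show ?thesis by simp
      qed
      have "expectation (\<lambda>\<omega>. y \<omega> ^ Suc m)
          \<le> expectation (\<lambda>\<omega>. 2 ^ Suc m * ((2 * C) ^ Suc m * (1 + ?S \<omega> ^ (2 * m)) + (2 * C\<^sup>2 * K) ^ Suc m))"
        by (intro integral_mono y_pow has_moments_integrable has_moments_add has_moments_mult
            has_moments_const has_moments_power hm hy)
      also have "\<dots> = 2 ^ Suc m * ((2 * C) ^ Suc m * (1 + expectation (\<lambda>\<omega>. ?S \<omega> ^ (2 * m))) + (2 * C\<^sup>2 * K) ^ Suc m)"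
        using has_moments_integrable[OF has_moments_power[OF hm(2), of "2 * m"]]
        by (simp add: prob_space del: power_Suc)
      also have "\<dots> \<le> D"
        unfolding D_def using B[OF admissible_abs[OF adm]] C
        by (intro mult_left_mono add_mono) auto
      finally have y_moment: "expectation (\<lambda>\<omega>. y \<omega> ^ Suc m) \<le> D" .
      have pw: "?F \<omega> ^ (2 * m) * ?G \<omega> \<le> ?F \<omega> ^ (2 * Suc m) / R + R ^ m * y \<omega> ^ Suc m" for \<omega>
      proof -
        have "?F \<omega> ^ (2 * m) * ?G \<omega> \<le> ((?F \<omega>)\<^sup>2) ^ m * y \<omega>"
          using half_carre_le[OF adm C, of \<omega>] unfolding y_def power_mult
          by (intro mult_left_mono) auto
        also have "\<dots> \<le> ((?F \<omega>)\<^sup>2) ^ Suc m / R + R ^ m * y \<omega> ^ Suc m"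
          by (intro weighted_young_power y0 R) simp
        finally show ?thesis
          by (simp only: power_mult)
      qed
      have "expectation (\<lambda>\<omega>. ?F \<omega> ^ (2 * Suc m)) = real (2 * m + 1) * expectation (\<lambda>\<omega>. ?F \<omega> ^ (2 * m) * ?G \<omega>)"
        using expectation_qform_power_Suc[OF I Y, where a = a and k = "2 * m + 1"] by simp
      also have "\<dots> \<le> real (2 * m + 1) * expectation (\<lambda>\<omega>. ?F \<omega> ^ (2 * Suc m) / R + R ^ m * y \<omega> ^ Suc m)"
        unfolding divide_inverse
        by (intro mult_left_mono integral_mono pw[unfolded divide_inverse] has_moments_integrable has_moments_add has_moments_mult
            has_moments_const has_moments_power hm hy) simp
      also have "\<dots> = real (2 * m + 1) * (expectation (\<lambda>\<omega>. ?F \<omega> ^ (2 * Suc m)) / R + R ^ m * expectation (\<lambda>\<omega>. y \<omega> ^ Suc m))"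
        using has_moments_integrable[OF has_moments_power[OF hm(1), of "2 * Suc m"]]
          has_moments_integrable[OF has_moments_power[OF hy, of "Suc m"]]
        by (simp del: power_Suc mult_Suc_right)
      also have "\<dots> \<le> real (2 * m + 1) * (expectation (\<lambda>\<omega>. ?F \<omega> ^ (2 * Suc m)) / R + R ^ m * D)"
        using y_moment R by (intro mult_left_mono add_mono) auto
      also have "\<dots> = expectation (\<lambda>\<omega>. ?F \<omega> ^ (2 * Suc m)) / 2 + R * (R ^ m * D) / 2"
      proof -
        have "real (2 * m + 1) = R / 2" by (simp add: R_def)
        moreover have "R / 2 * (u / R + w) = u / 2 + R * w / 2" for u w
          using R by (simp add: field_simps)
        ultimately show ?thesis
          by (simp only:)
      qed
      finally show "expectation (\<lambda>\<omega>. ?F \<omega> ^ (2 * Suc m)) \<le> R * (R ^ m * D)"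
        by linarith
    qed
  qed
qed

text \<open>Replace \<open>G\<close> by its mean \<open>v\<close> in \<open>E F\<^sup>j\<^sup>+\<^sup>2 = (j + 1) E (F\<^sup>j G)\<close>: the leading part
  \<open>(j + 1) v E F\<^sup>j\<close> is the recursion of normal moments, and the rest is at most
  \<open>(j + 1) (A E F\<^sup>2\<^sup>j + Var G / A)\<close>, where \<open>Var G\<close> is of order \<open>A\<^sup>2\<close>.\<close>

lemma moments_qform_tendsto_normal:
  fixes I :: "nat \<Rightarrow> 'i set"
  assumes C: "0 \<le> C" and K: "0 \<le> K"
    and adm: "\<And>n. admissible C K (A n) (I n) (a n) (Y n)" and A: "A \<longlonglongrightarrow> 0"
    and var: "(\<lambda>n. cov (qform (I n) (a n) (Y n)) (qform (I n) (a n) (Y n))) \<longlonglongrightarrow> s\<^sup>2" and s: "0 \<le> s"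
  shows "(\<lambda>n. expectation (\<lambda>\<omega>. qform (I n) (a n) (Y n) \<omega> ^ k)) \<longlonglongrightarrow> (\<integral>x. x ^ k \<partial>normal_law 0 s)"
proof (induction k rule: less_induct)
  case (less k)
  let ?F = "\<lambda>n. qform (I n) (a n) (Y n)" and ?G = "\<lambda>n. half_carre (I n) (a n) (Y n)"
  have I: "finite (I n)" and Y: "\<And>i. i \<in> I n \<Longrightarrow> Y n i \<in> H" for n
    using adm[of n] by (auto simp: admissible_def)
  consider "k = 0" | "k = 1" | j where "k = j + 2"
    by (metis One_nat_def add_2_eq_Suc' not0_implies_Suc)
  then show ?case
  proof cases
    case 1
    interpret N: real_distribution "normal_law 0 s"
      using s by (rule real_distribution_normal_law)
    show ?thesis using 1 N.prob_space by (simp add: prob_space)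
  next
    case 2
    then show ?thesis
      using normal_law_moment_odd[OF s, of 0] I Y by simp
  next
    case 3
    let ?v = "\<lambda>n. cov (?F n) (?F n)"
    obtain B where B: "\<And>n. expectation (\<lambda>\<omega>. ?F n \<omega> ^ (2 * j)) \<le> B"
      using even_moments_qform_bounded[OF C K, of j] adm by metis
    have hm: "has_moments (?F n)" "has_moments (?G n)" for n
      using Y by (auto intro: has_moments_qform has_moments_half_carre)
    have rest: "(\<lambda>n. expectation (\<lambda>\<omega>. ?F n \<omega> ^ j * (?G n \<omega> - ?v n))) \<longlonglongrightarrow> 0"
    proof (rule tendsto_rabs_zero_cancel, rule tendsto_sandwich)
      show "\<forall>\<^sub>F n in sequentially. 0 \<le> \<bar>expectation (\<lambda>\<omega>. ?F n \<omega> ^ j * (?G n \<omega> - ?v n))\<bar>"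
        by simp
      show "(\<lambda>_. 0) \<longlonglongrightarrow> 0" by simp
      show "(\<lambda>n. A n * (B + 8 * K * C ^ 4)) \<longlonglongrightarrow> 0"
        by (rule tendsto_mult_left_zero[OF A])
      show "\<forall>\<^sub>F n in sequentially. \<bar>expectation (\<lambda>\<omega>. ?F n \<omega> ^ j * (?G n \<omega> - ?v n))\<bar> \<le> A n * (B + 8 * K * C ^ 4)"
      proof (rule always_eventually, rule allI)
        fix n
        have A0: "0 < A n" and A2: "(A n)\<^sup>2 * real (card (I n)) \<le> K"
          using adm[of n] by (auto simp: admissible_def)
        let ?d = "\<lambda>\<omega>. ?G n \<omega> - ?v n"
        have hd: "has_moments ?d"
          by (intro has_moments_diff has_moments_const hm)
        have am_gm: "\<bar>u * w\<bar> \<le> A n * u\<^sup>2 + w\<^sup>2 / A n" for u w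
        proof -
          have "2 * ((A n * \<bar>u\<bar>) * \<bar>w\<bar>) \<le> (A n * \<bar>u\<bar>)\<^sup>2 + \<bar>w\<bar>\<^sup>2"
            using sum_squares_bound[of "A n * \<bar>u\<bar>" "\<bar>w\<bar>"] by simp
          moreover have "0 \<le> (A n * \<bar>u\<bar>) * \<bar>w\<bar>"
            using A0 by simp
          ultimately have "(A n * \<bar>u\<bar>) * \<bar>w\<bar> \<le> (A n * \<bar>u\<bar>)\<^sup>2 + \<bar>w\<bar>\<^sup>2"
            by linarith
          then have "A n * \<bar>u * w\<bar> \<le> A n * (A n * u\<^sup>2 + w\<^sup>2 / A n)"
            using A0 by (simp add: abs_mult power2_eq_square algebra_simps)
          then show ?thesis
            using A0 by simp
        qed
        have "\<bar>expectation (\<lambda>\<omega>. ?F n \<omega> ^ j * ?d \<omega>)\<bar> \<le> expectation (\<lambda>\<omega>. \<bar>?F n \<omega> ^ j * ?d \<omega>\<bar>)"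
          by (rule integral_abs_bound)
        also have "\<dots> \<le> expectation (\<lambda>\<omega>. A n * (?F n \<omega> ^ j)\<^sup>2 + (?d \<omega>)\<^sup>2 / A n)"
          unfolding divide_inverse
          by (intro integral_mono am_gm[unfolded divide_inverse] has_moments_integrable has_moments_abs
              has_moments_add has_moments_mult has_moments_const has_moments_power hm hd)
        also have "\<dots> = A n * expectation (\<lambda>\<omega>. ?F n \<omega> ^ (2 * j)) + expectation (\<lambda>\<omega>. (?d \<omega>)\<^sup>2) / A n"
          using has_moments_integrable[OF has_moments_power[OF hm(1)[of n], of "2 * j"]]
            has_moments_integrable[OF has_moments_power[OF hd, of 2]]
          by (simp add: mult.commute[of 2 j] flip: power_mult)
        also have "\<dots> \<le> A n * B + (8 * A n ^ 4 * real (card (I n)) * C ^ 4) / A n"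
        proof (intro add_mono mult_left_mono divide_right_mono B)
          show "expectation (\<lambda>\<omega>. (?d \<omega>)\<^sup>2) \<le> 8 * A n ^ 4 * real (card (I n)) * C ^ 4"
            using variance_half_carre_le[of "I n" "Y n" C "a n" "A n"] adm[of n] C I Y
              expectation_half_carre[of "I n" "Y n" "a n"]
            by (auto simp: admissible_def)
        qed (use A0 in auto)
        also have "(8 * A n ^ 4 * real (card (I n)) * C ^ 4) / A n
            = A n * (8 * ((A n)\<^sup>2 * real (card (I n))) * C ^ 4)"
          using A0 by (simp add: power4_eq_xxxx power2_eq_square)
        also have "A n * B + \<dots> \<le> A n * B + A n * (8 * K * C ^ 4)"
          using A0 A2 by (intro add_left_mono mult_left_mono mult_right_mono) auto
        finally show "\<bar>expectation (\<lambda>\<omega>. ?F n \<omega> ^ j * ?d \<omega>)\<bar> \<le> A n * (B + 8 * K * C ^ 4)"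
          by (simp add: distrib_left)
      qed
    qed
    have "expectation (\<lambda>\<omega>. ?F n \<omega> ^ k) = real (j + 1) * (?v n * expectation (\<lambda>\<omega>. ?F n \<omega> ^ j)
        + expectation (\<lambda>\<omega>. ?F n \<omega> ^ j * (?G n \<omega> - ?v n)))" for n
    proof -
      have i: "integrable M (\<lambda>\<omega>. ?F n \<omega> ^ j * ?G n \<omega>)" "integrable M (\<lambda>\<omega>. ?F n \<omega> ^ j * ?v n)"
        by (intro has_moments_integrable has_moments_mult has_moments_const has_moments_power hm)+
      have "expectation (\<lambda>\<omega>. ?F n \<omega> ^ j * (?G n \<omega> - ?v n))
          = expectation (\<lambda>\<omega>. ?F n \<omega> ^ j * ?G n \<omega>) - expectation (\<lambda>\<omega>. ?F n \<omega> ^ j) * ?v n"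
        using i by (simp add: right_diff_distrib)
      then show ?thesis
        using expectation_qform_power_Suc[of "I n" "Y n" "a n" "j + 1"] I Y 3 by simp
    qed
    moreover have "(\<lambda>n. real (j + 1) * (?v n * expectation (\<lambda>\<omega>. ?F n \<omega> ^ j)
        + expectation (\<lambda>\<omega>. ?F n \<omega> ^ j * (?G n \<omega> - ?v n))))
        \<longlonglongrightarrow> real (j + 1) * (s\<^sup>2 * (\<integral>x. x ^ j \<partial>normal_law 0 s) + 0)"
      using 3 by (intro tendsto_intros var less rest) simp
    ultimately show ?thesis
      using normal_law_moment_Suc_Suc[OF s, of j] 3
      by (simp only: add_0_right mult.assoc)
  qed
qed

end

section \<open>Correlations of second differences of fractional Brownian motion\<close>

lemma third_difference_mean_value:
  fixes f f1 f2 f3 :: "real \<Rightarrow> real"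
  assumes "\<And>y. x \<le> y \<Longrightarrow> (f has_real_derivative f1 y) (at y)"
    and "\<And>y. x \<le> y \<Longrightarrow> (f1 has_real_derivative f2 y) (at y)"
    and "\<And>y. x \<le> y \<Longrightarrow> (f2 has_real_derivative f3 y) (at y)"
  shows "\<exists>z>x. f (x + 3) - 3 * f (x + 2) + 3 * f (x + 1) - f x = f3 z"
proof -
  have shift: "((\<lambda>y. g (y + c)) has_real_derivative g' (y + c)) (at y)"
    if "\<And>y. x \<le> y \<Longrightarrow> (g has_real_derivative g' y) (at y)" "x \<le> y" "0 \<le> c" for g g' :: "real \<Rightarrow> real" and y c
    using that(1)[of "y + c"] that(2,3) DERIV_shift[of g "g' (y + c)" y c] by simp
  have "\<exists>z. x < z \<and> z < x + 1 \<and> (f (x + 1 + 2) - 2 * f (x + 1 + 1) + f (x + 1)) - (f (x + 2) - 2 * f (x + 1) + f x)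
      = (x + 1 - x) * (f1 (z + 2) - 2 * f1 (z + 1) + f1 z)"
    by (rule MVT2) (auto intro!: derivative_eq_intros shift[where g' = f1] assms)
  then obtain z1 where z1: "x < z1"
    "(f (x + 1 + 2) - 2 * f (x + 1 + 1) + f (x + 1)) - (f (x + 2) - 2 * f (x + 1) + f x) = f1 (z1 + 2) - 2 * f1 (z1 + 1) + f1 z1"
    by auto
  have "\<exists>z. z1 < z \<and> z < z1 + 1 \<and> (f1 (z1 + 1 + 1) - f1 (z1 + 1)) - (f1 (z1 + 1) - f1 z1)
      = (z1 + 1 - z1) * (f2 (z + 1) - f2 z)"
    using z1(1) by (intro MVT2) (auto intro!: derivative_eq_intros shift[where g' = f2] assms)
  then obtain z2 where z2: "z1 < z2" "(f1 (z1 + 1 + 1) - f1 (z1 + 1)) - (f1 (z1 + 1) - f1 z1) = f2 (z2 + 1) - f2 z2"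
    by auto
  have "\<exists>z. z2 < z \<and> z < z2 + 1 \<and> f2 (z2 + 1) - f2 z2 = (z2 + 1 - z2) * f3 z"
    using z1(1) z2(1) by (intro MVT2) (auto intro!: assms)
  then obtain z3 where "z2 < z3" "f2 (z2 + 1) - f2 z2 = f3 z3"
    by auto
  with z1 z2 show ?thesis
    by (intro exI[of _ z3]) (auto simp: algebra_simps)
qed

text \<open>The third derivative of \<open>x\<^sup>p\<close> decays with exponent \<open>p - 3 < -1\<close>.  The resulting decay like \<open>1 / x\<close>
  is enough for square summability.\<close>

lemma third_difference_powr_le:
  assumes "1 \<le> x" "0 < p" "p < (2::real)"
  shows "\<bar>(x + 3) powr p - 3 * (x + 2) powr p + 3 * (x + 1) powr p - x powr p\<bar>
    \<le> \<bar>p * (p - 1) * (p - 2)\<bar> / x"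
proof -
  have "\<exists>z>x. (x + 3) powr p - 3 * (x + 2) powr p + 3 * (x + 1) powr p - x powr p
      = p * (p - 1) * (p - 2) * z powr (p - 3)"
  proof (rule third_difference_mean_value[of x "\<lambda>y. y powr p" "\<lambda>y. p * y powr (p - 1)"
          "\<lambda>y. p * (p - 1) * y powr (p - 2)" "\<lambda>z. p * (p - 1) * (p - 2) * z powr (p - 3)"])
    fix y assume "x \<le> y"
    then have y: "0 < y" using \<open>1 \<le> x\<close> by simp
    show "((\<lambda>y. y powr p) has_real_derivative p * y powr (p - 1)) (at y)"
      by (rule has_real_derivative_powr[OF y])
    show "((\<lambda>y. p * y powr (p - 1)) has_real_derivative p * (p - 1) * y powr (p - 2)) (at y)"
      using DERIV_cmult[OF has_real_derivative_powr[OF y, of "p - 1"], of p] by (simp add: mult.assoc)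
    show "((\<lambda>y. p * (p - 1) * y powr (p - 2)) has_real_derivative p * (p - 1) * (p - 2) * y powr (p - 3)) (at y)"
      using DERIV_cmult[OF has_real_derivative_powr[OF y, of "p - 2"], of "p * (p - 1)"] by (simp add: mult.assoc)
  qed
  then obtain z where z: "x < z" "(x + 3) powr p - 3 * (x + 2) powr p + 3 * (x + 1) powr p - x powr p
      = p * (p - 1) * (p - 2) * z powr (p - 3)"
    by auto
  have "z powr (p - 3) \<le> z powr - 1"
    using z assms by (intro powr_mono) auto
  also have "\<dots> = 1 / z"
    using z assms by (simp add: powr_minus_divide)
  also have "\<dots> \<le> 1 / x"
    using z assms by (intro divide_left_mono) auto
  finally have "\<bar>p * (p - 1) * (p - 2)\<bar> * (z powr (p - 3)) \<le> \<bar>p * (p - 1) * (p - 2)\<bar> * (1 / x)"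
    by (intro mult_left_mono abs_ge_zero)
  moreover have "\<bar>p * (p - 1) * (p - 2) * z powr (p - 3)\<bar> = \<bar>p * (p - 1) * (p - 2)\<bar> * (z powr (p - 3))"
    unfolding abs_mult by (simp only: abs_of_nonneg powr_ge_zero)
  ultimately show ?thesis
    unfolding z(2) by (simp only: mult_1_right times_divide_eq_right)
qed

lemma rho_hat_minus [simp]: "rho_hat \<gamma> (- j) = rho_hat \<gamma> j"
proof -
  have *: "\<bar>real_of_int (- j)\<bar> = \<bar>real_of_int j\<bar>"
    "\<bar>real_of_int (- j + c)\<bar> = \<bar>real_of_int (j - c)\<bar>"
    "\<bar>real_of_int (- j - c)\<bar> = \<bar>real_of_int (j + c)\<bar>" for c
    by linarith+
  show ?thesis
    unfolding rho_hat_def * by argo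
qed

lemma rho_hat_0: "rho_hat \<gamma> 0 = 4 - 2 powr (2 * \<gamma>)"
  by (simp add: rho_hat_def)

text \<open>A second difference with step two is the second differences with step one convolved with
  \<open>(1, 2, 1)\<close>.\<close>

lemma rho_tilde_eq: "rho_tilde \<gamma> j = rho_hat \<gamma> (j - 1) + 2 * rho_hat \<gamma> j + rho_hat \<gamma> (j + 1)"
  by (simp add: rho_tilde_def rho_hat_def algebra_simps)

lemma summable_rho_hat_sq:
  assumes "0 < \<gamma>" "\<gamma> < 1"
  shows "summable (\<lambda>n. (rho_hat \<gamma> (int n))\<^sup>2)"
proof -
  define p where "p = 2 * \<gamma>"
  have p: "0 < p" "p < 2" using assms by (auto simp: p_def)
  define K where "K = \<bar>p * (p - 1) * (p - 2)\<bar>"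
  have bound: "\<bar>rho_hat \<gamma> (int (n + 3))\<bar> \<le> K / real (Suc n)" for n
  proof -
    let ?t = "\<lambda>x. (x + 3) powr p - 3 * (x + 2) powr p + 3 * (x + 1) powr p - x powr p"
    have rho: "rho_hat \<gamma> (int (n + 3)) = 1/2 * (?t (real n + 1) - ?t (real n + 2))"
      by (simp add: rho_hat_def p_def algebra_simps)
    have 1: "\<bar>?t (real n + 1)\<bar> \<le> K / (real n + 1)"
      unfolding K_def using p by (intro third_difference_powr_le) auto
    have 2: "\<bar>?t (real n + 2)\<bar> \<le> K / (real n + 2)"
      unfolding K_def using p by (intro third_difference_powr_le) auto
    have 3: "K / (real n + 2) \<le> K / (real n + 1)"
      by (intro divide_left_mono) (auto simp: K_def)
    have mean_le: "\<bar>1/2 * (u - v)\<bar> \<le> c" if "\<bar>u\<bar> \<le> c" "\<bar>v\<bar> \<le> d" "d \<le> c" for u v c d :: real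
      using that by (simp add: abs_le_iff)
    have "\<bar>rho_hat \<gamma> (int (n + 3))\<bar> \<le> K / (real n + 1)"
      unfolding rho by (rule mean_le[OF 1 2 3])
    then show ?thesis
      by (simp only: of_nat_Suc add.commute)
  qed
  have "summable (\<lambda>n. K\<^sup>2 * (1 / real (Suc n) ^ 2))"
    using inverse_squares_sums by (intro summable_mult) (auto simp: sums_iff add.commute)
  moreover have "norm ((rho_hat \<gamma> (int (n + 3)))\<^sup>2) \<le> K\<^sup>2 * (1 / real (Suc n) ^ 2)" for n
    using power_mono[OF bound[of n], of 2] by (simp add: power_divide)
  ultimately have "summable (\<lambda>n. (rho_hat \<gamma> (int (n + 3)))\<^sup>2)"
    by (rule summable_comparison_test'[where N = 0])
  then show ?thesis
    by (subst (asm) summable_iff_shift)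
qed

lemma has_sum_int_even_function:
  fixes f :: "int \<Rightarrow> real"
  assumes even: "\<And>j. f (- j) = f j" and nonneg: "\<And>j. 0 \<le> f j" and summable: "summable (\<lambda>n. f (int n))"
  shows "(f has_sum (f 0 + 2 * (\<Sum>n. f (int (Suc n))))) UNIV"
proof -
  let ?s = "\<Sum>n. f (int (Suc n))"
  have summable': "summable (\<lambda>n. f (int (Suc n)))"
    using summable by (simp only: summable_Suc_iff[of "\<lambda>n. f (int n)"])
  have pos: "((\<lambda>n. f (int (Suc n))) has_sum ?s) UNIV"
    using summable' nonneg by (intro norm_summable_imp_has_sum) (auto simp: summable_sums)
  have "(f has_sum ?s) (range (\<lambda>n. int (Suc n)))"
    using pos by (subst has_sum_reindex) (auto simp: inj_on_def o_def)
  moreover have "(f has_sum ?s) (range (\<lambda>n. - int (Suc n)))"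
    using pos even[of "int (Suc n)" for n] by (subst has_sum_reindex) (auto simp: inj_on_def o_def simp del: of_nat_Suc)
  moreover have "(f has_sum f 0) {0}"
    using has_sum_finite[of "{0}" f] by simp
  ultimately have "(f has_sum (f 0 + (?s + ?s))) ({0} \<union> (range (\<lambda>n. int (Suc n)) \<union> range (\<lambda>n. - int (Suc n))))"
    by (intro has_sum_Un_disjoint) auto
  moreover have "{0} \<union> (range (\<lambda>n. int (Suc n)) \<union> range (\<lambda>n. - int (Suc n))) = UNIV"
  proof -
    have "j = 0 \<or> j \<in> range (\<lambda>n. int (Suc n)) \<or> j \<in> range (\<lambda>n. - int (Suc n))" for j
    proof (cases j rule: int_cases)
      case (nonneg n)
      then show ?thesis by (cases n) auto
    qed auto
    then show ?thesis by auto
  qed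
  ultimately show ?thesis by simp
qed

text \<open>\<open>\<Sigma>\<^sub>1\<^sub>1\<close> is twice the sum over all integers of the squared correlations
  \<open>rho_hat \<gamma> j / rho_hat \<gamma> 0\<close>.\<close>

lemma has_sum_rho_hat_sq:
  assumes "0 < \<gamma>" "\<gamma> < 1"
  shows "((\<lambda>j. (rho_hat \<gamma> j)\<^sup>2) has_sum ((4 - 2 powr (2 * \<gamma>))\<^sup>2 / 2 * Sigma11 \<gamma>)) UNIV"
proof -
  have "2 powr (2 * \<gamma>) < 2 powr 2"
    using assms by (intro powr_less_mono) auto
  then have "4 - 2 powr (2 * \<gamma>) \<noteq> 0"
    by simp
  then have "(4 - 2 powr (2 * \<gamma>))\<^sup>2 / 2 * Sigma11 \<gamma>
      = (rho_hat \<gamma> 0)\<^sup>2 + 2 * (\<Sum>n. (rho_hat \<gamma> (int (Suc n)))\<^sup>2)"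
    by (simp add: Sigma11_def rho_hat_0 field_simps)
  then show ?thesis
    using has_sum_int_even_function[of "\<lambda>j. (rho_hat \<gamma> j)\<^sup>2"] summable_rho_hat_sq[OF assms]
    by (simp only: rho_hat_minus zero_le_power2)
qed

lemma summable_on_rho_tilde_sq:
  assumes "0 < \<gamma>" "\<gamma> < 1"
  shows "(\<lambda>j. (rho_tilde \<gamma> j)\<^sup>2) summable_on UNIV"
proof -
  have base: "(\<lambda>j. (rho_hat \<gamma> j)\<^sup>2) summable_on UNIV"
    using has_sum_rho_hat_sq[OF assms] by (auto simp: summable_on_def)
  have shift: "(\<lambda>j. (rho_hat \<gamma> (j + c))\<^sup>2) summable_on UNIV" for c
  proof -
    have "bij_betw (\<lambda>j. j + c) UNIV UNIV"
      by (rule bij_betwI[where g = "\<lambda>j. j - c"]) auto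
    with base show ?thesis
      by (subst summable_on_reindex_bij_betw[of "\<lambda>j. j + c" UNIV UNIV "\<lambda>j. (rho_hat \<gamma> j)\<^sup>2"])
  qed
  have dom: "(\<lambda>j. 4 * ((rho_hat \<gamma> (j + - 1))\<^sup>2 + 2 * (rho_hat \<gamma> j)\<^sup>2 + (rho_hat \<gamma> (j + 1))\<^sup>2)) summable_on UNIV"
    by (intro summable_on_cmult_right summable_on_add shift base)
  have ineq: "(u + 2 * v + w)\<^sup>2 \<le> 4 * (u\<^sup>2 + 2 * v\<^sup>2 + w\<^sup>2)" for u v w :: real
  proof -
    have "4 * (u\<^sup>2 + 2 * v\<^sup>2 + w\<^sup>2) - (u + 2 * v + w)\<^sup>2 = 2 * (u - v)\<^sup>2 + 2 * (v - w)\<^sup>2 + (u - w)\<^sup>2"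
      by (simp add: power2_eq_square algebra_simps)
    moreover have "0 \<le> 2 * (u - v)\<^sup>2 + 2 * (v - w)\<^sup>2 + (u - w)\<^sup>2"
      by simp
    ultimately show ?thesis by linarith
  qed
  show ?thesis
    by (rule summable_on_comparison_test[OF dom]) (use ineq in \<open>auto simp: rho_tilde_eq\<close>)
qed

text \<open>Collect the terms by the value \<open>d = k - c j\<close>.  It is attained by at least \<open>n - 2 \<bar>d\<bar> - 1\<close>
  and at most \<open>n\<close> indices \<open>j\<close>, so after division by \<open>n\<close> its multiplicity tends to one while
  staying below one, and dominated convergence applies.\<close>

lemma Cesaro_sum_lattice_differences:
  fixes r :: "int \<Rightarrow> real"
  assumes r: "(\<lambda>d. norm (r d)) summable_on UNIV" and c: "1 \<le> c"
  shows "(\<lambda>n. (\<Sum>j=1..n-1. \<Sum>k=1..c*n-1. r (int k - int c * int j)) / real n) \<longlonglongrightarrow> infsum r UNIV"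
proof -
  define J where "J n d = {j \<in> {1..n-1}. 1 \<le> d + int c * int j \<and> d + int c * int j \<le> int (c * n - 1)}" for n d
  have J_fin: "finite (J n d)" for n d
    by (simp add: J_def)
  have J_le: "card (J n d) \<le> n" for n d
    using card_mono[of "{1..n}" "J n d"] by (force simp: J_def)
  have J_ge: "real n - 2 * real_of_int \<bar>d\<bar> - 1 \<le> real (card (J n d))" for n d
  proof (cases "2 * nat \<bar>d\<bar> + 1 \<le> n")
    case True
    have "{nat \<bar>d\<bar> + 1..n - 1 - nat \<bar>d\<bar>} \<subseteq> J n d"
    proof
      fix j assume j: "j \<in> {nat \<bar>d\<bar> + 1..n - 1 - nat \<bar>d\<bar>}"
      have j1: "\<bar>d\<bar> + 1 \<le> int j" and j2: "int j + \<bar>d\<bar> + 1 \<le> int n"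
        using j True by auto
      have ge: "x \<le> int c * x" if "0 \<le> x" for x
        using c that mult_right_mono[of 1 "int c" x] by simp
      have "1 \<le> d + int c * int j"
        using ge[of "int j"] j1 by linarith
      moreover have "d + int c * int j + 1 \<le> int c * int n"
      proof -
        have "d + 1 \<le> int n - int j" using j2 by linarith
        also have "\<dots> \<le> int c * (int n - int j)" using j2 by (intro ge) linarith
        finally show ?thesis by (simp add: algebra_simps)
      qed
      moreover have "int (c * n - 1) = int c * int n - 1"
        using c True by (simp add: of_nat_diff Suc_le_eq)
      ultimately show "j \<in> J n d"
        using j by (auto simp: J_def)
    qed
    from card_mono[OF J_fin this] show ?thesis
      using True by (simp add: of_nat_diff)
  next
    case False
    then show ?thesis by linarith
  qed
  have eq: "(\<Sum>j=1..n-1. \<Sum>k=1..c*n-1. r (int k - int c * int j))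
      = (\<integral>d. real (card (J n d)) * r d \<partial>count_space UNIV)" for n
  proof -
    define D where "D = {- int (c * n)..int (c * n)}"
    have support: "d \<in> D" if "J n d \<noteq> {}" for d
    proof -
      from that obtain j where j: "j \<in> {1..n-1}" "1 \<le> d + int c * int j" "d + int c * int j \<le> int (c * n - 1)"
        by (auto simp: J_def)
      have "int c * int j \<le> int (c * n)"
        using j by (auto intro!: mult_left_mono)
      moreover have "0 \<le> int c * int j"
        by simp
      moreover have "int (c * n - 1) \<le> int (c * n)"
        by (simp only: of_nat_le_iff diff_le_self)
      ultimately show ?thesis
        using j unfolding D_def atLeastAtMost_iff by linarith
    qed
    have "(\<Sum>j=1..n-1. \<Sum>k=1..c*n-1. r (int k - int c * int j))
        = (\<Sum>j=1..n-1. \<Sum>d\<in>D. if j \<in> J n d then r d else 0)"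
    proof (intro sum.cong refl)
      fix j assume j: "j \<in> {1..n-1}"
      have "(\<Sum>k=1..c*n-1. r (int k - int c * int j)) = (\<Sum>d\<in>{d\<in>D. j \<in> J n d}. r d)"
      proof (rule sum.reindex_bij_witness[where i = "\<lambda>d. nat (d + int c * int j)" and j = "\<lambda>k. int k - int c * int j"])
        fix k assume k: "k \<in> {1..c*n-1}"
        have "int c * int j \<le> int (c * n)"
          using j by (auto intro!: mult_left_mono)
        moreover have "0 \<le> int c * int j"
          by simp
        moreover have "int k \<le> int (c * n - 1)"
          using k by (simp only: of_nat_le_iff atLeastAtMost_iff)
        moreover have "int (c * n - 1) \<le> int (c * n)"
          by (simp only: of_nat_le_iff diff_le_self)
        ultimately have "int k - int c * int j \<in> D"
          unfolding D_def atLeastAtMost_iff by linarith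
        then show "int k - int c * int j \<in> {d\<in>D. j \<in> J n d}"
          using j k unfolding J_def by auto
      qed (use j in \<open>auto simp: J_def\<close>)
      also have "\<dots> = (\<Sum>d\<in>D. if j \<in> J n d then r d else 0)"
        by (intro sum.mono_neutral_cong_left) (auto simp: D_def)
      finally show "(\<Sum>k=1..c*n-1. r (int k - int c * int j)) = (\<Sum>d\<in>D. if j \<in> J n d then r d else 0)" .
    qed
    also have "\<dots> = (\<Sum>d\<in>D. \<Sum>j=1..n-1. if j \<in> J n d then r d else 0)"
      by (rule sum.swap)
    also have "\<dots> = (\<Sum>d\<in>D. real (card (J n d)) * r d)"
    proof (intro sum.cong refl)
      fix d
      have "(\<Sum>j=1..n-1. if j \<in> J n d then r d else 0) = (\<Sum>j\<in>J n d. r d)"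
        by (intro sum.mono_neutral_cong_right) (auto simp: J_def)
      then show "(\<Sum>j=1..n-1. if j \<in> J n d then r d else 0) = real (card (J n d)) * r d"
        by simp
    qed
    also have "\<dots> = (\<Sum>d | d \<in> UNIV \<and> real (card (J n d)) * r d \<noteq> 0. real (card (J n d)) * r d)"
    proof (intro sum.mono_neutral_right)
      show "{d. d \<in> UNIV \<and> real (card (J n d)) * r d \<noteq> 0} \<subseteq> D"
      proof
        fix d assume "d \<in> {d. d \<in> UNIV \<and> real (card (J n d)) * r d \<noteq> 0}"
        then show "d \<in> D" by (intro support) auto
      qed
    qed (auto simp: D_def)
    also have "\<dots> = (\<integral>d. real (card (J n d)) * r d \<partial>count_space UNIV)"
    proof (rule lebesgue_integral_count_space_finite_support[symmetric])
      have "{d \<in> UNIV. real (card (J n d)) * r d \<noteq> 0} \<subseteq> D"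
      proof
        fix d assume "d \<in> {d \<in> UNIV. real (card (J n d)) * r d \<noteq> 0}"
        then show "d \<in> D" by (intro support) auto
      qed
      then show "finite {d \<in> UNIV. real (card (J n d)) * r d \<noteq> 0}"
        by (rule finite_subset) (simp add: D_def)
    qed
    finally show ?thesis .
  qed
  note r_abs = abs_summable_equivalent[of r UNIV, THEN iffD1, OF r]
  then have r_int: "integrable (count_space UNIV) r"
    by (simp add: abs_summable_on_def)
  have "(\<lambda>n. \<integral>d. real (card (J n d)) / real n * r d \<partial>count_space UNIV) \<longlonglongrightarrow> (\<integral>d. r d \<partial>count_space UNIV)"
  proof (rule integral_dominated_convergence[where w = "\<lambda>d. norm (r d)"])
    show "integrable (count_space UNIV) (\<lambda>d. norm (r d))"
      using r_int by (rule integrable_norm)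
    have "(\<lambda>n. real (card (J n d)) / real n * r d) \<longlonglongrightarrow> 1 * r d" for d
    proof (intro tendsto_mult tendsto_const)
      show "(\<lambda>n. real (card (J n d)) / real n) \<longlonglongrightarrow> 1"
      proof (rule tendsto_sandwich)
        have "(\<lambda>n. 1 - (2 * real_of_int \<bar>d\<bar> + 1) / real n) \<longlonglongrightarrow> 1 - 0"
          by (intro tendsto_diff tendsto_const lim_const_over_n)
        then show "(\<lambda>n. 1 - (2 * real_of_int \<bar>d\<bar> + 1) / real n) \<longlonglongrightarrow> 1"
          by simp
        show "\<forall>\<^sub>F n in sequentially. 1 - (2 * real_of_int \<bar>d\<bar> + 1) / real n \<le> real (card (J n d)) / real n"
          using eventually_gt_at_top[of 0]
        proof eventually_elim
          case (elim n)
          then show ?case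
            using divide_right_mono[OF J_ge[of n d], of "real n"] by (simp add: diff_divide_distrib add_divide_distrib)
        qed
        show "\<forall>\<^sub>F n in sequentially. real (card (J n d)) / real n \<le> 1"
          using J_le by (intro always_eventually allI) (auto simp: divide_le_eq)
      qed simp
    qed
    then show "AE d in count_space UNIV. (\<lambda>n. real (card (J n d)) / real n * r d) \<longlonglongrightarrow> r d"
      by simp
    show "AE d in count_space UNIV. norm (real (card (J n d)) / real n * r d) \<le> norm (r d)" for n
    proof (rule AE_I2)
      fix d
      have "real (card (J n d)) / real n \<le> 1"
        using J_le by (auto simp: divide_le_eq)
      then show "norm (real (card (J n d)) / real n * r d) \<le> norm (r d)"
        using mult_left_le_one_le[of "\<bar>r d\<bar>" "real (card (J n d)) / real n"] by (simp add: abs_mult)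
    qed
  qed auto
  moreover have "(\<integral>d. r d \<partial>count_space UNIV) = infsum r UNIV"
    using infsetsum_infsum[OF r_abs] by (simp add: infsetsum_def)
  moreover have "(\<integral>d. real (card (J n d)) / real n * r d \<partial>count_space UNIV)
      = (\<Sum>j=1..n-1. \<Sum>k=1..c*n-1. r (int k - int c * int j)) / real n" for n
    unfolding eq by (simp flip: integral_divide_zero)
  ultimately show ?thesis
    by (simp only:)
qed

section \<open>Second-order quadratic variations of a Gaussian process\<close>

definition process_span :: "real \<Rightarrow> (real \<Rightarrow> 'a \<Rightarrow> real) \<Rightarrow> ('a \<Rightarrow> real) set" where
  "process_span T X = {\<lambda>\<omega>. \<Sum>t\<in>F. c t * X t \<omega> | F c. finite F \<and> F \<subseteq> {0..T}}"

lemma process_in_span: "t \<in> {0..T} \<Longrightarrow> X t \<in> process_span T X"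
  unfolding process_span_def
  by (rule CollectI, rule exI[of _ "{t}"], rule exI[of _ "\<lambda>_. 1"]) auto

text \<open>The law of a linear combination is normal by assumption; its mean vanishes by linearity, which
  identifies the law as centred.\<close>

lemma gaussian_space_process_span:
  assumes "centered_gaussian_process M T X"
  shows "gaussian_space M (process_span T X)"
proof -
  interpret prob_space M
    using assms by (auto simp: centered_gaussian_process_def gaussian_process_def)
  have meas: "X t \<in> borel_measurable M" if "t \<in> {0..T}" for t
    using assms that by (auto simp: centered_gaussian_process_def gaussian_process_def)
  have mean: "expectation (X t) = 0" if "t \<in> {0..T}" for t
    using assms that by (auto simp: centered_gaussian_process_def)
  have law: "\<exists>m s. 0 \<le> s \<and> distr M borel (\<lambda>\<omega>. \<Sum>t\<in>F. c t * X t \<omega>) = normal_law m s"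
    if "finite F" "F \<subseteq> {0..T}" for F c
    using assms that by (auto simp: centered_gaussian_process_def gaussian_process_def)
  have int: "integrable M (X t)" if "t \<in> {0..T}" for t
  proof -
    have "\<exists>m s. 0 \<le> s \<and> distr M borel (X t) = normal_law m s"
      using law[of "{t}" "\<lambda>_. 1"] that by simp
    then obtain m s where "0 \<le> s" "distr M borel (X t) = normal_law m s"
      by blast
    then have "integrable (distr M borel (X t)) (\<lambda>x. x)"
      using normal_law_mean(1) by simp
    then show ?thesis
      using meas[OF that] by (simp add: integrable_distr_eq)
  qed
  show ?thesis
  proof
    fix Y assume "Y \<in> process_span T X"
    then obtain F c where F: "finite F" "F \<subseteq> {0..T}" and Y: "Y = (\<lambda>\<omega>. \<Sum>t\<in>F. c t * X t \<omega>)"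
      by (auto simp: process_span_def)
    show Y_meas: "Y \<in> borel_measurable M"
      unfolding Y using meas F by (intro borel_measurable_sum borel_measurable_times) auto
    obtain m s where ms: "0 \<le> s" "distr M borel Y = normal_law m s"
      using law[OF F, of c] unfolding Y by blast
    have "expectation Y = (\<Sum>t\<in>F. c t * expectation (X t))"
      unfolding Y using int F by (subst Bochner_Integration.integral_sum) (auto intro!: integrable_mult_right)
    also have "\<dots> = 0"
      using mean F by (intro sum.neutral) auto
    finally have "m = 0"
      using normal_law_mean(2)[OF ms(1), of m] Y_meas by (simp flip: ms(2) add: integral_distr)
    with ms show "\<exists>s\<ge>0. distr M borel Y = normal_law 0 s"
      by auto
  next
    show "(\<lambda>_. 0) \<in> process_span T X"
      unfolding process_span_def by (rule CollectI, rule exI[of _ "{}"]) auto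
  next
    fix Y Z and a :: real assume "Y \<in> process_span T X" "Z \<in> process_span T X"
    then obtain F c G d where F: "finite F" "F \<subseteq> {0..T}" and Y: "Y = (\<lambda>\<omega>. \<Sum>t\<in>F. c t * X t \<omega>)"
      and G: "finite G" "G \<subseteq> {0..T}" and Z: "Z = (\<lambda>\<omega>. \<Sum>t\<in>G. d t * X t \<omega>)"
      by (auto simp: process_span_def)
    define e where "e t = (if t \<in> F then c t else 0) + a * (if t \<in> G then d t else 0)" for t
    have "Y \<omega> + a * Z \<omega> = (\<Sum>t\<in>F \<union> G. e t * X t \<omega>)" for \<omega>
    proof -
      have "Y \<omega> = (\<Sum>t\<in>F \<union> G. (if t \<in> F then c t else 0) * X t \<omega>)"
        unfolding Y using F G by (intro sum.mono_neutral_cong_left) auto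
      moreover have "Z \<omega> = (\<Sum>t\<in>F \<union> G. (if t \<in> G then d t else 0) * X t \<omega>)"
        unfolding Z using F G by (intro sum.mono_neutral_cong_left) auto
      ultimately show ?thesis
        by (simp add: e_def distrib_right sum.distrib sum_distrib_left mult.assoc)
    qed
    then show "(\<lambda>\<omega>. Y \<omega> + a * Z \<omega>) \<in> process_span T X"
      unfolding process_span_def using F G
      by (intro CollectI exI[of _ "F \<union> G"] exI[of _ e]) auto
  qed
qed

lemma (in gaussian_space) cov_second_differences:
  assumes "A \<in> H" "B \<in> H" "C \<in> H" "A' \<in> H" "B' \<in> H" "C' \<in> H"
  shows "cov (\<lambda>\<omega>. A \<omega> - 2 * B \<omega> + C \<omega>) (\<lambda>\<omega>. A' \<omega> - 2 * B' \<omega> + C' \<omega>)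
    = cov A A' - 2 * cov A B' + cov A C' - 2 * (cov B A' - 2 * cov B B' + cov B C')
      + (cov C A' - 2 * cov C B' + cov C C')"
proof -
  have "cov (\<lambda>\<omega>. A \<omega> - 2 * B \<omega> + C \<omega>) (\<lambda>\<omega>. A' \<omega> - 2 * B' \<omega> + C' \<omega>)
      = expectation (\<lambda>\<omega>. A \<omega> * A' \<omega> - 2 * (A \<omega> * B' \<omega>) + A \<omega> * C' \<omega>
          - 2 * (B \<omega> * A' \<omega> - 2 * (B \<omega> * B' \<omega>) + B \<omega> * C' \<omega>)
          + (C \<omega> * A' \<omega> - 2 * (C \<omega> * B' \<omega>) + C \<omega> * C' \<omega>))"
    by (intro Bochner_Integration.integral_cong refl) (simp add: algebra_simps)
  also have "\<dots> = cov A A' - 2 * cov A B' + cov A C' - 2 * (cov B A' - 2 * cov B B' + cov B C')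
      + (cov C A' - 2 * cov C B' + cov C C')"
    using assms by (simp add: integrable_H_times_H)
  finally show ?thesis .
qed

locale normalized_process =
  fixes M :: "'a measure" and X :: "real \<Rightarrow> 'a \<Rightarrow> real" and T \<gamma> \<kappa> :: real
  assumes T_pos: "0 < T" and gamma_pos: "0 < \<gamma>" and gamma_less_1: "\<gamma> < 1" and kappa_pos: "0 < \<kappa>"
    and centered_gaussian: "centered_gaussian_process M T X"
begin

sublocale gaussian_space M "process_span T X"
  using centered_gaussian by (rule gaussian_space_process_span)

abbreviation Y :: "nat \<Rightarrow> nat \<Rightarrow> 'a \<Rightarrow> real" where
  "Y N k \<equiv> nincr2 \<kappa> \<gamma> T X N k"

abbreviation V :: "nat \<Rightarrow> 'a \<Rightarrow> real" where
  "V N \<equiv> quad_var \<kappa> \<gamma> T X N"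

definition scale :: "nat \<Rightarrow> real" where
  "scale N = \<kappa> * sqrt (4 - 2 powr (2 * \<gamma>)) * (T / real N) powr \<gamma>"

lemma four_minus_powr_pos: "0 < 4 - 2 powr (2 * \<gamma>)"
proof -
  have "2 powr (2 * \<gamma>) < 2 powr 2"
    using gamma_less_1 by (intro powr_less_mono) auto
  then show ?thesis by simp
qed

lemma scale_pos: "0 < N \<Longrightarrow> 0 < scale N"
  using kappa_pos T_pos four_minus_powr_pos by (simp add: scale_def)

lemma scale_sq: "(scale N)\<^sup>2 = \<kappa>\<^sup>2 * (4 - 2 powr (2 * \<gamma>)) * (T / real N) powr (2 * \<gamma>)"
proof -
  have "((T / real N) powr \<gamma>)\<^sup>2 = (T / real N) powr (2 * \<gamma>)"
    unfolding power2_eq_square powr_add[symmetric] by simp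
  then show ?thesis
    using four_minus_powr_pos by (simp add: scale_def power_mult_distrib)
qed

lemma scale_double: "scale n = 2 powr \<gamma> * scale (2 * n)"
proof -
  have "(T / real n) powr \<gamma> = (2 * (T / real (2 * n))) powr \<gamma>"
    by simp
  also have "\<dots> = 2 powr \<gamma> * (T / real (2 * n)) powr \<gamma>"
    using T_pos by (intro powr_mult)
  finally show ?thesis by (simp add: scale_def)
qed

lemma Y_eq: "Y N k \<omega> = incr2 T X N k \<omega> / scale N"
  by (simp add: nincr2_def scale_def)

lemma node_in_interval:
  assumes "k \<le> N"
  shows "real k / real N * T \<in> {0..T}"
  using assms T_pos mult_left_le_one_le[of T "real k / real N"] by (simp add: divide_le_eq)

lemma incr2_nodes_in_span:
  assumes "k \<in> {1..N-1}"
  shows "X ((real k + 1) / real N * T) \<in> process_span T X" "X (real k / real N * T) \<in> process_span T X"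
    "X ((real k - 1) / real N * T) \<in> process_span T X"
  using node_in_interval[of "k + 1" N] node_in_interval[of k N] node_in_interval[of "k - 1" N] assms
  by (auto intro!: process_in_span simp: of_nat_diff add.commute)

lemma incr2_in_span:
  assumes "k \<in> {1..N-1}"
  shows "incr2 T X N k \<in> process_span T X"
proof -
  have "(\<lambda>\<omega>. (X ((real k + 1) / real N * T) \<omega> + (- 2) * X (real k / real N * T) \<omega>)
      + 1 * X ((real k - 1) / real N * T) \<omega>) \<in> process_span T X"
    by (intro H_add_scaled incr2_nodes_in_span assms)
  then show ?thesis
    by (simp add: incr2_def[abs_def])
qed

lemma Y_in_span: "k \<in> {1..N-1} \<Longrightarrow> Y N k \<in> process_span T X"
  using H_scale[OF incr2_in_span, of k N "1 / scale N"] by (simp add: Y_eq[abs_def])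

text \<open>The identity \<open>(1, 0, -2, 0, 1) = (1, -2, 1) * (1, 2, 1)\<close> of difference masks.  It expresses the
  increments of the mesh \<open>n\<close> through those of the mesh \<open>2 n\<close>.\<close>

lemma Y_coarse:
  assumes "j \<in> {1..n-1}"
  shows "Y n j \<omega> = 2 powr (- \<gamma>) * (Y (2 * n) (2 * j - 1) \<omega> + 2 * Y (2 * n) (2 * j) \<omega> + Y (2 * n) (2 * j + 1) \<omega>)"
proof -
  have j: "real (2 * j - 1) = 2 * real j - 1"
    using assms by (simp add: of_nat_diff)
  have nodes: "(2 * real j - 1 + 1) / (2 * real n) * T = real j / real n * T"
    "(2 * real j + 1 + 1) / (2 * real n) * T = (real j + 1) / real n * T"
    "2 * real j / (2 * real n) * T = real j / real n * T"
    "(2 * real j - 1 - 1) / (2 * real n) * T = (real j - 1) / real n * T"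
    "(2 * real j + 1 - 1) / (2 * real n) * T = real j / real n * T"
    by (simp_all add: divide_simps)
  have "incr2 T X n j \<omega> = incr2 T X (2 * n) (2 * j - 1) \<omega> + 2 * incr2 T X (2 * n) (2 * j) \<omega>
      + incr2 T X (2 * n) (2 * j + 1) \<omega>"
    unfolding incr2_def j of_nat_add of_nat_mult of_nat_numeral of_nat_1 nodes by simp
  moreover have "0 < scale (2 * n)"
    using assms by (intro scale_pos) auto
  ultimately show ?thesis
    unfolding Y_eq scale_double[of n] by (simp add: powr_minus divide_simps)
qed

lemma V_centered: "V N \<omega> - expectation (V N) = qform {1..N-1} (\<lambda>_. 1) (Y N) \<omega>"
proof -
  have "expectation (V N) = (\<Sum>k=1..N-1. cov (Y N k) (Y N k))"
    unfolding quad_var_def[abs_def] power2_eq_square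
    using Y_in_span integrable_H_times_H by (simp add: Bochner_Integration.integral_sum)
  then show ?thesis
    by (simp add: quad_var_def qform_def power2_eq_square sum_subtractf)
qed

lemma covariance_scaled_V_qform:
  "covariance M (\<lambda>\<omega>. a * V N \<omega>) (\<lambda>\<omega>. b * V N' \<omega>)
    = a * b * cov (qform {1..N-1} (\<lambda>_. 1) (Y N)) (qform {1..N'-1} (\<lambda>_. 1) (Y N'))"
proof -
  have centered: "c * V K \<omega> - expectation (\<lambda>\<omega>. c * V K \<omega>) = c * qform {1..K-1} (\<lambda>_. 1) (Y K) \<omega>" for c K \<omega>
    by (simp only: V_centered[symmetric] right_diff_distrib integral_mult_right_zero)
  have "covariance M (\<lambda>\<omega>. a * V N \<omega>) (\<lambda>\<omega>. b * V N' \<omega>)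
      = expectation (\<lambda>\<omega>. (a * b) * (qform {1..N-1} (\<lambda>_. 1) (Y N) \<omega> * qform {1..N'-1} (\<lambda>_. 1) (Y N') \<omega>))"
    unfolding covariance_def centered
    by (intro Bochner_Integration.integral_cong refl) (simp only: mult_ac)
  then show ?thesis
    by simp
qed

lemma covariance_scaled_V:
  "covariance M (\<lambda>\<omega>. a * V N \<omega>) (\<lambda>\<omega>. b * V N' \<omega>)
    = 2 * a * b * (\<Sum>j=1..N-1. \<Sum>k=1..N'-1. (cov (Y N j) (Y N' k))\<^sup>2)"
  unfolding covariance_scaled_V_qform by (subst cov_qform_qform) (auto simp: Y_in_span)

end

context normalized_process
begin

text \<open>The index set of all increments of the meshes \<open>n\<close> and \<open>2 n\<close>; the first component is the mesh.\<close>

definition grid :: "nat \<Rightarrow> (nat \<times> nat) set" where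
  "grid n = (SIGMA N:{n, 2 * n}. {1..N-1})"

definition weight :: "nat \<Rightarrow> nat \<times> nat \<Rightarrow> real" where
  "weight n i = (if fst i = n then 1 else - 1) * sqrt (real n) / real (fst i)"

text \<open>The linear part of the normalized estimation error.\<close>

definition fluctuation :: "nat \<Rightarrow> 'a \<Rightarrow> real" where
  "fluctuation n = qform (grid n) (weight n) (case_prod Y)"

lemma grid_in_span: "i \<in> grid n \<Longrightarrow> case_prod Y i \<in> process_span T X"
  using Y_in_span by (auto simp: grid_def)

lemma sum_grid:
  assumes "0 < n"
  shows "(\<Sum>i\<in>grid n. f i) = (\<Sum>k=1..n-1. f (n, k)) + (\<Sum>k=1..2*n-1. f (2 * n, k))"
proof -
  have "(\<Sum>i\<in>grid n. f i) = (\<Sum>N\<in>{n, 2 * n}. \<Sum>k=1..N-1. f (N, k))"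
    unfolding grid_def by (subst sum.Sigma) auto
  then show ?thesis using assms by simp
qed

lemma cov_Y_coarse:
  assumes j: "j \<in> {1..n-1}" and U: "U \<in> process_span T X"
  shows "cov (Y n j) U = 2 powr (- \<gamma>) *
    (cov (Y (2 * n) (2 * j - 1)) U + 2 * cov (Y (2 * n) (2 * j)) U + cov (Y (2 * n) (2 * j + 1)) U)"
proof -
  have mem: "Y (2 * n) (2 * j - 1) \<in> process_span T X" "Y (2 * n) (2 * j) \<in> process_span T X"
    "Y (2 * n) (2 * j + 1) \<in> process_span T X"
    using j by (auto intro!: Y_in_span)
  have "cov (Y n j) U = expectation (\<lambda>\<omega>. 2 powr (- \<gamma>) * (Y (2 * n) (2 * j - 1) \<omega> * U \<omega>
      + 2 * (Y (2 * n) (2 * j) \<omega> * U \<omega>) + Y (2 * n) (2 * j + 1) \<omega> * U \<omega>))"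
    unfolding Y_coarse[OF j] by (intro Bochner_Integration.integral_cong refl) (simp add: algebra_simps)
  then show ?thesis
    using integrable_H_times_H[OF mem(1) U] integrable_H_times_H[OF mem(2) U] integrable_H_times_H[OF mem(3) U]
    by simp
qed

text \<open>Only the covariances between the two meshes are new.  By \<open>Y_coarse\<close> each of them is at most a
  combination of three covariances within the fine mesh with weights \<open>1, 2, 1\<close>, so they contribute
  at most \<open>4 C\<close> to a row.\<close>

lemma row_bounded_grid:
  assumes C: "0 \<le> C" and coarse: "row_bounded {1..n-1} (Y n) C"
    and fine: "row_bounded {1..2*n-1} (Y (2 * n)) C"
  shows "row_bounded (grid n) (case_prod Y) (5 * C)"
proof (cases "n = 0")
  case True
  then show ?thesis by (simp add: row_bounded_def grid_def)
next
  case False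
  then have n: "0 < n" by simp
  let ?d = "\<lambda>l k. \<bar>cov (Y (2 * n) l) (Y (2 * n) k)\<bar>"
  have cross: "\<bar>cov (Y n j) (Y (2 * n) k)\<bar> \<le> ?d (2 * j - 1) k + 2 * ?d (2 * j) k + ?d (2 * j + 1) k"
    if jk: "j \<in> {1..n-1}" "k \<in> {1..2*n-1}" for j k
  proof -
    have tri: "\<bar>a + 2 * b + c\<bar> \<le> \<bar>a\<bar> + 2 * \<bar>b\<bar> + \<bar>c\<bar>" for a b c :: real
      by linarith
    have "2 powr (- \<gamma>) \<le> 1"
      using gamma_pos powr_mono[of "- \<gamma>" 0 "2::real"] by simp
    then have "2 powr (- \<gamma>) * \<bar>a\<bar> \<le> \<bar>a\<bar>" for a
      using mult_right_mono[of "2 powr (- \<gamma>)" 1 "\<bar>a\<bar>"] by simp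
    from order_trans[OF this tri] show ?thesis
      unfolding cov_Y_coarse[OF jk(1) Y_in_span[OF jk(2)]] by (simp add: abs_mult)
  qed
  have row: "(\<Sum>k=1..2*n-1. ?d l k) \<le> C" if "l \<in> {1..2*n-1}" for l
    using fine that unfolding row_bounded_def by blast
  have col: "(\<Sum>j=1..n-1. ?d (h j) k) \<le> C"
    if "k \<in> {1..2*n-1}" "inj_on h {1..n-1}" "h ` {1..n-1} \<subseteq> {1..2*n-1}" for h k
  proof -
    have "(\<Sum>j=1..n-1. ?d (h j) k) = (\<Sum>l\<in>h ` {1..n-1}. ?d l k)"
      using that(2) by (simp add: sum.reindex)
    also have "\<dots> \<le> (\<Sum>l=1..2*n-1. ?d l k)"
      using that(3) by (intro sum_mono2) auto
    also have "\<dots> = (\<Sum>l=1..2*n-1. ?d k l)"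
      by (simp add: mult.commute)
    finally show ?thesis
      using row[OF that(1)] by simp
  qed
  show ?thesis
    unfolding row_bounded_def
  proof
    fix i assume "i \<in> grid n"
    then consider j where "i = (n, j)" "j \<in> {1..n-1}" | k where "i = (2 * n, k)" "k \<in> {1..2*n-1}"
      by (auto simp: grid_def)
    then show "(\<Sum>i'\<in>grid n. \<bar>cov (case_prod Y i) (case_prod Y i')\<bar>) \<le> 5 * C"
    proof cases
      case 1
      have sub: "2 * j - 1 \<in> {1..2*n-1}" "2 * j \<in> {1..2*n-1}" "2 * j + 1 \<in> {1..2*n-1}"
        using 1(2) by auto
      have "(\<Sum>k=1..2*n-1. \<bar>cov (Y n j) (Y (2 * n) k)\<bar>)
          \<le> (\<Sum>k=1..2*n-1. ?d (2 * j - 1) k + 2 * ?d (2 * j) k + ?d (2 * j + 1) k)"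
        using 1(2) by (intro sum_mono cross)
      also have "\<dots> = (\<Sum>k=1..2*n-1. ?d (2 * j - 1) k) + 2 * (\<Sum>k=1..2*n-1. ?d (2 * j) k)
          + (\<Sum>k=1..2*n-1. ?d (2 * j + 1) k)"
        by (simp only: sum.distrib sum_distrib_left)
      finally have "(\<Sum>k=1..2*n-1. \<bar>cov (Y n j) (Y (2 * n) k)\<bar>) \<le> 4 * C"
        using row[OF sub(1)] row[OF sub(2)] row[OF sub(3)] by linarith
      moreover have "(\<Sum>k=1..n-1. \<bar>cov (Y n j) (Y n k)\<bar>) \<le> C"
        using coarse 1(2) unfolding row_bounded_def by blast
      ultimately show ?thesis
        unfolding sum_grid[OF n] 1(1) case_prod_conv by linarith
    next
      case 2
      have "(\<Sum>j=1..n-1. \<bar>cov (Y (2 * n) k) (Y n j)\<bar>) = (\<Sum>j=1..n-1. \<bar>cov (Y n j) (Y (2 * n) k)\<bar>)"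
        by (simp add: mult.commute)
      also have "\<dots> \<le> (\<Sum>j=1..n-1. ?d (2 * j - 1) k + 2 * ?d (2 * j) k + ?d (2 * j + 1) k)"
        using 2(2) by (intro sum_mono cross)
      also have "\<dots> = (\<Sum>j=1..n-1. ?d (2 * j - 1) k) + 2 * (\<Sum>j=1..n-1. ?d (2 * j) k)
          + (\<Sum>j=1..n-1. ?d (2 * j + 1) k)"
        by (simp only: sum.distrib sum_distrib_left)
      also have "\<dots> \<le> C + 2 * C + C"
        using 2(2) by (intro add_mono mult_left_mono col) (auto simp: inj_on_def)
      finally show ?thesis
        using row[OF 2(2)] unfolding sum_grid[OF n] 2(1) case_prod_conv by linarith
    qed
  qed
qed

lemma fluctuation_eq:
  assumes "0 < n"
  shows "fluctuation n \<omega> = sqrt (real n) *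
    ((V n \<omega> - expectation (V n)) / real n - (V (2 * n) \<omega> - expectation (V (2 * n))) / real (2 * n))"
proof -
  have coarse: "(\<Sum>k=1..n-1. weight n (n, k) * (Y n k \<omega> * Y n k \<omega> - cov (Y n k) (Y n k)))
      = sqrt (real n) * ((V n \<omega> - expectation (V n)) / real n)"
    unfolding V_centered qform_def by (simp add: weight_def sum_distrib_left sum_divide_distrib)
  have fine: "(\<Sum>k=1..2*n-1. weight n (2 * n, k) * (Y (2 * n) k \<omega> * Y (2 * n) k \<omega> - cov (Y (2 * n) k) (Y (2 * n) k)))
      = - sqrt (real n) * ((V (2 * n) \<omega> - expectation (V (2 * n))) / real (2 * n))"
    unfolding V_centered qform_def using assms by (simp add: weight_def sum_distrib_left sum_divide_distrib sum_negf)
  show ?thesis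
    unfolding fluctuation_def qform_def sum_grid[OF assms] case_prod_conv coarse fine
    by (simp only: mult_minus_left right_diff_distrib add_uminus_conv_diff)
qed

lemma variance_fluctuation:
  assumes n: "0 < n"
  shows "cov (fluctuation n) (fluctuation n) = 1 / real n *
    (covariance M (\<lambda>\<omega>. 1 * V n \<omega>) (\<lambda>\<omega>. 1 * V n \<omega>)
      + covariance M (\<lambda>\<omega>. 1/2 * V (2 * n) \<omega>) (\<lambda>\<omega>. 1/2 * V (2 * n) \<omega>)
      - 2 * covariance M (\<lambda>\<omega>. 1 * V n \<omega>) (\<lambda>\<omega>. 1/2 * V (2 * n) \<omega>))"
proof -
  let ?u = "qform {1..n-1} (\<lambda>_. 1) (Y n)" and ?w = "qform {1..2*n-1} (\<lambda>_. 1) (Y (2 * n))"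
  have hm: "has_moments ?u" "has_moments ?w"
    using Y_in_span by (auto intro!: has_moments_qform)
  have int: "integrable M (\<lambda>\<omega>. ?u \<omega> * ?u \<omega>)" "integrable M (\<lambda>\<omega>. ?u \<omega> * ?w \<omega>)" "integrable M (\<lambda>\<omega>. ?w \<omega> * ?w \<omega>)"
    by (intro has_moments_integrable has_moments_mult hm)+
  have sq: "fluctuation n \<omega> * fluctuation n \<omega>
      = 1 / real n * (?u \<omega> * ?u \<omega> + 1/4 * (?w \<omega> * ?w \<omega>) - ?u \<omega> * ?w \<omega>)" for \<omega>
  proof -
    have "(sqrt (real n) * (a / real n - b / real (2 * n))) * (sqrt (real n) * (a / real n - b / real (2 * n)))
        = real n * ((a / real n - b / real (2 * n)) * (a / real n - b / real (2 * n)))" for a b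
      by (simp add: algebra_simps)
    also have "real n * ((a / real n - b / real (2 * n)) * (a / real n - b / real (2 * n)))
        = 1 / real n * (a * a + 1/4 * (b * b) - a * b)" for a b
      using n by (simp add: field_simps)
    finally show ?thesis
      unfolding fluctuation_eq[OF n] V_centered .
  qed
  have "cov (fluctuation n) (fluctuation n) = 1 / real n * (cov ?u ?u + 1/4 * cov ?w ?w - cov ?u ?w)"
    unfolding sq using int by simp
  then show ?thesis
    unfolding covariance_scaled_V_qform by simp
qed

text \<open>For \<open>n = 0\<close> the grid is empty, and the bound on the weights is set to one to keep it
  positive.\<close>

lemma admissible_grid:
  assumes C: "0 \<le> C" and rows: "\<And>N. row_bounded {1..N-1} (Y N) C"
  shows "admissible (5 * C) 3 (if n = 0 then 1 else 1 / sqrt (real n)) (grid n) (weight n) (case_prod Y)"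
proof (cases "n = 0")
  case True
  then show ?thesis
    by (simp add: admissible_def grid_def row_bounded_def)
next
  case False
  then have n: "0 < n" by simp
  have "real (card (grid n)) = (\<Sum>i\<in>grid n. 1)"
    by simp
  also have "\<dots> = real (n - 1) + real (2 * n - 1)"
    unfolding sum_grid[OF n] by simp
  also have "\<dots> \<le> 3 * real n"
    using n by (simp add: of_nat_diff)
  finally have card: "real (card (grid n)) \<le> 3 * real n" .
  have "\<bar>weight n i\<bar> \<le> 1 / sqrt (real n)" if "i \<in> grid n" for i
  proof -
    have "fst i = n \<or> fst i = 2 * n"
      using that by (auto simp: grid_def)
    then have "real n \<le> real (fst i)"
      by auto
    then have "sqrt (real n) / real (fst i) \<le> sqrt (real n) / real n"
      using n by (intro divide_left_mono) auto
    moreover have "sqrt (real n) / real n = 1 / sqrt (real n)"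
      using n by (simp add: field_simps)
    moreover have "\<bar>weight n i\<bar> = sqrt (real n) / real (fst i)"
      by (simp add: weight_def)
    ultimately show ?thesis by simp
  qed
  moreover have "(1 / sqrt (real n))\<^sup>2 * real (card (grid n)) \<le> 3"
    using card n by (simp add: power_divide divide_le_eq)
  moreover have "finite (grid n)"
    by (simp add: grid_def)
  ultimately show ?thesis
    using n row_bounded_grid[OF C rows rows] grid_in_span by (simp add: admissible_def)
qed

text \<open>The fourth power of the sequence is \<open>N\<^sup>-\<^sup>2\<close> times the eighth power of the form with weights
  \<open>1 / \<surd>N\<close>.  That form has a bounded eighth moment, so the expectations are summable.\<close>

lemma AE_quad_var_fluctuation_rate:
  assumes C: "0 \<le> C" and rows: "\<And>N. row_bounded {1..N-1} (Y N) C"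
  shows "AE \<omega> in M. (\<lambda>N. sqrt (real N) * ((V N \<omega> - expectation (V N)) / real N)\<^sup>2) \<longlonglongrightarrow> 0"
proof -
  define F where "F N = qform {1..N-1} (\<lambda>_. 1 / sqrt (real N)) (Y N)" for N
  have adm: "admissible C 1 (1 / sqrt (real N)) {1..N-1} (\<lambda>_. 1 / sqrt (real N)) (Y N)" if "0 < N" for N
    using that rows Y_in_span by (auto simp: admissible_def power_divide divide_le_eq of_nat_diff)
  obtain B where B: "\<And>N. 0 < N \<Longrightarrow> expectation (\<lambda>\<omega>. F N \<omega> ^ (2 * 4)) \<le> B"
    using even_moments_qform_bounded[OF C, of 1 4] adm unfolding F_def by (metis zero_le_one)
  have hF: "has_moments (F N)" for N
    unfolding F_def using Y_in_span by (intro has_moments_qform) auto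
  have F_eq: "F N \<omega> = (V N \<omega> - expectation (V N)) / sqrt (real N)" for N \<omega>
    unfolding V_centered F_def qform_def by (simp add: sum_divide_distrib)
  define W where "W N \<omega> = 1 / (real N)\<^sup>2 * F N \<omega> ^ (2 * 4)" for N \<omega>
  have "AE \<omega> in M. (\<lambda>N. W N \<omega>) \<longlonglongrightarrow> 0"
  proof (rule AE_tendsto_0_if_expectations_summable)
    show "0 \<le> W N \<omega>" for N \<omega>
      unfolding W_def by (intro mult_nonneg_nonneg zero_le_even_power) auto
    show "integrable M (W N)" for N
      unfolding W_def by (intro has_moments_integrable has_moments_mult has_moments_const has_moments_power hF)
    have "summable (\<lambda>N. \<bar>B\<bar> * (1 / (real N)\<^sup>2))"
      using inverse_power_summable[of 2, where 'a = real] by (intro summable_mult) (simp add: inverse_eq_divide)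
    moreover have "norm (expectation (W N)) \<le> \<bar>B\<bar> * (1 / (real N)\<^sup>2)" if "1 \<le> N" for N
    proof -
      have "0 \<le> expectation (\<lambda>\<omega>. F N \<omega> ^ (2 * 4))"
        by (intro integral_nonneg_AE) simp
      then show ?thesis
        using B[of N] that unfolding W_def[abs_def] by (simp add: divide_right_mono)
    qed
    ultimately show "summable (\<lambda>N. expectation (W N))"
      by (rule summable_comparison_test'[where N = 1])
  qed
  then show ?thesis
  proof eventually_elim
    case (elim \<omega>)
    (* Taking fourth roots recovers the sequence, since its terms are nonnegative. *)
    let ?w = "\<lambda>N. sqrt (real N) * ((V N \<omega> - expectation (V N)) / real N)\<^sup>2"
    have "W N \<omega> = ?w N ^ 4" for N
    proof (cases "N = 0")
      case False
      define q where "q = sqrt (real N)"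
      have q: "real N = q\<^sup>2" "q \<noteq> 0"
        using False by (auto simp: q_def)
      show ?thesis
        unfolding W_def F_eq q_def[symmetric] unfolding q(1)
        using q(2) by (simp add: power_mult_distrib power_divide field_simps flip: power_mult power_add)
    qed (simp add: W_def)
    then have "root 4 (W N \<omega>) = ?w N" for N
      using real_root_power_cancel[of 4 "?w N"] by simp
    moreover have "(\<lambda>N. root 4 (W N \<omega>)) \<longlonglongrightarrow> root 4 0"
      by (intro tendsto_real_root elim)
    ultimately show ?case by simp
  qed
qed

lemma AE_quad_var_rate:
  assumes C: "0 \<le> C" and rows: "\<And>N. row_bounded {1..N-1} (Y N) C"
    and mean: "(\<lambda>N. sqrt (real N) * (expectation (V N) / real N - 1)) \<longlonglongrightarrow> 0"
  shows "AE \<omega> in M. (\<lambda>N. sqrt (real N) * (V N \<omega> / real N - 1)\<^sup>2) \<longlonglongrightarrow> 0"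
proof -
  let ?m = "\<lambda>N. expectation (V N) / real N - 1"
  have "?m \<longlonglongrightarrow> 0"
  proof (rule tendsto_rabs_zero_cancel, rule tendsto_sandwich[OF _ _ tendsto_const tendsto_rabs_zero[OF mean]])
    show "\<forall>\<^sub>F N in sequentially. \<bar>?m N\<bar> \<le> \<bar>sqrt (real N) * ?m N\<bar>"
      using eventually_ge_at_top[of 1]
    proof eventually_elim
      case (elim N)
      then have "1 \<le> sqrt (real N)" by simp
      from mult_right_mono[OF this, of "\<bar>?m N\<bar>"] show ?case
        by (simp add: abs_mult)
    qed
  qed simp
  from tendsto_mult[OF mean this] have mean_sq: "(\<lambda>N. sqrt (real N) * (?m N)\<^sup>2) \<longlonglongrightarrow> 0"
    by (simp add: power2_eq_square mult_ac)
  from AE_quad_var_fluctuation_rate[OF C rows] show ?thesis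
  proof eventually_elim
    case (elim \<omega>)
    let ?f = "\<lambda>N. (V N \<omega> - expectation (V N)) / real N"
    have upper: "(\<lambda>N. 2 * (sqrt (real N) * (?f N)\<^sup>2) + 2 * (sqrt (real N) * (?m N)\<^sup>2)) \<longlonglongrightarrow> 0"
      using tendsto_add[OF tendsto_mult_right_zero[OF elim, of 2] tendsto_mult_right_zero[OF mean_sq, of 2]] by simp
    show ?case
    proof (rule tendsto_sandwich[OF _ _ tendsto_const upper])
      have "sqrt (real N) * (V N \<omega> / real N - 1)\<^sup>2 \<le> 2 * (sqrt (real N) * (?f N)\<^sup>2) + 2 * (sqrt (real N) * (?m N)\<^sup>2)" for N
      proof -
        have eq: "V N \<omega> / real N - 1 = ?f N + ?m N"
          by (simp add: diff_divide_distrib)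
        have "(?f N + ?m N)\<^sup>2 \<le> 2 * (?f N)\<^sup>2 + 2 * (?m N)\<^sup>2"
          using sum_squares_bound[of "?f N" "?m N"] by (simp add: power2_sum)
        then have "sqrt (real N) * (?f N + ?m N)\<^sup>2 \<le> sqrt (real N) * (2 * (?f N)\<^sup>2 + 2 * (?m N)\<^sup>2)"
          by (intro mult_left_mono) auto
        then show ?thesis
          unfolding eq by (simp only: distrib_left mult.left_commute)
      qed
      then show "\<forall>\<^sub>F N in sequentially. sqrt (real N) * (V N \<omega> / real N - 1)\<^sup>2
          \<le> 2 * (sqrt (real N) * (?f N)\<^sup>2) + 2 * (sqrt (real N) * (?m N)\<^sup>2)"
        by simp
    qed simp
  qed
qed

lemma sum_incr2_sq: "0 < N \<Longrightarrow> (\<Sum>k=1..N-1. (incr2 T X N k \<omega>)\<^sup>2) = (scale N)\<^sup>2 * V N \<omega>"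
  using scale_pos[of N] by (simp add: quad_var_def Y_eq power_divide sum_distrib_left)

lemma gamma_hat_eq:
  assumes n: "0 < n" and V: "0 < V n \<omega>" "0 < V (2 * n) \<omega>"
  shows "2 * ln 2 * (gamma_hat T X n \<omega> - \<gamma>) = ln (V n \<omega> / real n) - ln (V (2 * n) \<omega> / real (2 * n))"
proof -
  have n2: "0 < 2 * n" using n by simp
  have "(\<Sum>k=1..2*n-1. (incr2 T X (2 * n) k \<omega>)\<^sup>2) / (\<Sum>k=1..n-1. (incr2 T X n k \<omega>)\<^sup>2)
      = 2 * (V (2 * n) \<omega> / real (2 * n)) / ((2 powr \<gamma>)\<^sup>2 * (V n \<omega> / real n))"
    unfolding sum_incr2_sq[OF n] sum_incr2_sq[OF n2]
    using n scale_pos[OF n2] by (simp add: scale_double[of n] power_mult_distrib)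
  also have "ln \<dots> = ln 2 + ln (V (2 * n) \<omega> / real (2 * n)) - (2 * \<gamma> * ln 2 + ln (V n \<omega> / real n))"
    using n V by (simp add: ln_div ln_mult ln_realpow)
  finally have ratio: "ln ((\<Sum>k=1..2*n-1. (incr2 T X (2 * n) k \<omega>)\<^sup>2) / (\<Sum>k=1..n-1. (incr2 T X n k \<omega>)\<^sup>2))
      = ln 2 + ln (V (2 * n) \<omega> / real (2 * n)) - (2 * \<gamma> * ln 2 + ln (V n \<omega> / real n))" .
  have "2 * ln 2 * (1/2 - 1 / (2 * ln 2) * r - \<gamma>) = ln 2 - r - 2 * \<gamma> * ln 2" for r :: real
    by (simp add: right_diff_distrib)
  then show ?thesis
    unfolding gamma_hat_def ratio by simp
qed

lemma gamma_hat_measurable: "gamma_hat T X n \<in> borel_measurable M"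
proof -
  have "incr2 T X N k \<in> borel_measurable M" if "k \<in> {1..N-1}" for N k
    using incr2_in_span[OF that] by (rule H_measurable)
  then have "(\<lambda>\<omega>. \<Sum>k=1..N-1. (incr2 T X N k \<omega>)\<^sup>2) \<in> borel_measurable M" for N
    by (intro borel_measurable_sum borel_measurable_power) auto
  then show ?thesis
    unfolding gamma_hat_def[abs_def] by measurable
qed

end

lemma max_row_sum_row_bounded:
  assumes "normalized_process M X T \<gamma> \<kappa>"
    and "max_row_sum M \<kappa> \<gamma> T X N \<le> C"
  shows "gaussian_space.row_bounded M {1..N-1} (nincr2 \<kappa> \<gamma> T X N) C"
proof -
  interpret normalized_process M X T \<gamma> \<kappa> by fact
  show ?thesis
    unfolding row_bounded_def
  proof
    fix k assume k: "k \<in> {1..N-1}"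
    then have "(\<Sum>j=1..N-1. \<bar>incr_cov M \<kappa> \<gamma> T X N j k\<bar>)
        \<le> (MAX k\<in>{1..N-1}. \<Sum>j=1..N-1. \<bar>incr_cov M \<kappa> \<gamma> T X N j k\<bar>)"
      by (intro Max_ge) auto
    also have "\<dots> \<le> C"
      using assms(2) k by (simp add: max_row_sum_def split: if_splits)
    finally show "(\<Sum>j=1..N-1. \<bar>cov (Y N k) (Y N j)\<bar>) \<le> C"
      by (simp add: incr_cov_def mult.commute)
  qed
qed

section \<open>Covariances of the quadratic variations of fractional Brownian motion\<close>

text \<open>Second differences annihilate the parts of the covariance that depend on one time only; the part
  \<open>- \<bar>t - s\<bar>\<^sup>2\<^sup>\<gamma> / 2\<close> is turned into a fourth difference, which is \<open>rho_hat\<close> up to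
  scaling.\<close>

lemma fbm_cov_incr2:
  assumes B: "fractional_brownian_motion M T \<gamma> B" and T: "0 < T" and gamma: "0 < \<gamma>" "\<gamma> < 1"
    and jk: "j \<in> {1..N-1}" "k \<in> {1..N-1}"
  shows "(\<integral>\<omega>. incr2 T B N j \<omega> * incr2 T B N k \<omega> \<partial>M) = (T / real N) powr (2 * \<gamma>) * rho_hat \<gamma> (int j - int k)"
proof -
  interpret normalized_process M B T \<gamma> 1
    using B T gamma by unfold_locales (auto simp: fractional_brownian_motion_def)
  define p where "p = 2 * \<gamma>"
  define h where "h = T / real N"
  define s where "s x = x / real N * T" for x
  have N: "0 < N" using jk by auto
  have cov_B: "cov (B (s (real j + a))) (B (s (real k + b)))
      = 1/2 * (s (real j + a) powr p + s (real k + b) powr p) - 1/2 * (\<bar>real_of_int (int j - int k) + (a - b)\<bar> powr p * h powr p)"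
    if ab: "a \<in> {-1, 0, 1}" "b \<in> {-1, 0, 1}" for a b :: real
  proof -
    have in_T: "s (real l + c) \<in> {0..T}" if "l \<in> {1..N-1}" "c \<in> {-1, 0, 1}" for l and c :: real
    proof -
      have "0 \<le> (real l + c) / real N" "(real l + c) / real N \<le> 1"
        using that by (auto simp: divide_le_eq of_nat_diff)
      then have "0 \<le> (real l + c) / real N * T" "(real l + c) / real N * T \<le> T"
        using T by (intro mult_nonneg_nonneg mult_left_le_one_le; simp)+
      then show ?thesis
        by (simp add: s_def)
    qed
    have "s (real j + a) - s (real k + b) = (real_of_int (int j - int k) + (a - b)) * h"
      by (simp add: s_def h_def diff_divide_distrib add_divide_distrib algebra_simps)
    then have "\<bar>s (real j + a) - s (real k + b)\<bar> = \<bar>real_of_int (int j - int k) + (a - b)\<bar> * h"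
      using T by (simp add: abs_mult h_def)
    then have "\<bar>s (real j + a) - s (real k + b)\<bar> powr p = \<bar>real_of_int (int j - int k) + (a - b)\<bar> powr p * h powr p"
      by (simp add: powr_mult)
    moreover have "cov (B (s (real j + a))) (B (s (real k + b)))
        = 1/2 * (s (real j + a) powr p + s (real k + b) powr p - \<bar>s (real j + a) - s (real k + b)\<bar> powr p)"
      using B in_T[OF jk(1) ab(1)] in_T[OF jk(2) ab(2)] by (simp add: fractional_brownian_motion_def p_def)
    ultimately show ?thesis
      by (simp only: right_diff_distrib)
  qed
  have incr: "incr2 T B N l = (\<lambda>\<omega>. B (s (real l + 1)) \<omega> - 2 * B (s (real l + 0)) \<omega> + B (s (real l + - 1)) \<omega>)" for l
    by (simp add: incr2_def[abs_def] s_def)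
  have mem: "B (s (real l + 1)) \<in> process_span T B" "B (s (real l + 0)) \<in> process_span T B"
    "B (s (real l + - 1)) \<in> process_span T B" if "l \<in> {1..N-1}" for l
    using incr2_nodes_in_span[OF that] by (simp_all add: s_def)
  have "cov (incr2 T B N j) (incr2 T B N k) = h powr p * rho_hat \<gamma> (int j - int k)"
    unfolding incr cov_second_differences[OF mem[OF jk(1)] mem[OF jk(2)]] rho_hat_def p_def[symmetric]
    by (simp only: cov_B insert_iff simp_thms) (simp add: algebra_simps add_divide_distrib)
  then show ?thesis
    by (simp add: h_def p_def)
qed

locale normalized_fbm = normalized_process M B T \<gamma> 1
  for M :: "'a measure" and B T \<gamma> +
  assumes fbm: "fractional_brownian_motion M T \<gamma> B"
begin

lemma cov_Y:
  assumes "j \<in> {1..N-1}" "k \<in> {1..N-1}"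
  shows "cov (Y N j) (Y N k) = rho_hat \<gamma> (int j - int k) / (4 - 2 powr (2 * \<gamma>))"
proof -
  have N: "0 < N" using assms by auto
  have "cov (Y N j) (Y N k) = cov (incr2 T B N j) (incr2 T B N k) / (scale N)\<^sup>2"
    unfolding Y_eq power2_eq_square times_divide_times_eq by simp
  also have "\<dots> = rho_hat \<gamma> (int j - int k) / (4 - 2 powr (2 * \<gamma>))"
    unfolding fbm_cov_incr2[OF fbm T_pos gamma_pos gamma_less_1 assms] scale_sq
    using N T_pos by simp
  finally show ?thesis .
qed

lemma cov_Y_coarse_fine:
  assumes j: "j \<in> {1..n-1}" and k: "k \<in> {1..2*n-1}"
  shows "cov (Y n j) (Y (2 * n) k)
    = 2 powr (- \<gamma>) * rho_tilde \<gamma> (int k - int 2 * int j) / (4 - 2 powr (2 * \<gamma>))"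
proof -
  have mem: "2 * j - 1 \<in> {1..2*n-1}" "2 * j \<in> {1..2*n-1}" "2 * j + 1 \<in> {1..2*n-1}"
    using j by auto
  define d where "d = int k - int 2 * int j"
  have e: "int (2 * j - 1) - int k = - (d + 1)" "int (2 * j) - int k = - d" "int (2 * j + 1) - int k = - (d - 1)"
    using j by (auto simp: d_def of_nat_diff)
  show ?thesis
    unfolding cov_Y_coarse[OF j Y_in_span[OF k]] cov_Y[OF mem(1) k] cov_Y[OF mem(2) k] cov_Y[OF mem(3) k]
      e rho_hat_minus d_def[symmetric] rho_tilde_eq
    by (simp add: add_divide_distrib algebra_simps)
qed

lemma covariance_same_mesh_limit:
  "(\<lambda>n. 1 / real n * covariance M (\<lambda>\<omega>. 1 * V n \<omega>) (\<lambda>\<omega>. 1 * V n \<omega>)) \<longlonglongrightarrow> Sigma11 \<gamma>"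
proof -
  let ?q = "4 - 2 powr (2 * \<gamma>)"
  have "(\<lambda>n. 2 / ?q\<^sup>2 * ((\<Sum>j=1..n-1. \<Sum>k=1..1*n-1. (rho_hat \<gamma> (int k - int 1 * int j))\<^sup>2) / real n))
      \<longlonglongrightarrow> 2 / ?q\<^sup>2 * infsum (\<lambda>d. (rho_hat \<gamma> d)\<^sup>2) UNIV"
    using has_sum_rho_hat_sq[OF gamma_pos gamma_less_1]
    by (intro tendsto_mult tendsto_const Cesaro_sum_lattice_differences) (auto simp: summable_on_def)
  moreover have "2 / ?q\<^sup>2 * infsum (\<lambda>d. (rho_hat \<gamma> d)\<^sup>2) UNIV = Sigma11 \<gamma>"
    unfolding infsumI[OF has_sum_rho_hat_sq[OF gamma_pos gamma_less_1]] using four_minus_powr_pos by simp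
  moreover have "1 / real n * covariance M (\<lambda>\<omega>. 1 * V n \<omega>) (\<lambda>\<omega>. 1 * V n \<omega>)
      = 2 / ?q\<^sup>2 * ((\<Sum>j=1..n-1. \<Sum>k=1..1*n-1. (rho_hat \<gamma> (int k - int 1 * int j))\<^sup>2) / real n)" for n
  proof -
    have "(\<Sum>j=1..n-1. \<Sum>k=1..n-1. (cov (Y n j) (Y n k))\<^sup>2)
        = (\<Sum>j=1..n-1. \<Sum>k=1..n-1. (rho_hat \<gamma> (int k - int j))\<^sup>2 / ?q\<^sup>2)"
    proof (intro sum.cong refl)
      fix j k assume "j \<in> {1..n-1}" "k \<in> {1..n-1}"
      then show "(cov (Y n j) (Y n k))\<^sup>2 = (rho_hat \<gamma> (int k - int j))\<^sup>2 / ?q\<^sup>2"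
        using rho_hat_minus[of \<gamma> "int k - int j"] by (simp only: cov_Y minus_diff_eq power_divide)
    qed
    then show ?thesis
      unfolding covariance_scaled_V by (simp flip: sum_divide_distrib)
  qed
  ultimately show ?thesis
    by (simp only:)
qed

lemma covariance_coarse_fine_limit:
  "(\<lambda>n. 1 / real n * covariance M (\<lambda>\<omega>. 1 * V n \<omega>) (\<lambda>\<omega>. 1/2 * V (2 * n) \<omega>)) \<longlonglongrightarrow> Sigma12 \<gamma>"
proof -
  let ?q = "4 - 2 powr (2 * \<gamma>)"
  let ?c = "1 / (2 powr (2 * \<gamma>) * ?q\<^sup>2)"
  have "(\<lambda>n. ?c * ((\<Sum>j=1..n-1. \<Sum>k=1..2*n-1. (rho_tilde \<gamma> (int k - int 2 * int j))\<^sup>2) / real n))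
      \<longlonglongrightarrow> ?c * infsum (\<lambda>d. (rho_tilde \<gamma> d)\<^sup>2) UNIV"
    using summable_on_rho_tilde_sq[OF gamma_pos gamma_less_1]
    by (intro tendsto_mult tendsto_const Cesaro_sum_lattice_differences) auto
  moreover have "?c * infsum (\<lambda>d. (rho_tilde \<gamma> d)\<^sup>2) UNIV = Sigma12 \<gamma>"
    by (simp add: Sigma12_def)
  moreover have "1 / real n * covariance M (\<lambda>\<omega>. 1 * V n \<omega>) (\<lambda>\<omega>. 1/2 * V (2 * n) \<omega>)
      = ?c * ((\<Sum>j=1..n-1. \<Sum>k=1..2*n-1. (rho_tilde \<gamma> (int k - int 2 * int j))\<^sup>2) / real n)" for n
  proof -
    have "(2 powr (- \<gamma>))\<^sup>2 = 1 / 2 powr (2 * \<gamma>)"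
      unfolding power2_eq_square powr_add[symmetric] by (simp flip: powr_minus_divide)
    then have "(2 powr (- \<gamma>) * x / ?q)\<^sup>2 = ?c * x\<^sup>2" for x
      by (simp add: power_mult_distrib power_divide)
    then have "(\<Sum>j=1..n-1. \<Sum>k=1..2*n-1. (cov (Y n j) (Y (2 * n) k))\<^sup>2)
        = (\<Sum>j=1..n-1. \<Sum>k=1..2*n-1. ?c * (rho_tilde \<gamma> (int k - int 2 * int j))\<^sup>2)"
      by (intro sum.cong refl) (simp only: cov_Y_coarse_fine)
    then have "covariance M (\<lambda>\<omega>. 1 * V n \<omega>) (\<lambda>\<omega>. 1/2 * V (2 * n) \<omega>)
        = ?c * (\<Sum>j=1..n-1. \<Sum>k=1..2*n-1. (rho_tilde \<gamma> (int k - int 2 * int j))\<^sup>2)"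
      unfolding covariance_scaled_V sum_distrib_left by simp
    then show ?thesis by simp
  qed
  ultimately show ?thesis
    by (simp only:)
qed

lemma covariance_fine_mesh_limit:
  "(\<lambda>n. 1 / real n * covariance M (\<lambda>\<omega>. 1/2 * V (2 * n) \<omega>) (\<lambda>\<omega>. 1/2 * V (2 * n) \<omega>)) \<longlonglongrightarrow> Sigma11 \<gamma> / 2"
proof -
  have "filterlim (\<lambda>n::nat. 2 * n) sequentially sequentially"
    by (rule filterlim_subseq) (auto simp: strict_mono_def)
  from filterlim_compose[OF covariance_same_mesh_limit this]
  have "(\<lambda>n. 1/2 * (1 / real (2 * n) * covariance M (\<lambda>\<omega>. 1 * V (2 * n) \<omega>) (\<lambda>\<omega>. 1 * V (2 * n) \<omega>)))
      \<longlonglongrightarrow> 1/2 * Sigma11 \<gamma>"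
    by (intro tendsto_mult tendsto_const)
  then show ?thesis
    unfolding covariance_scaled_V by (simp add: field_simps)
qed

end

section \<open>Consistency and asymptotic normality of the estimator\<close>

theorem theorem9:
  fixes M :: "'a measure" and M' :: "'b measure"
    and X :: "real \<Rightarrow> 'a \<Rightarrow> real" and B :: "real \<Rightarrow> 'b \<Rightarrow> real"
    and T \<gamma> \<kappa> :: real
  assumes T: "0 < T" and gamma: "0 < \<gamma>" "\<gamma> < 1" and kappa: "0 < \<kappa>"
    and X: "centered_gaussian_process M T X"
    and X0: "AE \<omega> in M. X 0 \<omega> = 0"
    and Orey: "has_Orey_index M T X \<gamma>"
    and C2: "condition_C2 M T X \<kappa> \<gamma>"
    and row_sums: "\<exists>C. \<forall>n\<ge>1. \<forall>i\<in>{1, 2::nat}. max_row_sum M \<kappa> \<gamma> T X (i * n) \<le> C"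
    and B: "fractional_brownian_motion M' T \<gamma> B"
    and cov_lim: "\<And>i j :: nat. i \<in> {1, 2} \<Longrightarrow> j \<in> {1, 2} \<Longrightarrow>
      (\<lambda>n. 1 / real n *
         (covariance M (\<lambda>\<omega>. 1 / real i * quad_var \<kappa> \<gamma> T X (i * n) \<omega>)
                       (\<lambda>\<omega>. 1 / real j * quad_var \<kappa> \<gamma> T X (j * n) \<omega>)
          - covariance M' (\<lambda>\<omega>. 1 / real i * quad_var 1 \<gamma> T B (i * n) \<omega>)
                          (\<lambda>\<omega>. 1 / real j * quad_var 1 \<gamma> T B (j * n) \<omega>))) \<longlonglongrightarrow> 0"
    and mean_lim: "\<And>i :: nat. i \<in> {1, 2} \<Longrightarrow>
      (\<lambda>n. sqrt (real n) *
         (1 / real (i * n) * (\<integral>\<omega>. quad_var \<kappa> \<gamma> T X (i * n) \<omega> \<partial>M) - 1)) \<longlonglongrightarrow> 0"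
  shows "(AE \<omega> in M. (\<lambda>n. gamma_hat T X n \<omega>) \<longlonglongrightarrow> \<gamma>) \<and>
    weak_conv_m
      (\<lambda>n. distr M borel (\<lambda>\<omega>. 2 * ln 2 * sqrt (real n) * (gamma_hat T X n \<omega> - \<gamma>)))
      (normal_law 0 (sqrt (asymp_var \<gamma>)))"
proof -
  have process: "normalized_process M X T \<gamma> \<kappa>"
    using T gamma kappa X by unfold_locales
  interpret normalized_process M X T \<gamma> \<kappa> by fact
  interpret fbm: normalized_fbm M' B T \<gamma>
    using T gamma B by unfold_locales (auto simp: fractional_brownian_motion_def)
  obtain C0 where C0: "\<And>n i. 1 \<le> n \<Longrightarrow> i \<in> {1, 2::nat} \<Longrightarrow> max_row_sum M \<kappa> \<gamma> T X (i * n) \<le> C0"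
    using row_sums by blast
  define C where "C = max 0 C0"
  have C: "0 \<le> C" by (simp add: C_def)
  have rows: "row_bounded {1..N-1} (Y N) C" for N
  proof (cases "N = 0")
    case True
    then show ?thesis by (simp add: row_bounded_def)
  next
    case False
    then have "max_row_sum M \<kappa> \<gamma> T X N \<le> C"
      using C0[of N 1] by (simp add: C_def)
    then show ?thesis
      by (rule max_row_sum_row_bounded[OF process])
  qed

  have var_lim: "(\<lambda>n. cov (fluctuation n) (fluctuation n)) \<longlonglongrightarrow> asymp_var \<gamma>"
  proof -
    have c11: "(\<lambda>n. 1 / real n * covariance M (\<lambda>\<omega>. 1 * V n \<omega>) (\<lambda>\<omega>. 1 * V n \<omega>)) \<longlonglongrightarrow> Sigma11 \<gamma>"
      using tendsto_add[OF cov_lim[of 1 1] fbm.covariance_same_mesh_limit] by (simp add: right_diff_distrib)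
    have c22: "(\<lambda>n. 1 / real n * covariance M (\<lambda>\<omega>. 1/2 * V (2 * n) \<omega>) (\<lambda>\<omega>. 1/2 * V (2 * n) \<omega>)) \<longlonglongrightarrow> Sigma11 \<gamma> / 2"
      using tendsto_add[OF cov_lim[of 2 2] fbm.covariance_fine_mesh_limit] by (simp add: right_diff_distrib)
    have c12: "(\<lambda>n. 1 / real n * covariance M (\<lambda>\<omega>. 1 * V n \<omega>) (\<lambda>\<omega>. 1/2 * V (2 * n) \<omega>)) \<longlonglongrightarrow> Sigma12 \<gamma>"
      using tendsto_add[OF cov_lim[of 1 2] fbm.covariance_coarse_fine_limit] by (simp add: right_diff_distrib)
    have "\<forall>\<^sub>F n in sequentially. cov (fluctuation n) (fluctuation n)
        = 1 / real n * covariance M (\<lambda>\<omega>. 1 * V n \<omega>) (\<lambda>\<omega>. 1 * V n \<omega>)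
          + 1 / real n * covariance M (\<lambda>\<omega>. 1/2 * V (2 * n) \<omega>) (\<lambda>\<omega>. 1/2 * V (2 * n) \<omega>)
          - 2 * (1 / real n * covariance M (\<lambda>\<omega>. 1 * V n \<omega>) (\<lambda>\<omega>. 1/2 * V (2 * n) \<omega>))"
      using eventually_gt_at_top[of 0]
      by eventually_elim (simp only: variance_fluctuation distrib_left right_diff_distrib mult.left_commute)
    moreover have "Sigma11 \<gamma> + Sigma11 \<gamma> / 2 - 2 * Sigma12 \<gamma> = asymp_var \<gamma>"
      by (simp add: asymp_var_def)
    ultimately show ?thesis
      using tendsto_diff[OF tendsto_add[OF c11 c22] tendsto_mult[OF tendsto_const[of 2] c12]]
      by (simp only: tendsto_cong)
  qed
  (* The limit of variances is nonnegative, so the limit law has the standard deviation stated. *)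
  have "0 \<le> asymp_var \<gamma>"
    by (rule LIMSEQ_le_const[OF var_lim]) (auto intro!: exI[of _ 0] integral_nonneg_AE)
  then have s: "0 \<le> sqrt (asymp_var \<gamma>)" "(sqrt (asymp_var \<gamma>))\<^sup>2 = asymp_var \<gamma>"
    by auto

  have adm: "admissible (5 * C) 3 (if n = 0 then 1 else 1 / sqrt (real n)) (grid n) (weight n) (case_prod Y)" for n
    by (rule admissible_grid[OF C rows])
  have mesh: "(\<lambda>n. if n = 0 then 1 else 1 / sqrt (real n)) \<longlonglongrightarrow> 0"
  proof (rule Lim_transform_eventually)
    show "(\<lambda>n. 1 / sqrt (real n)) \<longlonglongrightarrow> 0"
      by (intro tendsto_divide_0[OF tendsto_const] filterlim_at_top_imp_at_infinity
          filterlim_compose[OF sqrt_at_top filterlim_real_sequentially])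
    show "\<forall>\<^sub>F n in sequentially. 1 / sqrt (real n) = (if n = 0 then 1 else 1 / sqrt (real n))"
      using eventually_gt_at_top[of 0] by eventually_elim simp
  qed
  have hm: "has_moments (fluctuation n)" for n
    unfolding fluctuation_def using grid_in_span by (rule has_moments_qform)
  have fluct_meas: "fluctuation n \<in> borel_measurable M" for n
    using hm by (rule has_moments_measurable)
  have moments: "(\<lambda>n. expectation (\<lambda>\<omega>. fluctuation n \<omega> ^ k)) \<longlonglongrightarrow> (\<integral>x. x ^ k \<partial>normal_law 0 (sqrt (asymp_var \<gamma>)))" for k
    unfolding fluctuation_def
    by (rule moments_qform_tendsto_normal[OF _ _ adm mesh]) (use C s var_lim[unfolded fluctuation_def] in auto)
  have char_fluct: "(\<lambda>n. char (distr M borel (fluctuation n)) t) \<longlonglongrightarrow> char (normal_law 0 (sqrt (asymp_var \<gamma>))) t" for t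
  proof (rule char_tendsto_normal_law[OF _ s(1)])
    show "real_distribution (distr M borel (fluctuation n))" for n
      using fluct_meas by (rule real_distribution_distr)
    show "integrable (distr M borel (fluctuation n)) (\<lambda>x. x ^ k)" for n k
      using fluct_meas has_moments_integrable[OF has_moments_power[OF hm]] by (simp add: integrable_distr_eq)
    show "(\<lambda>n. \<integral>x. x ^ k \<partial>distr M borel (fluctuation n)) \<longlonglongrightarrow> (\<integral>x. x ^ k \<partial>normal_law 0 (sqrt (asymp_var \<gamma>)))" for k
      using moments[of k] fluct_meas by (simp add: integral_distr)
  qed

  define x where "x N \<omega> = V N \<omega> / real N" for N \<omega>
  define m where "m N = expectation (V N) / real N" for N
  have m1: "(\<lambda>n. sqrt (real n) * (m n - 1)) \<longlonglongrightarrow> 0" and m2: "(\<lambda>n. sqrt (real n) * (m (2 * n) - 1)) \<longlonglongrightarrow> 0"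
    using mean_lim[of 1] mean_lim[of 2] by (simp_all add: m_def)
  have double: "filterlim (\<lambda>n::nat. 2 * n) sequentially sequentially"
    by (rule filterlim_subseq) (auto simp: strict_mono_def)
  have rate: "AE \<omega> in M. (\<lambda>N. sqrt (real N) * (x N \<omega> - 1)\<^sup>2) \<longlonglongrightarrow> 0"
    unfolding x_def using AE_quad_var_rate[OF C rows] m1 by (simp add: m_def)
  (* Both conclusions are drawn on the same almost sure event, where the rate of convergence holds. *)
  have main: "AE \<omega> in M. (\<lambda>n. gamma_hat T X n \<omega>) \<longlonglongrightarrow> \<gamma> \<and>
      (\<lambda>n. 2 * ln 2 * sqrt (real n) * (gamma_hat T X n \<omega> - \<gamma>) - fluctuation n \<omega>) \<longlonglongrightarrow> 0"
    using rate
  proof eventually_elim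
    case (elim \<omega>)
    note x1 = log_linearization(1)[OF elim] and lin1 = log_linearization(2)[OF elim]
    have x2: "(\<lambda>n. x (2 * n) \<omega>) \<longlonglongrightarrow> 1"
      by (rule filterlim_compose[OF x1 double])
    have lin2: "(\<lambda>n. sqrt (real n) * (ln (x (2 * n) \<omega>) - (x (2 * n) \<omega> - 1))) \<longlonglongrightarrow> 0"
    proof -
      have "(\<lambda>n. 1 / sqrt 2 * (sqrt (real (2 * n)) * (ln (x (2 * n) \<omega>) - (x (2 * n) \<omega> - 1)))) \<longlonglongrightarrow> 0"
        by (rule tendsto_mult_right_zero[OF filterlim_compose[OF lin1 double]])
      then show ?thesis
        by (simp add: real_sqrt_mult)
    qed
    have pos: "\<forall>\<^sub>F n in sequentially. 0 < n \<and> 0 < V n \<omega> \<and> 0 < V (2 * n) \<omega>"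
      using order_tendstoD(1)[OF x1, of 0, simplified] order_tendstoD(1)[OF x2, of 0, simplified]
        eventually_gt_at_top[of 0]
      by eventually_elim (auto simp: x_def zero_less_divide_iff)
    have est: "\<forall>\<^sub>F n in sequentially. 2 * ln 2 * (gamma_hat T X n \<omega> - \<gamma>) = ln (x n \<omega>) - ln (x (2 * n) \<omega>)"
      using pos by eventually_elim (simp add: gamma_hat_eq x_def)
    have "(\<lambda>n. ln (x n \<omega>) - ln (x (2 * n) \<omega>)) \<longlonglongrightarrow> ln 1 - ln 1"
      by (intro tendsto_diff tendsto_ln x1 x2) auto
    then have "(\<lambda>n. 2 * ln 2 * (gamma_hat T X n \<omega> - \<gamma>)) \<longlonglongrightarrow> 0"
      using est by (simp add: tendsto_cong)
    from tendsto_add[OF tendsto_mult[OF tendsto_const[of "1 / (2 * ln 2)"] this] tendsto_const[of \<gamma>]]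
    have consistent: "(\<lambda>n. gamma_hat T X n \<omega>) \<longlonglongrightarrow> \<gamma>"
      by simp
    have "\<forall>\<^sub>F n in sequentially. 2 * ln 2 * sqrt (real n) * (gamma_hat T X n \<omega> - \<gamma>) - fluctuation n \<omega>
        = sqrt (real n) * (ln (x n \<omega>) - (x n \<omega> - 1)) - sqrt (real n) * (ln (x (2 * n) \<omega>) - (x (2 * n) \<omega> - 1))
          + sqrt (real n) * (m n - 1) - sqrt (real n) * (m (2 * n) - 1)"
      using pos est
    proof eventually_elim
      case (elim n)
      have "fluctuation n \<omega> = sqrt (real n) * ((x n \<omega> - m n) - (x (2 * n) \<omega> - m (2 * n)))"
        using elim(1) by (simp add: fluctuation_eq x_def m_def diff_divide_distrib)
      moreover have "2 * ln 2 * sqrt (real n) * (gamma_hat T X n \<omega> - \<gamma>) = sqrt (real n) * (ln (x n \<omega>) - ln (x (2 * n) \<omega>))"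
        unfolding elim(2)[symmetric] by (simp only: mult_ac)
      ultimately show ?case
        by (simp add: algebra_simps)
    qed
    moreover have "(\<lambda>n. sqrt (real n) * (ln (x n \<omega>) - (x n \<omega> - 1)) - sqrt (real n) * (ln (x (2 * n) \<omega>) - (x (2 * n) \<omega> - 1))
          + sqrt (real n) * (m n - 1) - sqrt (real n) * (m (2 * n) - 1)) \<longlonglongrightarrow> 0"
      using tendsto_diff[OF tendsto_add[OF tendsto_diff[OF lin1 lin2] m1] m2] by simp
    ultimately show ?case
      using consistent by (simp add: tendsto_cong)
  qed

  have est_meas: "(\<lambda>\<omega>. 2 * ln 2 * sqrt (real n) * (gamma_hat T X n \<omega> - \<gamma>)) \<in> borel_measurable M" for n
    using gamma_hat_measurable[of n] by measurable
  have "weak_conv_m (\<lambda>n. distr M borel (\<lambda>\<omega>. 2 * ln 2 * sqrt (real n) * (gamma_hat T X n \<omega> - \<gamma>)))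
      (normal_law 0 (sqrt (asymp_var \<gamma>)))"
  proof (rule levy_continuity)
    show "real_distribution (distr M borel (\<lambda>\<omega>. 2 * ln 2 * sqrt (real n) * (gamma_hat T X n \<omega> - \<gamma>)))" for n
      using est_meas by (rule real_distribution_distr)
    show "real_distribution (normal_law 0 (sqrt (asymp_var \<gamma>)))"
      using s(1) by (rule real_distribution_normal_law)
    show "(\<lambda>n. char (distr M borel (\<lambda>\<omega>. 2 * ln 2 * sqrt (real n) * (gamma_hat T X n \<omega> - \<gamma>))) t)
        \<longlonglongrightarrow> char (normal_law 0 (sqrt (asymp_var \<gamma>))) t" for t
    proof (rule char_tendsto_asymptotically_equal[OF fluct_meas est_meas _ char_fluct])
      show "AE \<omega> in M. (\<lambda>n. 2 * ln 2 * sqrt (real n) * (gamma_hat T X n \<omega> - \<gamma>) - fluctuation n \<omega>) \<longlonglongrightarrow> 0"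
        using main by eventually_elim auto
    qed
  qed
  moreover have "AE \<omega> in M. (\<lambda>n. gamma_hat T X n \<omega>) \<longlonglongrightarrow> \<gamma>"
    using main by eventually_elim auto
  ultimately show ?thesis
    by blast
qed

end
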